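(* For $q=e^{2\pi i\tau}$ with $\operatorname{Im}(\tau)>0$, the following identities hold: \begin{align*} qB_2(q)-2A_2(-q^4)&=q\,\frac{\Theta_{2}}{\Theta_{1}^2}\frac{\Theta_{4}^5\Theta_{16}^2}{\Theta_{8}^5},\\ qB_2(q)+\frac12\mu_2(q^4)&=\frac12\frac{\Theta_{2}}{\Theta_{1}^2}\frac{\Theta_{4}^3\Theta_{8}}{\Theta_{16}^2},\\ qB_2(q)+\frac14\mu_2(q^4)-A_2(-q^4)&=\frac14\frac{\Theta_{2}^6}{\Theta_{1}^{4}}\frac{\Theta_{4}^3}{\Theta_{8}^4}. \end{align*}
   Context: Here $q=e^{2\pi i\tau}$, $\operatorname{Im}(\tau)>0$ (so $0<|q|<1$). Notation: $(x;q)_n=\prod_{i=0}^{n-1}(1-q^ix)$ and $\Theta_m=\prod_{i\ge1}(1-q^{mi})$ for positive integers $m$. The second-order mock theta functions are $$A_2(q)=\sum_{n\ge0}\frac{q^{n+1}(-q^2;q^2)_n}{(q;q^2)_{n+1}}=\sum_{n\ge0}\frac{q^{(n+1)^2}(-q;q^2)_n}{(q;q^2)_{n+1}^2},$$ $$B_2(q)=\sum_{n\ge0}\frac{q^{n}(-q;q^2)_n}{(q;q^2)_{n+1}}=\sum_{n\ge0}\frac{q^{n^2+n}(-q^2;q^2)_n}{(q;q^2)_{n+1}^2},\qquad \mu_2(q)=\sum_{n\ge0}\frac{(-1)^nq^{n^2}(q;q^2)_n}{(-q^2;q^2)_n^2}.$$ *)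

theory Defs
  imports "HOL-Analysis.Analysis"
begin

definition qpoch :: "complex \<Rightarrow> complex \<Rightarrow> nat \<Rightarrow> complex" where
  "qpoch x q n = (\<Prod>i<n. 1 - q ^ i * x)"

text \<open>
  The infinite product starts at exponent \<open>m\<close> (that is, \<open>i \<ge> 1\<close>), hence the \<open>Suc i\<close>.
\<close>

definition Theta :: "nat \<Rightarrow> complex \<Rightarrow> complex" where
  "Theta m q = (\<Prod>i. 1 - q ^ (m * Suc i))"

text \<open>
  The second-order mock theta functions, by their Eulerian series; \<open>A2\<close> and \<open>B2\<close> each have
  two classical Eulerian forms, and the ones with \<open>q ^ (n + 1)\<close> and \<open>q ^ n\<close> in the
  numerator are taken as definitions.  All three series converge for \<open>norm q < 1\<close>; their values
  outside the unit disc carry no meaning.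
\<close>

definition A2 :: "complex \<Rightarrow> complex" where
  "A2 q = (\<Sum>n. q ^ (n + 1) * qpoch (- (q ^ 2)) (q ^ 2) n / qpoch q (q ^ 2) (n + 1))"

definition B2 :: "complex \<Rightarrow> complex" where
  "B2 q = (\<Sum>n. q ^ n * qpoch (- q) (q ^ 2) n / qpoch q (q ^ 2) (n + 1))"

definition mu2 :: "complex \<Rightarrow> complex" where
  "mu2 q = (\<Sum>n. (- 1) ^ n * q ^ (n ^ 2) * qpoch q (q ^ 2) n / (qpoch (- (q ^ 2)) (q ^ 2) n) ^ 2)"

end

theory Submission
  imports Defs "HOL-Computational_Algebra.Polynomial"
begin

text \<open>
  The three series are reduced to Appell--Lerch sums, which are then compared with theta products.

  Fine's transformation (\<open>fine_transformation\<close>) turns the defining series of \<open>A2\<close> and \<open>B2\<close> into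
  series whose terms contain \<open>1 / (q; q\<^sup>2)\<^sub>n\<^sub>+\<^sub>1\<^sup>2\<close>, while those of \<open>mu2\<close> contain
  \<open>1 / (- q\<^sup>2; q\<^sup>2)\<^sub>n\<^sup>2\<close>.  Both factors have finite partial fraction expansions, that is, they are the
  \<open>\<beta>\<close> side of a Bailey pair (\<open>bailey_pair_odd\<close>, \<open>bailey_pair_mu\<close>), and a limiting case of Bailey's
  lemma (\<open>bailey_lemma\<close>) sums them.  With \<open>e k = Q ^ (k (k + 1) / 2) / (1 + Q ^ k)\<close>, \<open>Q = q ^ 4\<close> and
  \<open>P = (Q; Q\<^sup>2)\<^sub>\<infinity> / (Q\<^sup>2; Q\<^sup>2)\<^sub>\<infinity>\<close>, the functions \<open>mu2 Q / 2\<close> and \<open>- 2 A2 (- Q)\<close> are \<open>P\<close> times the sum of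
  \<open>e k\<close> over all even and over all odd integers \<open>k\<close>, respectively.  Similarly, \<open>q B2 q\<close> is a multiple of
  \<open>\<Sum> (- 1) ^ k q ^ (2 k (k + 1) + 1) / (1 - q ^ (2 k + 1))\<close>; multiplying numerator and denominator of each
  term by \<open>1 + q ^ (2 k + 1)\<close> splits this sum into two sums with denominators \<open>1 - q ^ (4 k + 2)\<close>.

  Three of the resulting sums are evaluated by letting \<open>n \<rightarrow> \<infinity>\<close> in partial fraction expansions.
  The limits of the two Bailey pairs give \<open>\<Sum> (- 1) ^ k e k\<close> (\<open>alternating_appell_sum\<close>) and one of the
  two parts of \<open>q B2 q\<close> (\<open>lambert_sum\<close>) as products.  The other part and \<open>\<Sum> e k\<close> are not
  evaluated individually, but they are the contributions of the two families of poles of a single quotient of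
  theta products, so that a linear combination of them is a product
  (\<open>appell_square_lambert_relation\<close>).  This combination is the one that occurs in
  \<open>2 q B2 q + mu2 Q / 2 - 2 A2 (- Q)\<close>, and \<open>\<Sum> (- 1) ^ k e k\<close> is responsible for \<open>mu2 Q / 2 + 2 A2 (- Q)\<close>.

  What is left are identities between products.  They follow from the dissection
  \<open>\<phi>(q) = \<phi>(q ^ 4) + 2 q \<psi>(q ^ 8)\<close> of Gauss' theta functions (\<open>phi_dissection\<close>); the expansions of \<open>\<phi>\<close> and
  \<open>\<psi>\<close> as power series come from Bailey's lemma applied to the unit pair (\<open>bailey_unit_identity\<close>).
\<close>

section \<open>Finite and infinite \<open>q\<close>-Pochhammer symbols\<close>

text \<open>The infinite \<open>q\<close>-Pochhammer symbol \<open>(x; Q)\<^sub>\<infinity>\<close>, meaningful for \<open>norm Q < 1\<close>.\<close>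

definition qinf :: "complex \<Rightarrow> complex \<Rightarrow> complex" where
  "qinf x Q = (\<Prod>i. 1 - Q ^ i * x)"

lemma qpoch_0 [simp]: "qpoch x Q 0 = 1"
  by (simp add: qpoch_def)

lemma qpoch_Suc: "qpoch x Q (Suc n) = qpoch x Q n * (1 - Q ^ n * x)"
  by (simp add: qpoch_def)

lemma qpoch_Suc_0 [simp]: "qpoch x Q (Suc 0) = 1 - x"
  by (simp add: qpoch_def)

lemma qpoch_add: "qpoch x Q (m + n) = qpoch x Q m * qpoch (x * Q ^ m) Q n"
  by (induction n) (simp_all add: qpoch_Suc power_add mult_ac)

lemma qpoch_Suc_left: "qpoch x Q (Suc n) = (1 - x) * qpoch (x * Q) Q n"
  using qpoch_add[of x Q 1 n] by simp

lemma power_mult_neq_1: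
  fixes x Q :: complex
  assumes "norm Q < 1" "norm x < 1"
  shows "Q ^ i * x \<noteq> 1"
proof
  assume "Q ^ i * x = 1"
  hence "norm (Q ^ i) * norm x = 1"
    by (metis norm_mult norm_one)
  moreover have "norm (Q ^ i) * norm x \<le> 1 * norm x"
    by (intro mult_right_mono) (use assms in \<open>auto simp: norm_power power_le_one\<close>)
  ultimately show False using assms by simp
qed

lemma convergent_prod_qinf:
  fixes x Q :: complex
  assumes "norm Q < 1"
  shows "convergent_prod (\<lambda>i. 1 - Q ^ i * x)"
proof -
  have "summable (\<lambda>i. norm (Q ^ i * x))"
    unfolding norm_mult norm_power
    by (intro summable_mult2 summable_geometric) (use assms in simp)
  hence "summable (\<lambda>i. norm ((1 - Q ^ i * x) - 1))"
    by simp
  thus ?thesis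
    by (intro abs_convergent_prod_imp_convergent_prod summable_imp_abs_convergent_prod)
qed

lemma qpoch_tendsto:
  assumes "norm Q < 1"
  shows "qpoch x Q \<longlonglongrightarrow> qinf x Q"
proof -
  have "(\<lambda>n. \<Prod>i\<le>n. 1 - Q ^ i * x) \<longlonglongrightarrow> qinf x Q"
    unfolding qinf_def by (rule convergent_prod_LIMSEQ[OF convergent_prod_qinf[OF assms]])
  hence "(\<lambda>n. qpoch x Q (Suc n)) \<longlonglongrightarrow> qinf x Q"
    by (simp add: qpoch_def lessThan_Suc_atMost)
  thus ?thesis by (simp add: LIMSEQ_imp_Suc)
qed

lemma qpoch_nonzero:
  assumes "\<And>i. Q ^ i * x \<noteq> 1"
  shows "qpoch x Q n \<noteq> 0"
  using assms by (simp add: qpoch_def)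

lemma qinf_nonzero:
  assumes "norm Q < 1" "\<And>i. Q ^ i * x \<noteq> 1"
  shows "qinf x Q \<noteq> 0"
  unfolding qinf_def
  by (rule prodinf_nonzero[OF convergent_prod_qinf[OF assms(1)]]) (use assms(2) in simp)

lemma qinf_nonzero':
  assumes "norm Q < 1" "norm x < 1"
  shows "qinf x Q \<noteq> 0"
  using assms power_mult_neq_1 qinf_nonzero by metis

lemma convergent_imp_norm_bounded:
  fixes f :: "nat \<Rightarrow> complex"
  assumes "f \<longlonglongrightarrow> l"
  obtains C where "C > 0" "\<And>n. norm (f n) \<le> C"
  using convergent_imp_Bseq[OF convergentI[OF assms]] unfolding Bseq_def by blast

lemma qpoch_bounded:
  assumes "norm Q < 1"
  obtains C where "C > 0" "\<And>n. norm (qpoch x Q n) \<le> C"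
  using convergent_imp_norm_bounded[OF qpoch_tendsto[OF assms]] by blast

lemma inverse_qpoch_tendsto:
  assumes "norm Q < 1" "\<And>i. Q ^ i * x \<noteq> 1"
  shows "(\<lambda>n. 1 / qpoch x Q n) \<longlonglongrightarrow> 1 / qinf x Q"
  by (intro tendsto_intros qpoch_tendsto qinf_nonzero assms)

lemma inverse_qpoch_bounded:
  assumes "norm Q < 1" "\<And>i. Q ^ i * x \<noteq> 1"
  obtains C where "C > 0" "\<And>n. norm (1 / qpoch x Q n) \<le> C"
  using convergent_imp_norm_bounded[OF inverse_qpoch_tendsto[OF assms]] by blast

lemma qinf_split_prefix:
  assumes "norm Q < 1"
  shows "qinf x Q = qpoch x Q m * qinf (x * Q ^ m) Q"
proof -
  have "(\<lambda>n. qpoch x Q (m + n)) \<longlonglongrightarrow> qinf x Q"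
    using LIMSEQ_ignore_initial_segment[OF qpoch_tendsto[OF assms, of x], of m]
    by (simp add: add.commute)
  moreover have "(\<lambda>n. qpoch x Q m * qpoch (x * Q ^ m) Q n) \<longlonglongrightarrow> qpoch x Q m * qinf (x * Q ^ m) Q"
    by (intro tendsto_intros qpoch_tendsto assms)
  ultimately show ?thesis
    by (metis (no_types, lifting) LIMSEQ_unique ext qpoch_add)
qed

lemma qinf_even_odd:
  assumes "norm Q < 1"
  shows "qinf x (Q\<^sup>2) * qinf (x * Q) (Q\<^sup>2) = qinf x Q"
proof -
  have Q2: "norm (Q\<^sup>2) < 1"
    using assms by (simp add: norm_power power_less_one_iff abs_square_less_1)
  have fin: "qpoch x Q (2 * n) = qpoch x (Q\<^sup>2) n * qpoch (x * Q) (Q\<^sup>2) n" for n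
  proof (induction n)
    case (Suc n)
    have "Q ^ (2 * n) = (Q\<^sup>2) ^ n" "Q ^ Suc (2 * n) = (Q\<^sup>2) ^ n * Q"
      by (simp_all add: power_mult)
    thus ?case using Suc by (simp add: qpoch_Suc mult_ac)
  qed simp
  have "filterlim (\<lambda>n::nat. 2 * n) sequentially sequentially"
    by (rule mult_nat_left_at_top) simp
  from filterlim_compose[OF qpoch_tendsto[OF assms, of x] this]
  have "(\<lambda>n. qpoch x (Q\<^sup>2) n * qpoch (x * Q) (Q\<^sup>2) n) \<longlonglongrightarrow> qinf x Q"
    by (simp add: fin)
  moreover have "(\<lambda>n. qpoch x (Q\<^sup>2) n * qpoch (x * Q) (Q\<^sup>2) n)
      \<longlonglongrightarrow> qinf x (Q\<^sup>2) * qinf (x * Q) (Q\<^sup>2)"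
    by (intro tendsto_intros qpoch_tendsto Q2)
  ultimately show ?thesis using LIMSEQ_unique by blast
qed

lemma qinf_pm:
  assumes "norm Q < 1"
  shows "qinf x Q * qinf (- x) Q = qinf (x\<^sup>2) (Q\<^sup>2)"
proof -
  have Q2: "norm (Q\<^sup>2) < 1"
    using assms by (simp add: norm_power power_less_one_iff abs_square_less_1)
  have fin: "qpoch x Q n * qpoch (- x) Q n = qpoch (x\<^sup>2) (Q\<^sup>2) n" for n
    by (induction n)
      (simp_all add: qpoch_Suc algebra_simps power2_eq_square power_mult_distrib)
  have "(\<lambda>n. qpoch x Q n * qpoch (- x) Q n) \<longlonglongrightarrow> qinf x Q * qinf (- x) Q"
    by (intro tendsto_intros qpoch_tendsto assms)
  moreover have "(\<lambda>n. qpoch x Q n * qpoch (- x) Q n) \<longlonglongrightarrow> qinf (x\<^sup>2) (Q\<^sup>2)"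
    unfolding fin by (rule qpoch_tendsto[OF Q2])
  ultimately show ?thesis using LIMSEQ_unique by blast
qed

lemma Theta_eq_qinf: "Theta m q = qinf (q ^ m) (q ^ m)"
  by (simp only: Theta_def qinf_def power_mult power_Suc2)

section \<open>Growth of Gaussian powers\<close>

lemma zero_choose_two [simp]: "0 choose 2 = 0"
  by (simp add: numeral_2_eq_2)

lemma Suc_choose_two: "Suc n choose 2 = (n choose 2) + n"
  by (simp add: numeral_2_eq_2)

lemma two_times_choose_two: "2 * (n choose 2) = n * (n - 1)"
  by (induction n) (auto simp: Suc_choose_two algebra_simps)

lemma power2_choose_two: "(q\<^sup>2) ^ (n choose 2) = (q::complex) ^ (n * (n - 1))"
  by (metis power_mult two_times_choose_two)

lemma gaussian_summable:
  fixes Q r :: complex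
  assumes "norm Q < 1"
  shows "summable (\<lambda>n. norm (r ^ n * Q ^ (n choose 2)))"
proof -
  have "(\<lambda>n. norm r * norm Q ^ n) \<longlonglongrightarrow> norm r * 0"
    by (intro tendsto_intros LIMSEQ_power_zero) (use assms in simp)
  hence "eventually (\<lambda>n. norm r * norm Q ^ n < 1/2) sequentially"
    by (intro order_tendstoD) auto
  then obtain N where N: "\<And>n. n \<ge> N \<Longrightarrow> norm r * norm Q ^ n < 1/2"
    by (auto simp: eventually_sequentially)
  show ?thesis
  proof (rule summable_ratio_test[of "1/2" N])
    fix n assume "n \<ge> N"
    have "norm (r ^ Suc n * Q ^ (Suc n choose 2)) =
        (norm r * norm Q ^ n) * norm (r ^ n * Q ^ (n choose 2))"
      by (simp add: norm_mult norm_power Suc_choose_two power_add mult_ac)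
    also have "\<dots> \<le> 1/2 * norm (r ^ n * Q ^ (n choose 2))"
      by (intro mult_right_mono) (use N[OF \<open>n \<ge> N\<close>] in auto)
    finally show "norm (norm (r ^ Suc n * Q ^ (Suc n choose 2)))
        \<le> 1/2 * norm (norm (r ^ n * Q ^ (n choose 2)))" by simp
  qed simp
qed

lemma gaussian_tendsto_0:
  fixes Q r :: complex
  assumes "norm Q < 1"
  shows "(\<lambda>n. r ^ n * Q ^ (n choose 2)) \<longlonglongrightarrow> 0"
  using summable_LIMSEQ_zero[OF gaussian_summable[OF assms, of r]]
  by (simp add: tendsto_norm_zero_iff)

lemma gaussian_geometric_bound:
  fixes Q r :: complex
  assumes "norm Q < 1"
  obtains K where "K > 0" "\<And>n. norm (r ^ n * Q ^ (n choose 2)) \<le> K * (1/2) ^ n"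
proof -
  obtain K where K: "K > 0" "\<And>n. norm ((2 * r) ^ n * Q ^ (n choose 2)) \<le> K"
    using convergent_imp_norm_bounded[OF gaussian_tendsto_0[OF assms, of "2 * r"]] by blast
  have "norm (r ^ n * Q ^ (n choose 2)) \<le> K * (1/2) ^ n" for n
    using K(2)[of n] by (simp add: norm_mult norm_power power_mult_distrib field_simps)
  with K(1) that show ?thesis by blast
qed

section \<open>A transformation of Fine\<close>

lemma tannery_sequences:
  fixes f :: "nat \<Rightarrow> nat \<Rightarrow> complex"
  assumes "\<And>k. f k \<longlonglongrightarrow> g k" "\<And>k n. norm (f k n) \<le> M k" "summable M"
  shows "(\<lambda>n. \<Sum>k. f k n) \<longlonglongrightarrow> (\<Sum>k. g k)" and "summable (\<lambda>k. norm (g k))"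
proof -
  have "\<forall>\<^sub>F (k, n) in at_top \<times>\<^sub>F sequentially. norm (f k n) \<le> M k"
    using assms(2) by (intro always_eventually) auto
  from tannerys_theorem[OF assms(1) this assms(3)]
  show "(\<lambda>n. \<Sum>k. f k n) \<longlonglongrightarrow> (\<Sum>k. g k)" "summable (\<lambda>k. norm (g k))"
    by simp_all
qed

lemma fine_series_summable:
  assumes "norm Q < 1" "norm t < 1" "\<And>i. Q ^ i * B \<noteq> 1"
  shows "summable (\<lambda>n. qpoch A Q n / qpoch B Q n * t ^ n)"
proof -
  obtain C where C: "C > 0" "\<And>n. norm (qpoch A Q n) \<le> C"
    using qpoch_bounded[OF assms(1)] by blast
  obtain D where D: "D > 0" "\<And>n. norm (1 / qpoch B Q n) \<le> D"
    using inverse_qpoch_bounded[OF assms(1) assms(3)] by blast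
  show ?thesis
  proof (rule summable_comparison_test')
    show "summable (\<lambda>n. C * D * norm t ^ n)"
      using assms(2) by (intro summable_mult summable_geometric) simp
    fix n
    have "norm (qpoch A Q n / qpoch B Q n * t ^ n) =
        norm (qpoch A Q n) * norm (1 / qpoch B Q n) * norm t ^ n"
      by (simp add: norm_mult norm_divide norm_power)
    also have "\<dots> \<le> C * D * norm t ^ n"
      using C D by (intro mult_right_mono mult_mono) (auto intro: less_imp_le)
    finally show "norm (qpoch A Q n / qpoch B Q n * t ^ n) \<le> C * D * norm t ^ n" .
  qed
qed

text \<open>
  The recursion behind Fine's transformation: multiplied by \<open>1 - t\<close>, the series is an affine
  function of the same series with \<open>(B, t)\<close> replaced by \<open>(B Q, t Q)\<close>.
\<close>

lemma fine_recursion: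
  assumes "norm Q < 1" "norm t < 1" "\<And>i. Q ^ i * B \<noteq> 1"
  shows "(1 - t) * (\<Sum>n. qpoch A Q n / qpoch B Q n * t ^ n) =
         1 + (B - A) * t / (1 - B) * (\<Sum>n. qpoch A Q n / qpoch (B * Q) Q n * (t * Q) ^ n)"
proof -
  define c where "c n = qpoch A Q n / qpoch B Q n * t ^ n" for n
  define d where "d n = qpoch A Q n / qpoch (B * Q) Q n * (t * Q) ^ n" for n
  have sc: "summable c"
    unfolding c_def by (rule fine_series_summable[OF assms])
  have B': "Q ^ i * (B * Q) \<noteq> 1" for i
    using assms(3)[of "Suc i"] by (simp add: mult_ac)
  have tQ: "norm (t * Q) < 1"
    using assms(1,2) mult_right_le_one_le[of "norm t" "norm Q"] by (simp add: norm_mult)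
  have sd: "summable d"
    unfolding d_def by (rule fine_series_summable[OF assms(1) tQ B'])
  have step: "c (Suc n) - t * c n = (B - A) * t / (1 - B) * d n" for n
  proof -
    define a where "a = qpoch A Q n"
    define b where "b = qpoch (B * Q) Q n"
    have nz: "b \<noteq> 0" "1 - B \<noteq> 0" "1 - Q ^ n * B \<noteq> 0"
      using qpoch_nonzero[OF B', of n] assms(3)[of 0] assms(3)[of n] by (auto simp: b_def)
    have e: "qpoch B Q n * (1 - Q ^ n * B) = (1 - B) * b"
      unfolding b_def by (metis qpoch_Suc qpoch_Suc_left)
    hence e': "qpoch B Q n = (1 - B) * b / (1 - Q ^ n * B)"
      using nz by (simp add: field_simps)
    have "c (Suc n) = a * (1 - Q ^ n * A) / ((1 - B) * b) * t ^ Suc n"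
      by (simp add: c_def a_def b_def qpoch_Suc_left[of B] qpoch_Suc[of A])
    moreover have "t * c n = a * (1 - Q ^ n * B) / ((1 - B) * b) * t ^ Suc n"
      by (simp add: c_def a_def e')
    ultimately have "c (Suc n) - t * c n =
        (a * (1 - Q ^ n * A) - a * (1 - Q ^ n * B)) / ((1 - B) * b) * t ^ Suc n"
      by (simp add: diff_divide_distrib left_diff_distrib)
    also have "\<dots> = (B - A) * t / (1 - B) * d n"
      using nz by (simp add: d_def a_def[symmetric] b_def[symmetric] field_simps power_mult_distrib)
    finally show ?thesis .
  qed
  have "(1 - t) * suminf c = 1 + ((\<Sum>n. c (Suc n)) - t * suminf c)"
    using suminf_split_head[OF sc] by (simp add: c_def algebra_simps)
  also have "(\<Sum>n. c (Suc n)) - t * suminf c = (\<Sum>n. c (Suc n) - t * c n)"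
    using suminf_diff[of "\<lambda>n. c (Suc n)" "\<lambda>n. t * c n"] suminf_mult[OF sc, of t] sc
    by (simp add: summable_mult summable_Suc_iff)
  also have "\<dots> = (B - A) * t / (1 - B) * suminf d"
    unfolding step by (rule suminf_mult[OF sd])
  finally show ?thesis
    by (simp add: c_def[abs_def] d_def[abs_def])
qed

theorem fine_transformation:
  assumes "norm Q < 1" "norm t < 1" "A \<noteq> 0" "\<And>i. Q ^ i * B \<noteq> 1"
  shows "(\<Sum>n. qpoch A Q n / qpoch B Q n * t ^ n) =
         (\<Sum>n. qpoch (B / A) Q n * (- A * t) ^ n * Q ^ (n choose 2) / (qpoch B Q n * qpoch t Q (Suc n)))"
proof -
  define F where "F n = (\<Sum>m. qpoch A Q m / qpoch (B * Q ^ n) Q m * (t * Q ^ n) ^ m)" for n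
  define w where "w n = qpoch (B / A) Q n * (- A * t) ^ n * Q ^ (n choose 2)
                          / (qpoch B Q n * qpoch t Q n)" for n
  have t1: "Q ^ i * t \<noteq> 1" for i
    using power_mult_neq_1 assms by blast
  have tn: "norm (t * Q ^ n) \<le> norm t" for n
    using assms by (simp add: norm_mult norm_power mult_right_le_one_le power_le_one)
  have Bn: "Q ^ i * (B * Q ^ n) \<noteq> 1" for i n
    using assms(4)[of "i + n"] by (simp add: power_add mult_ac)
  have F: "F n = 1 / (1 - t * Q ^ n)
             + (B * Q ^ n - A) * (t * Q ^ n) / ((1 - B * Q ^ n) * (1 - t * Q ^ n)) * F (Suc n)" for n
  proof -
    have "(1 - t * Q ^ n) * F n =
        1 + (B * Q ^ n - A) * (t * Q ^ n) / (1 - B * Q ^ n) * F (Suc n)"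
      using fine_recursion[where Q = Q and A = A and B = "B * Q ^ n" and t = "t * Q ^ n"] Bn assms(1) tn[of n] assms(2)
      by (simp add: F_def mult_ac)
    moreover have "1 - t * Q ^ n \<noteq> 0"
      using t1[of n] by (simp add: mult.commute)
    ultimately have "F n = (1 + (B * Q ^ n - A) * (t * Q ^ n) / (1 - B * Q ^ n) * F (Suc n))
        / (1 - t * Q ^ n)"
      by (metis nonzero_mult_div_cancel_left)
    thus ?thesis by (simp add: add_divide_distrib)
  qed
  have wS: "w (Suc n) = w n * ((B * Q ^ n - A) * (t * Q ^ n) / ((1 - B * Q ^ n) * (1 - t * Q ^ n)))" for n
  proof -
    have "w (Suc n) = w n * ((1 - Q ^ n * (B / A)) * (- A) * (t * Q ^ n)
                        / ((1 - B * Q ^ n) * (1 - t * Q ^ n)))"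
      by (simp add: w_def qpoch_Suc Suc_choose_two power_add mult_ac)
    moreover have "(1 - Q ^ n * (B / A)) * (- A) = B * Q ^ n - A"
      using assms(3) by (simp add: field_simps)
    ultimately show ?thesis by (simp only:)
  qed
  have partial: "F 0 = (\<Sum>n<N. w n / (1 - t * Q ^ n)) + w N * F N" for N
  proof (induction N)
    case 0
    then show ?case by (simp add: w_def)
  next
    case (Suc N)
    have "w N * F N = w N / (1 - t * Q ^ N) + w (Suc N) * F (Suc N)"
      unfolding wS by (subst F) (simp add: algebra_simps)
    with Suc show ?case by simp
  qed
  obtain C where C: "C > 0" "\<And>n. norm (qpoch A Q n) \<le> C"
    using qpoch_bounded[OF assms(1)] by blast
  obtain D where D: "D > 0" "\<And>n. norm (1 / qpoch B Q n) \<le> D"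
    using inverse_qpoch_bounded[OF assms(1) assms(4)] by blast
  obtain E where E: "E > 0" "\<And>n. norm (qpoch B Q n) \<le> E"
    using qpoch_bounded[OF assms(1)] by blast
  have bnd: "norm (F n) \<le> C * (E * D) / (1 - norm t)" for n
  proof -
    have *: "norm (qpoch A Q m / qpoch (B * Q ^ n) Q m * (t * Q ^ n) ^ m) \<le> C * (E * D) * norm t ^ m" for m
    proof -
      have "1 / qpoch (B * Q ^ n) Q m = qpoch B Q n * (1 / qpoch B Q (n + m))"
        using qpoch_nonzero[OF assms(4), of n] by (simp add: qpoch_add)
      hence "norm (1 / qpoch (B * Q ^ n) Q m) \<le> E * D"
        using D E by (simp only: norm_mult) (intro mult_mono, auto intro: less_imp_le)
      moreover have "norm (qpoch A Q m / qpoch (B * Q ^ n) Q m * (t * Q ^ n) ^ m) =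
          norm (qpoch A Q m) * norm (1 / qpoch (B * Q ^ n) Q m) * norm (t * Q ^ n) ^ m"
        by (simp add: norm_mult norm_divide norm_power)
      ultimately show ?thesis
        using C(1) C(2)[of m] E(1) D(1) tn[of n]
        by (simp only:) (intro mult_mono power_mono, auto intro: less_imp_le)
    qed
    have "norm (F n) \<le> (\<Sum>m. C * (E * D) * norm t ^ m)"
      unfolding F_def using assms(2) 
      by (intro norm_suminf_le * summable_mult summable_geometric) simp
    also have "\<dots> = C * (E * D) / (1 - norm t)"
      using assms(2) by (subst suminf_mult) (auto simp: suminf_geometric summable_geometric)
    finally show ?thesis .
  qed
  have "w \<longlonglongrightarrow> qinf (B / A) Q * 0 * ((1 / qinf B Q) * (1 / qinf t Q))"
  proof -
    have "(\<lambda>n. qpoch (B / A) Q n * ((- A * t) ^ n * Q ^ (n choose 2))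
            * ((1 / qpoch B Q n) * (1 / qpoch t Q n)))
          \<longlonglongrightarrow> qinf (B / A) Q * 0 * ((1 / qinf B Q) * (1 / qinf t Q))"
      by (intro tendsto_mult qpoch_tendsto gaussian_tendsto_0 inverse_qpoch_tendsto assms t1)
    thus ?thesis by (simp add: w_def[abs_def] mult.assoc)
  qed
  hence w0: "w \<longlonglongrightarrow> 0" by simp
  have "(\<lambda>N. w N * F N) \<longlonglongrightarrow> 0"
  proof (rule Lim_null_comparison)
    show "\<forall>\<^sub>F N in sequentially. norm (w N * F N) \<le> norm (w N) * (C * (E * D) / (1 - norm t))"
      using bnd by (intro always_eventually allI) (simp only: norm_mult, intro mult_left_mono, auto)
    show "(\<lambda>N. norm (w N) * (C * (E * D) / (1 - norm t))) \<longlonglongrightarrow> 0"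
      by (rule tendsto_mult_left_zero[OF tendsto_norm_zero[OF w0]])
  qed
  hence "(\<lambda>N. F 0 - w N * F N) \<longlonglongrightarrow> F 0 - 0"
    by (intro tendsto_intros)
  moreover have "F 0 - w N * F N = (\<Sum>n<N. w n / (1 - t * Q ^ n))" for N
    using partial[of N] by simp
  ultimately have "(\<lambda>n. w n / (1 - t * Q ^ n)) sums F 0"
    by (simp add: sums_def)
  moreover have "w n / (1 - t * Q ^ n) =
      qpoch (B / A) Q n * (- A * t) ^ n * Q ^ (n choose 2) / (qpoch B Q n * qpoch t Q (Suc n))" for n
    by (simp add: w_def qpoch_Suc mult_ac)
  ultimately have "F 0 = (\<Sum>n. qpoch (B / A) Q n * (- A * t) ^ n * Q ^ (n choose 2)
      / (qpoch B Q n * qpoch t Q (Suc n)))"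
    by (simp add: sums_iff)
  thus ?thesis by (simp add: F_def)
qed

section \<open>A limiting case of Bailey's lemma\<close>

text \<open>
  The limit \<open>b \<rightarrow> \<infinity>\<close> of the \<open>q\<close>-Gauss sum, that is, the summation of the series
  \<open>\<^sub>1\<phi>\<^sub>1(a; a b; b)\<close>.  Both sides satisfy the recursion \<open>S b = (1 - b) / (1 - a b) S (b Q)\<close>; for the
  series this holds because the difference of the two sides telescopes.
\<close>

lemma q_gauss_limit:
  assumes Q: "norm Q < 1" and ab: "\<And>i. Q ^ i * (a * b) \<noteq> 1"
  shows "(\<lambda>m. qpoch a Q m * (- b) ^ m * Q ^ (m choose 2) / (qpoch Q Q m * qpoch (a * b) Q m))
           sums (qinf b Q / qinf (a * b) Q)"
proof -
  define T where "T b m = qpoch a Q m * (- b) ^ m * Q ^ (m choose 2) / (qpoch Q Q m * qpoch (a * b) Q m)"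
    for b m
  define S where "S b = (\<Sum>m. T b m)" for b
  have QQ: "Q ^ i * Q \<noteq> 1" for i
    by (rule power_mult_neq_1[OF Q Q])
  obtain C where C: "C > 0" "\<And>n. norm (qpoch a Q n) \<le> C"
    using qpoch_bounded[OF Q] by blast
  obtain D where D: "D > 0" "\<And>n. norm (1 / qpoch Q Q n) \<le> D"
    using inverse_qpoch_bounded[OF Q QQ] by blast
  obtain E where E: "E > 0" "\<And>n. norm (1 / qpoch (a * b) Q n) \<le> E"
    using inverse_qpoch_bounded[OF Q ab] by blast
  obtain G where G: "G > 0" "\<And>n. norm (qpoch (a * b) Q n) \<le> G"
    using qpoch_bounded[OF Q] by blast
  define M where "M m = C * D * (G * E) * norm (b ^ m * Q ^ (m choose 2))" for m
  have sM: "summable M"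
    unfolding M_def by (intro summable_mult gaussian_summable Q)
  have abN: "Q ^ i * (a * (b * Q ^ N)) \<noteq> 1" for i N
    using ab[of "i + N"] by (simp add: power_add mult_ac)
  have bound: "norm (T (b * Q ^ N) m) \<le> M m" for N m
  proof -
    have "1 / qpoch (a * (b * Q ^ N)) Q m = qpoch (a * b) Q N * (1 / qpoch (a * b) Q (N + m))"
      using qpoch_nonzero[OF ab, of N] by (simp add: qpoch_add mult.assoc)
    hence 1: "norm (1 / qpoch (a * (b * Q ^ N)) Q m) \<le> G * E"
      using G E by (simp only: norm_mult) (intro mult_mono, auto intro: less_imp_le)
    have 2: "norm ((- (b * Q ^ N)) ^ m * Q ^ (m choose 2)) \<le> norm (b ^ m * Q ^ (m choose 2))"
    proof -
      have "norm (b * Q ^ N) ^ m \<le> norm b ^ m"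
        using Q by (intro power_mono)
          (auto simp: norm_mult norm_power intro!: mult_right_le_one_le power_le_one)
      thus ?thesis
        by (simp only: norm_mult norm_power norm_minus_cancel) (intro mult_right_mono, auto)
    qed
    have "norm (T (b * Q ^ N) m) = norm (qpoch a Q m) * norm (1 / qpoch Q Q m)
        * norm (1 / qpoch (a * (b * Q ^ N)) Q m) * norm ((- (b * Q ^ N)) ^ m * Q ^ (m choose 2))"
      by (simp add: T_def norm_mult norm_divide)
    also have "\<dots> \<le> M m"
      unfolding M_def using C(1) C(2)[of m] D(1) D(2)[of m] 1 2 E(1) G(1)
      by (intro mult_mono) (auto intro: less_imp_le)
    finally show ?thesis .
  qed
  have sT: "summable (T (b * Q ^ N))" for N
    by (rule summable_comparison_test'[OF sM]) (rule bound)
  have rec: "S (b * Q ^ N) = (1 - b * Q ^ N) / (1 - a * (b * Q ^ N)) * S (b * Q ^ Suc N)" for N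
  proof -
    define c where "c = b * Q ^ N"
    have nz: "1 - a * c * Q ^ m \<noteq> 0" for m
      using abN[of m N] by (auto simp: c_def mult_ac)
    have step: "T c m - (1 - c) / (1 - a * c) * T (c * Q) m
        = T c m * (1 - Q ^ m) - T c (Suc m) * (1 - Q ^ Suc m)" for m
    proof -
      have ne: "qpoch (a * c) Q m \<noteq> 0" "qpoch (a * c * Q) Q m \<noteq> 0" "1 - Q ^ Suc m \<noteq> 0" "1 - a * c \<noteq> 0"
        using qpoch_nonzero[of Q "a * c" m] qpoch_nonzero[of Q "a * c * Q" m]
              nz[of 0] QQ[of m] abN[of _ N] abN[of "Suc _" N]
        by (auto simp: c_def mult_ac)
      have "qpoch (a * c) Q m * (1 - a * c * Q ^ m) = (1 - a * c) * qpoch (a * c * Q) Q m"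
        by (metis qpoch_Suc qpoch_Suc_left mult.commute)
      hence e: "1 / qpoch (a * c * Q) Q m = (1 - a * c) / (qpoch (a * c) Q m * (1 - a * c * Q ^ m))"
        using ne nz[of m] by (simp add: field_simps)
      have pm: "(- (c * Q)) ^ m = (- c) ^ m * Q ^ m"
        by (metis mult_minus_left power_mult_distrib)
      have "T (c * Q) m = qpoch a Q m * (- (c * Q)) ^ m * Q ^ (m choose 2) / qpoch Q Q m
            * (1 / qpoch (a * c * Q) Q m)"
        by (simp add: T_def mult.assoc)
      hence 1: "T (c * Q) m = T c m * (Q ^ m * (1 - a * c) / (1 - a * c * Q ^ m))"
        unfolding e pm by (simp add: T_def mult_ac)
      have "T c (Suc m) = T c m * ((1 - Q ^ m * a) * (- c) * Q ^ m
            / ((1 - Q ^ m * Q) * (1 - Q ^ m * (a * c))))"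
        by (simp add: T_def qpoch_Suc Suc_choose_two power_add mult_ac)
      hence 2: "T c (Suc m) * (1 - Q ^ Suc m)
          = T c m * ((1 - Q ^ m * a) * (- c) * Q ^ m / (1 - a * c * Q ^ m))"
        using ne(3) by (simp add: mult_ac)
      define x where "x = Q ^ m"
      define d where "d = 1 - a * c * x"
      have d: "d \<noteq> 0" using nz[of m] by (simp add: d_def x_def)
      have "x * d = (1 - c) * x + (1 - x * a) * c * x"
        by (simp add: d_def algebra_simps)
      hence x: "x = (1 - c) * x / d + (1 - x * a) * c * x / d"
        using d by (metis add_divide_distrib nonzero_eq_divide_eq)
      have "(1 - c) / (1 - a * c) * T (c * Q) m = T c m * ((1 - c) * x / d)"
        using ne(4) by (simp add: 1 d_def x_def)
      moreover have "T c (Suc m) * (1 - Q ^ Suc m) = - (T c m * ((1 - x * a) * c * x / d))"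
        unfolding 2 d_def x_def by simp
      moreover have "T c m * (1 - Q ^ m) = T c m - T c m * ((1 - c) * x / d) - T c m * ((1 - x * a) * c * x / d)"
        by (subst x_def[symmetric], subst (1) x) (simp only: right_diff_distrib distrib_left mult_1_right diff_diff_eq)
      ultimately show ?thesis by simp
    qed
    have sc: "summable (T c)" "summable (T (c * Q))"
      using sT[of N] sT[of "Suc N"] by (simp_all add: c_def mult_ac)
    have "(\<lambda>m. T c m * (1 - Q ^ m)) \<longlonglongrightarrow> 0 * (1 - 0)"
      by (intro tendsto_intros summable_LIMSEQ_zero sc LIMSEQ_power_zero Q)
    hence "(\<lambda>m. T c m * (1 - Q ^ m) - T c (Suc m) * (1 - Q ^ Suc m)) sums (T c 0 * (1 - Q ^ 0) - 0)"
      by (intro telescope_sums') simp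
    hence "(\<lambda>m. T c m - (1 - c) / (1 - a * c) * T (c * Q) m) sums 0"
      unfolding step by simp
    moreover have "(\<lambda>m. T c m - (1 - c) / (1 - a * c) * T (c * Q) m)
        sums (S c - (1 - c) / (1 - a * c) * S (c * Q))"
      unfolding S_def by (rule sums_diff[OF summable_sums[OF sc(1)] sums_mult[OF summable_sums[OF sc(2)]]])
    ultimately have "S c - (1 - c) / (1 - a * c) * S (c * Q) = 0"
      by (rule sums_unique2[symmetric])
    thus ?thesis by (simp add: c_def mult_ac)
  qed
  have iter: "S b = qpoch b Q N / qpoch (a * b) Q N * S (b * Q ^ N)" for N
  proof (induction N)
    case (Suc N)
    show ?case
      by (subst Suc, subst rec) (simp add: qpoch_Suc mult_ac)
  qed simp
  have "(\<lambda>N. \<Sum>m. T (b * Q ^ N) m) \<longlonglongrightarrow> (\<Sum>m. if m = 0 then 1 else 0)"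
  proof (rule tannery_sequences(1)[where M = M])
    fix m
    show "(\<lambda>N. T (b * Q ^ N) m) \<longlonglongrightarrow> (if m = 0 then 1 else 0)"
    proof (cases "m = 0")
      case False
      have "(\<lambda>N. qpoch a Q m * (- (b * Q ^ N)) ^ m * Q ^ (m choose 2)
              / (qpoch Q Q m * qpoch (a * (b * Q ^ N)) Q m))
            \<longlonglongrightarrow> qpoch a Q m * (- (b * 0)) ^ m * Q ^ (m choose 2)
              / (qpoch Q Q m * (\<Prod>i<m. 1 - Q ^ i * (a * (b * 0))))"
        unfolding qpoch_def[of "a * (b * _)"]
        by (intro tendsto_intros LIMSEQ_power_zero Q)
           (use qpoch_nonzero[OF QQ, of m] in \<open>simp_all\<close>)
      with False show ?thesis by (simp add: T_def zero_power)
    qed (simp add: T_def)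
  qed (use bound sM in auto)
  moreover have "(\<Sum>m. if m = 0 then 1 else 0 :: complex) = 1"
    by (subst suminf_finite[of "{0}"]) auto
  ultimately have "(\<lambda>N. S (b * Q ^ N)) \<longlonglongrightarrow> 1"
    by (simp add: S_def)
  hence "(\<lambda>N. qpoch b Q N / qpoch (a * b) Q N * S (b * Q ^ N)) \<longlonglongrightarrow> qinf b Q / qinf (a * b) Q * 1"
    by (intro tendsto_intros qpoch_tendsto Q qinf_nonzero ab)
  hence "(\<lambda>N::nat. S b) \<longlonglongrightarrow> qinf b Q / qinf (a * b) Q"
    unfolding iter[symmetric] by simp
  hence "S b = qinf b Q / qinf (a * b) Q"
    by (rule LIMSEQ_unique[OF tendsto_const])
  moreover have "T b sums S b"
    using sT[of 0] by (simp add: S_def summable_sums)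
  ultimately show ?thesis
    by (simp add: T_def[abs_def])
qed

lemma sum_triangle_shift:
  fixes f :: "nat \<Rightarrow> nat \<Rightarrow> complex"
  shows "(\<Sum>n<N. \<Sum>k\<le>n. f k (n - k)) = (\<Sum>k<N. \<Sum>m<N - k. f k m)"
proof (induction N)
  case (Suc N)
  have "(\<Sum>k<Suc N. \<Sum>m<Suc N - k. f k m) = (\<Sum>k<Suc N. (\<Sum>m<N - k. f k m) + f k (N - k))"
    by (intro sum.cong) (auto simp: Suc_diff_le less_Suc_eq_le)
  also have "\<dots> = (\<Sum>k<N. \<Sum>m<N - k. f k m) + (\<Sum>k\<le>N. f k (N - k))"
    by (simp add: sum.distrib lessThan_Suc_atMost[symmetric])
  finally show ?case using Suc by simp
qed simp

lemma choose_two_add: "(k + m) choose 2 = (k choose 2) + (m choose 2) + k * m"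
  by (induction m) (auto simp: Suc_choose_two)

text \<open>
  Bailey's lemma with one parameter sent to infinity: a Bailey pair \<open>(a, \<beta>)\<close> relative to \<open>\<rho>\<close>
  gives an identity between a series in \<open>\<beta>\<close> and a series in \<open>a\<close>.  Here \<open>\<gamma> = \<rho> Q / \<alpha>\<close>.
\<close>

theorem bailey_lemma:
  fixes a \<beta> :: "nat \<Rightarrow> complex"
  assumes Q: "norm Q < 1" and \<alpha>: "\<alpha> \<noteq> 0"
    and \<rho>: "\<And>i. Q ^ i * (\<rho> * Q) \<noteq> 1" and \<gamma>: "\<And>i. Q ^ i * \<gamma> \<noteq> 1" "\<alpha> * \<gamma> = \<rho> * Q"
    and a: "\<And>k. norm (a k) \<le> K"
    and \<beta>: "\<And>n. \<beta> n = (\<Sum>k\<le>n. a k / (qpoch Q Q (n - k) * qpoch (\<rho> * Q) Q (n + k)))"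
  shows "(\<lambda>n. qpoch \<alpha> Q n * (- \<gamma>) ^ n * Q ^ (n choose 2) * \<beta> n) sums
         (qinf \<gamma> Q / qinf (\<rho> * Q) Q *
           (\<Sum>k. qpoch \<alpha> Q k / qpoch \<gamma> Q k * (- \<gamma>) ^ k * Q ^ (k choose 2) * a k))"
proof -
  define u where "u k m = a k * (qpoch \<alpha> Q (k + m) * (- \<gamma>) ^ (k + m) * Q ^ ((k + m) choose 2)
      / (qpoch Q Q m * qpoch (\<rho> * Q) Q (2 * k + m)))" for k m
  define v where "v k = qpoch \<alpha> Q k / qpoch \<gamma> Q k * (- \<gamma>) ^ k * Q ^ (k choose 2) * a k
      * (qinf \<gamma> Q / qinf (\<rho> * Q) Q)" for k
  have QQ: "Q ^ i * Q \<noteq> 1" for i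
    by (rule power_mult_neq_1[OF Q Q])
  have inner: "u k sums v k" for k
  proof -
    have e: "\<alpha> * Q ^ k * (\<gamma> * Q ^ k) = \<rho> * Q * Q ^ (2 * k)"
    proof -
      have "\<alpha> * Q ^ k * (\<gamma> * Q ^ k) = \<alpha> * \<gamma> * (Q ^ k * Q ^ k)"
        by (simp add: mult_ac)
      thus ?thesis by (simp only: \<gamma>(2) mult_2 power_add)
    qed
    have "Q ^ i * (\<alpha> * Q ^ k * (\<gamma> * Q ^ k)) \<noteq> 1" for i
      unfolding e using \<rho>[of "i + 2 * k"] by (simp add: power_add mult_ac)
    from q_gauss_limit[OF Q this]
    have "(\<lambda>m. qpoch (\<alpha> * Q ^ k) Q m * (- (\<gamma> * Q ^ k)) ^ m * Q ^ (m choose 2)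
            / (qpoch Q Q m * qpoch (\<rho> * Q * Q ^ (2 * k)) Q m))
          sums (qinf (\<gamma> * Q ^ k) Q / qinf (\<rho> * Q * Q ^ (2 * k)) Q)"
      by (simp only: e)
    hence "(\<lambda>m. a k * (qpoch \<alpha> Q k * (- \<gamma>) ^ k * Q ^ (k choose 2) / qpoch (\<rho> * Q) Q (2 * k)) *
            (qpoch (\<alpha> * Q ^ k) Q m * (- (\<gamma> * Q ^ k)) ^ m * Q ^ (m choose 2)
            / (qpoch Q Q m * qpoch (\<rho> * Q * Q ^ (2 * k)) Q m)))
          sums (a k * (qpoch \<alpha> Q k * (- \<gamma>) ^ k * Q ^ (k choose 2) / qpoch (\<rho> * Q) Q (2 * k)) *
            (qinf (\<gamma> * Q ^ k) Q / qinf (\<rho> * Q * Q ^ (2 * k)) Q))"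
      by (rule sums_mult)
    moreover have "a k * (qpoch \<alpha> Q k * (- \<gamma>) ^ k * Q ^ (k choose 2) / qpoch (\<rho> * Q) Q (2 * k)) *
            (qpoch (\<alpha> * Q ^ k) Q m * (- (\<gamma> * Q ^ k)) ^ m * Q ^ (m choose 2)
            / (qpoch Q Q m * qpoch (\<rho> * Q * Q ^ (2 * k)) Q m)) = u k m" for m
    proof -
      have "(- (\<gamma> * Q ^ k)) ^ m = (- \<gamma>) ^ m * Q ^ (k * m)"
        by (metis mult_minus_left power_mult_distrib power_mult)
      thus ?thesis
        by (simp add: u_def qpoch_add choose_two_add power_add mult_ac)
    qed
    moreover have "a k * (qpoch \<alpha> Q k * (- \<gamma>) ^ k * Q ^ (k choose 2) / qpoch (\<rho> * Q) Q (2 * k)) *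
            (qinf (\<gamma> * Q ^ k) Q / qinf (\<rho> * Q * Q ^ (2 * k)) Q) = v k"
      using qpoch_nonzero[OF \<gamma>(1), of k]
      by (simp add: v_def qinf_split_prefix[OF Q, of \<gamma> k] qinf_split_prefix[OF Q, of "\<rho> * Q" "2 * k"])
    ultimately show ?thesis by simp
  qed
  obtain C where C: "C > 0" "\<And>n. norm (qpoch \<alpha> Q n) \<le> C"
    using qpoch_bounded[OF Q] by blast
  obtain D where D: "D > 0" "\<And>n. norm (1 / qpoch Q Q n) \<le> D"
    using inverse_qpoch_bounded[OF Q QQ] by blast
  obtain E where E: "E > 0" "\<And>n. norm (1 / qpoch (\<rho> * Q) Q n) \<le> E"
    using inverse_qpoch_bounded[OF Q \<rho>] by blast
  obtain G where G: "G > 0" "\<And>n. norm ((- \<gamma>) ^ n * Q ^ (n choose 2)) \<le> G * (1/2) ^ n"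
    using gaussian_geometric_bound[OF Q] by blast
  have K: "K \<ge> 0" using a[of 0] norm_ge_zero order_trans by blast
  define L where "L = K * (C * G * (D * E))"
  have ub: "norm (u k m) \<le> L * (1/2) ^ k * (1/2) ^ m" for k m
  proof -
    have "norm (u k m) = norm (a k) * (norm (qpoch \<alpha> Q (k + m))
        * norm ((- \<gamma>) ^ (k + m) * Q ^ ((k + m) choose 2))
        * (norm (1 / qpoch Q Q m) * norm (1 / qpoch (\<rho> * Q) Q (2 * k + m))))"
      by (simp add: u_def norm_mult norm_divide)
    also have "\<dots> \<le> K * (C * (G * (1/2) ^ (k + m)) * (D * E))"
      using K a[of k] C(1) C(2)[of "k + m"] G(1) G(2)[of "k + m"] D(1) D(2)[of m] E(1) E(2)[of "2 * k + m"]
      by (intro mult_mono) (auto intro: less_imp_le)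
    finally show ?thesis by (simp add: L_def power_add mult_ac)
  qed
  have L: "L \<ge> 0" using K C(1) D(1) E(1) G(1) by (simp add: L_def)
  have half: "summable (\<lambda>m. (1/2 :: real) ^ m)" "(\<Sum>m. (1/2 :: real) ^ m) = 2"
    by (simp_all add: suminf_geometric)
  have lim: "(\<lambda>N. \<Sum>m<N - k. u k m) \<longlonglongrightarrow> v k" for k
  proof -
    have "filterlim (\<lambda>N. N - k) sequentially sequentially"
      by (rule filterlim_minus_const_nat_at_top)
    from filterlim_compose[OF inner[of k, unfolded sums_def] this]
    show ?thesis .
  qed
  have bound: "norm (\<Sum>m<N - k. u k m) \<le> L * (1/2) ^ k * 2" for k N
  proof -
    have "norm (\<Sum>m<N - k. u k m) \<le> (\<Sum>m<N - k. L * (1/2) ^ k * (1/2) ^ m)"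
      by (intro sum_norm_le ub)
    also have "\<dots> = L * (1/2) ^ k * (\<Sum>m<N - k. (1/2) ^ m)"
      by (simp add: sum_distrib_left)
    also have "\<dots> \<le> L * (1/2) ^ k * 2"
      using L sum_le_suminf[OF half(1), of "{..<N - k}"] half(2) by (intro mult_left_mono) auto
    finally show ?thesis .
  qed
  have sL: "summable (\<lambda>k. L * (1/2) ^ k * 2)"
    by (intro summable_mult2 summable_mult half)
  have "(\<lambda>N. \<Sum>k. \<Sum>m<N - k. u k m) \<longlonglongrightarrow> (\<Sum>k. v k)"
    by (rule tannery_sequences(1)[OF lim bound sL])
  moreover have "(\<Sum>k. \<Sum>m<N - k. u k m)
      = (\<Sum>n<N. qpoch \<alpha> Q n * (- \<gamma>) ^ n * Q ^ (n choose 2) * \<beta> n)" for N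
  proof -
    have "(\<Sum>k. \<Sum>m<N - k. u k m) = (\<Sum>k<N. \<Sum>m<N - k. u k m)"
      by (intro suminf_finite) auto
    also have "\<dots> = (\<Sum>n<N. \<Sum>k\<le>n. u k (n - k))"
      by (rule sum_triangle_shift[symmetric])
    also have "\<dots> = (\<Sum>n<N. qpoch \<alpha> Q n * (- \<gamma>) ^ n * Q ^ (n choose 2) * \<beta> n)"
    proof (intro sum.cong refl)
      fix n
      have "u k (n - k) = qpoch \<alpha> Q n * (- \<gamma>) ^ n * Q ^ (n choose 2)
          * (a k / (qpoch Q Q (n - k) * qpoch (\<rho> * Q) Q (n + k)))" if "k \<le> n" for k
      proof -
        have *: "k + (n - k) = n" "2 * k + (n - k) = n + k" using that by auto
        show ?thesis unfolding u_def * by simp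
      qed
      thus "(\<Sum>k\<le>n. u k (n - k)) = qpoch \<alpha> Q n * (- \<gamma>) ^ n * Q ^ (n choose 2) * \<beta> n"
        unfolding \<beta> sum_distrib_left by (intro sum.cong) auto
    qed
    finally show ?thesis .
  qed
  ultimately have "(\<lambda>n. qpoch \<alpha> Q n * (- \<gamma>) ^ n * Q ^ (n choose 2) * \<beta> n) sums (\<Sum>k. v k)"
    by (simp add: sums_def)
  moreover have "(\<Sum>k. v k) = qinf \<gamma> Q / qinf (\<rho> * Q) Q *
           (\<Sum>k. qpoch \<alpha> Q k / qpoch \<gamma> Q k * (- \<gamma>) ^ k * Q ^ (k choose 2) * a k)"
  proof -
    have nz: "qinf \<gamma> Q / qinf (\<rho> * Q) Q \<noteq> 0"
      using qinf_nonzero[OF Q \<gamma>(1)] qinf_nonzero[OF Q \<rho>] by simp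
    have "summable (\<lambda>k. v k)"
      by (rule summable_norm_cancel, rule tannery_sequences(2)[OF lim bound sL])
    hence "(\<Sum>k. v k / (qinf \<gamma> Q / qinf (\<rho> * Q) Q)) = (\<Sum>k. v k) / (qinf \<gamma> Q / qinf (\<rho> * Q) Q)"
      by (rule suminf_divide)
    moreover have "v k / (qinf \<gamma> Q / qinf (\<rho> * Q) Q) =
        qpoch \<alpha> Q k / qpoch \<gamma> Q k * (- \<gamma>) ^ k * Q ^ (k choose 2) * a k" for k
      unfolding v_def by (rule nonzero_mult_div_cancel_right[OF nz])
    ultimately show ?thesis
      using nz by (simp add: nonzero_eq_divide_eq mult.commute)
  qed
  ultimately show ?thesis by simp
qed

section \<open>Partial fractions and Bailey pairs\<close>

text \<open>
  Partial fraction expansion (equivalently, Lagrange interpolation) with simple poles at the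
  roots \<open>y j\<close> of linear factors \<open>\<alpha> j - \<beta> j * w\<close>.
\<close>

lemma partial_fractions:
  fixes \<alpha> \<beta> y :: "'i \<Rightarrow> complex" and N :: "complex poly"
  assumes fin: "finite I" and deg: "degree N < card I"
    and root: "\<And>j. j \<in> I \<Longrightarrow> \<alpha> j - \<beta> j * y j = 0"
    and nonroot: "\<And>i j. i \<in> I \<Longrightarrow> j \<in> I \<Longrightarrow> i \<noteq> j \<Longrightarrow> \<alpha> j - \<beta> j * y i \<noteq> 0"
    and z: "\<And>j. j \<in> I \<Longrightarrow> \<alpha> j - \<beta> j * z \<noteq> 0"
  shows "(\<Sum>i\<in>I. poly N (y i) / ((\<alpha> i - \<beta> i * z) * (\<Prod>j\<in>I - {i}. \<alpha> j - \<beta> j * y i)))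
         = poly N z / (\<Prod>j\<in>I. \<alpha> j - \<beta> j * z)"
proof -
  define p where "p j = [:\<alpha> j, - \<beta> j:]" for j
  define c where "c i = poly N (y i) / (\<Prod>j\<in>I - {i}. \<alpha> j - \<beta> j * y i)" for i
  define P where "P = (\<Sum>i\<in>I. smult (c i) (\<Prod>j\<in>I - {i}. p j))"
  have poly_p: "poly (p j) w = \<alpha> j - \<beta> j * w" for j w
    by (simp add: p_def mult.commute)
  have poly_P: "poly P w = (\<Sum>i\<in>I. c i * (\<Prod>j\<in>I - {i}. \<alpha> j - \<beta> j * w))" for w
    by (simp add: P_def poly_sum poly_prod poly_p)
  have inj: "inj_on y I"
    by (rule inj_onI) (metis nonroot root)
  have "degree (\<Prod>j\<in>I - {i}. p j) \<le> card I - 1" if "i \<in> I" for i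
  proof -
    have "degree (\<Prod>j\<in>I - {i}. p j) \<le> (\<Sum>j\<in>I - {i}. degree (p j))"
      by (rule order.trans[OF degree_prod_sum_le]) (use fin in \<open>auto simp: o_def\<close>)
    also have "\<dots> \<le> (\<Sum>j\<in>I - {i}. 1)"
      by (intro sum_mono) (auto simp: p_def)
    finally show ?thesis using that fin by simp
  qed
  hence "degree P \<le> card I - 1"
    unfolding P_def by (intro degree_sum_le fin) (use degree_smult_le le_trans in blast)
  hence degP: "degree P < card I"
    using deg by linarith
  have "P = N"
  proof (rule poly_eqI_degree[where A = "y ` I"])
    fix x assume "x \<in> y ` I"
    then obtain k where k: "k \<in> I" "x = y k" by auto
    have "poly P x = (\<Sum>i\<in>I. if i = k then poly N (y k) else 0)"
      unfolding poly_P
    proof (intro sum.cong refl)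
      fix i assume i: "i \<in> I"
      show "c i * (\<Prod>j\<in>I - {i}. \<alpha> j - \<beta> j * x) = (if i = k then poly N (y k) else 0)"
      proof (cases "i = k")
        case True
        have "(\<Prod>j\<in>I - {k}. \<alpha> j - \<beta> j * y k) \<noteq> 0"
          using fin nonroot k by auto
        thus ?thesis by (simp add: True k c_def)
      next
        case False
        hence "(\<Prod>j\<in>I - {i}. \<alpha> j - \<beta> j * x) = 0"
          using fin k root by (intro prod_zero) auto
        thus ?thesis using False by simp
      qed
    qed
    thus "poly P x = poly N x" using fin k by simp
  qed (use degP deg inj in \<open>simp_all add: card_image\<close>)
  hence "poly N z = (\<Sum>i\<in>I. c i * (\<Prod>j\<in>I - {i}. \<alpha> j - \<beta> j * z))"
    using poly_P by simp
  hence "poly N z / (\<Prod>j\<in>I. \<alpha> j - \<beta> j * z)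
      = (\<Sum>i\<in>I. c i * (\<Prod>j\<in>I - {i}. \<alpha> j - \<beta> j * z) / (\<Prod>j\<in>I. \<alpha> j - \<beta> j * z))"
    by (simp add: sum_divide_distrib)
  also have "\<dots> = (\<Sum>i\<in>I. poly N (y i) / ((\<alpha> i - \<beta> i * z) * (\<Prod>j\<in>I - {i}. \<alpha> j - \<beta> j * y i)))"
  proof (intro sum.cong refl)
    fix i assume i: "i \<in> I"
    have nz: "(\<Prod>j\<in>I - {i}. \<alpha> j - \<beta> j * z) \<noteq> 0"
      using fin z by auto
    have "(\<Prod>j\<in>I. \<alpha> j - \<beta> j * z) = (\<alpha> i - \<beta> i * z) * (\<Prod>j\<in>I - {i}. \<alpha> j - \<beta> j * z)"
      by (rule prod.remove[OF fin i])
    thus "c i * (\<Prod>j\<in>I - {i}. \<alpha> j - \<beta> j * z) / (\<Prod>j\<in>I. \<alpha> j - \<beta> j * z)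
        = poly N (y i) / ((\<alpha> i - \<beta> i * z) * (\<Prod>j\<in>I - {i}. \<alpha> j - \<beta> j * y i))"
      using nz by (simp add: c_def)
  qed
  finally show ?thesis by simp
qed

lemma prod_lessThan_skip:
  fixes f :: "nat \<Rightarrow> complex"
  assumes "k < n"
  shows "(\<Prod>i\<in>{..<n} - {k}. f i) = (\<Prod>i<k. f i) * (\<Prod>i<n - Suc k. f (Suc k + i))"
proof -
  have "(\<Prod>i<k. f i) * (\<Prod>i<n - Suc k. f (Suc k + i)) = (\<Prod>i<k. f i) * (\<Prod>i\<in>{Suc k..<n}. f i)"
    using prod.shift_bounds_nat_ivl[of f 0 "Suc k" "n - Suc k"] assms
    by (simp add: atLeast0LessThan add.commute)
  also have "\<dots> = (\<Prod>i\<in>{..<k} \<union> {Suc k..<n}. f i)"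
    by (intro prod.union_disjoint[symmetric]) auto
  also have "{..<k} \<union> {Suc k..<n} = {..<n} - {k}"
    using assms by auto
  finally show ?thesis by simp
qed

lemma qpoch_reverse:
  assumes "Q \<noteq> 0" "c \<noteq> 0"
  shows "qpoch (c / Q ^ k) Q k = (- c) ^ k / Q ^ (Suc k choose 2) * qpoch (Q / c) Q k"
proof (induction k)
  case (Suc k)
  have "qpoch (c / Q ^ Suc k) Q (Suc k) = (1 - c / Q ^ Suc k) * qpoch (c / Q ^ k) Q k"
    using assms by (simp add: qpoch_Suc_left)
  moreover have "1 - c / Q ^ Suc k = - c / Q ^ Suc k * (1 - Q ^ k * (Q / c))"
    using assms by (simp add: field_simps)
  moreover have "Q ^ (Suc (Suc k) choose 2) = Q ^ (Suc k choose 2) * Q ^ Suc k"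
    by (metis Suc_choose_two power_add)
  ultimately show ?case
    unfolding Suc by (simp only: qpoch_Suc power_Suc) (simp add: mult_ac)
qed (simp add: Suc_choose_two)

lemma qpoch_shifted_split:
  assumes "Q \<noteq> 0" "c \<noteq> 0" "k \<le> n"
  shows "qpoch (c / Q ^ k) Q n = (- c) ^ k / Q ^ (Suc k choose 2) * qpoch (Q / c) Q k * qpoch c Q (n - k)"
  using qpoch_add[of "c / Q ^ k" Q k "n - k"] qpoch_reverse[OF assms(1,2), of k] assms
  by simp

lemma prod_skip_left:
  assumes "Q \<noteq> 0" "k < n"
  shows "(\<Prod>i\<in>{..<n} - {k}. 1 - Q ^ i / Q ^ k)
         = (- 1) ^ k / Q ^ (Suc k choose 2) * qpoch Q Q k * qpoch Q Q (n - Suc k)"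
proof -
  have "(\<Prod>i\<in>{..<n} - {k}. 1 - Q ^ i / Q ^ k) = qpoch (1 / Q ^ k) Q k * qpoch Q Q (n - Suc k)"
    using assms by (subst prod_lessThan_skip) (auto simp: qpoch_def power_add mult_ac)
  thus ?thesis
    using qpoch_reverse[OF assms(1), of 1 k] by simp
qed

lemma prod_skip_right:
  assumes "k < n" "Q ^ k * x \<noteq> 1"
  shows "(\<Prod>i\<in>{..<n} - {k}. 1 - Q ^ i * x) = qpoch x Q n / (1 - Q ^ k * x)"
  using assms prod.remove[of "{..<n}" k "\<lambda>i. 1 - Q ^ i * x"] by (simp add: qpoch_def)

lemma power_inject_disc:
  fixes Q :: complex
  assumes "norm Q < 1" "Q \<noteq> 0" "Q ^ i = Q ^ j"
  shows "i = j"
proof -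
  have "norm Q ^ i = norm Q ^ j"
    using assms(3) by (metis norm_power)
  thus ?thesis
    using assms power_strict_decreasing[of i j "norm Q"] power_strict_decreasing[of j i "norm Q"]
    by (cases i j rule: linorder_cases) auto
qed

lemma power_neq_1_disc:
  fixes Q :: complex
  assumes "norm Q < 1" "m > 0"
  shows "Q ^ m \<noteq> 1"
proof
  assume "Q ^ m = 1"
  hence "norm Q ^ m = 1" by (metis norm_power norm_one)
  moreover have "norm Q ^ m < 1"
    using assms by (simp add: power_less_one_iff)
  ultimately show False by simp
qed

lemma one_minus_power_nonzero:
  fixes Q :: complex
  assumes "norm Q < 1" "m > 0"
  shows "1 - Q ^ m \<noteq> 0" "1 + Q ^ m \<noteq> 0"
proof -
  show "1 - Q ^ m \<noteq> 0" using power_neq_1_disc[OF assms] by simp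
  show "1 + Q ^ m \<noteq> 0"
  proof
    assume "1 + Q ^ m = 0"
    hence "Q ^ m = -1" by (simp add: eq_neg_iff_add_eq_0 add.commute)
    hence "Q ^ (2 * m) = 1" by (simp add: mult_2 power_add)
    thus False using power_neq_1_disc[of Q "2 * m"] assms by simp
  qed
qed

text \<open>
  The factor that results from folding a bilateral series with terms proportional to
  \<open>(- 1) ^ k Q ^ (k (k - 1) / 2)\<close> to \<open>k \<ge> 0\<close>: the terms of indices \<open>k\<close> and \<open>- k\<close> have quotient \<open>Q ^ k\<close>,
  and the term of index \<open>0\<close> occurs once.
\<close>

definition fold_weight :: "complex \<Rightarrow> nat \<Rightarrow> complex" where
  "fold_weight Q k = (if k = 0 then 1 else 1 + Q ^ k)"

lemma skipped_product_one:
  assumes Q: "norm Q < 1" "Q \<noteq> 0" and k: "k \<le> n"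
  shows "(\<Prod>i\<in>{..<Suc n} - {k}. (1 - Q ^ i / Q ^ k) * (1 - Q ^ i * Q ^ k))
         = (- 1) ^ k * (qpoch Q Q (n - k) * qpoch Q Q (n + k)
             / (Q ^ (Suc k choose 2) * fold_weight Q k))"
proof -
  have left: "(\<Prod>i\<in>{..<Suc n} - {k}. 1 - Q ^ i / Q ^ k)
      = (- 1) ^ k / Q ^ (Suc k choose 2) * qpoch Q Q k * qpoch Q Q (n - k)"
    using prod_skip_left[OF Q(2), of k "Suc n"] k by simp
  have right: "qpoch Q Q k * (\<Prod>i\<in>{..<Suc n} - {k}. 1 - Q ^ i * Q ^ k)
      = qpoch Q Q (n + k) / fold_weight Q k"
  proof (cases k)
    case 0
    have "(\<Prod>i\<in>{..<Suc n} - {0}. 1 - Q ^ i) = qpoch Q Q n"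
      by (subst prod_lessThan_skip) (simp_all add: qpoch_def mult.commute)
    thus ?thesis by (simp add: 0 fold_weight_def)
  next
    case (Suc l)
    have k0: "k > 0" using Suc by simp
    have nz: "1 - Q ^ k \<noteq> 0" "1 + Q ^ k \<noteq> 0"
      using one_minus_power_nonzero[OF Q(1) k0] by blast+
    have sq: "Q ^ k * Q ^ k \<noteq> 1"
      using power_neq_1_disc[OF Q(1), of "k + k"] k0 unfolding power_add by simp
    have "(\<Prod>i\<in>{..<Suc n} - {k}. 1 - Q ^ i * Q ^ k) = qpoch (Q ^ k) Q (Suc n) / (1 - Q ^ k * Q ^ k)"
      by (rule prod_skip_right[OF _ sq]) (use k in simp)
    moreover have "qpoch Q Q k = qpoch Q Q l * (1 - Q ^ k)"
      by (simp add: Suc qpoch_Suc mult.commute)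
    moreover have "qpoch Q Q l * qpoch (Q ^ k) Q (Suc n) = qpoch Q Q (n + k)"
      using qpoch_add[of Q Q l "Suc n"] by (simp add: Suc add.commute)
    ultimately have "qpoch Q Q k * (\<Prod>i\<in>{..<Suc n} - {k}. 1 - Q ^ i * Q ^ k)
        = (1 - Q ^ k) * qpoch Q Q (n + k) / (1 - Q ^ k * Q ^ k)"
      by (simp add: mult_ac)
    also have "1 - Q ^ k * Q ^ k = (1 - Q ^ k) * (1 + Q ^ k)"
      by (simp add: algebra_simps)
    finally show ?thesis using nz k0 by (simp add: fold_weight_def)
  qed
  have "(\<Prod>i\<in>{..<Suc n} - {k}. (1 - Q ^ i / Q ^ k) * (1 - Q ^ i * Q ^ k))
      = (- 1) ^ k / Q ^ (Suc k choose 2) * qpoch Q Q (n - k)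
        * (qpoch Q Q k * (\<Prod>i\<in>{..<Suc n} - {k}. 1 - Q ^ i * Q ^ k))"
    by (simp add: prod.distrib left mult_ac)
  thus ?thesis unfolding right by simp
qed

lemma minus_one_power_div: "1 / ((- 1) ^ k * x) = (- 1) ^ k / (x :: complex)"
  by (cases "even k") simp_all

text \<open>
  Partial fractions in \<open>w = x + 1 / x\<close>, at \<open>w = z\<close>, of a polynomial \<open>N\<close> in \<open>w\<close> divided by
  \<open>\<Prod>\<^sub>i (1 - Q ^ i x) (1 - Q ^ i / x)\<close>; the factors are \<open>1 + Q ^ (2 i) - Q ^ i w\<close>.
\<close>

lemma partial_fractions_one:
  fixes N :: "complex poly"
  assumes Q: "norm Q < 1" "Q \<noteq> 0" and N: "degree N \<le> n"
    and z: "\<And>i. 1 + Q ^ i * Q ^ i - Q ^ i * z \<noteq> 0"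
  shows "(\<Sum>k\<le>n. (- 1) ^ k * Q ^ (Suc k choose 2) * fold_weight Q k * poly N (Q ^ k + 1 / Q ^ k)
            / ((1 + Q ^ k * Q ^ k - Q ^ k * z) * (qpoch Q Q (n - k) * qpoch Q Q (n + k))))
         = poly N z / (\<Prod>i\<le>n. 1 + Q ^ i * Q ^ i - Q ^ i * z)"
proof -
  have factor: "1 + Q ^ j * Q ^ j - Q ^ j * (Q ^ i + 1 / Q ^ i) = (1 - Q ^ j / Q ^ i) * (1 - Q ^ j * Q ^ i)"
    for i j using Q(2) by (simp add: field_simps)
  have nonroot: "(1 - Q ^ j / Q ^ i) * (1 - Q ^ j * Q ^ i) \<noteq> 0" if "i \<noteq> j" for i j
  proof -
    have "Q ^ j \<noteq> Q ^ i" using power_inject_disc[OF Q] that by blast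
    moreover have "Q ^ (j + i) \<noteq> 1" by (rule power_neq_1_disc[OF Q(1)]) (use that in auto)
    ultimately show ?thesis using Q(2) by (auto simp: power_add)
  qed
  have "(\<Sum>k\<in>{..<Suc n}. poly N (Q ^ k + 1 / Q ^ k) / ((1 + Q ^ k * Q ^ k - Q ^ k * z) *
          (\<Prod>j\<in>{..<Suc n} - {k}. 1 + Q ^ j * Q ^ j - Q ^ j * (Q ^ k + 1 / Q ^ k))))
        = poly N z / (\<Prod>j\<in>{..<Suc n}. 1 + Q ^ j * Q ^ j - Q ^ j * z)"
  proof (rule partial_fractions)
    show "degree N < card {..<Suc n}" using N by simp
    show "1 + Q ^ j * Q ^ j - Q ^ j * (Q ^ j + 1 / Q ^ j) = 0" for j
      unfolding factor using Q(2) by simp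
    show "1 + Q ^ j * Q ^ j - Q ^ j * (Q ^ i + 1 / Q ^ i) \<noteq> 0" if "i \<noteq> j" for i j
      unfolding factor by (rule nonroot[OF that])
  qed (use z in auto)
  moreover have "poly N (Q ^ k + 1 / Q ^ k) / ((1 + Q ^ k * Q ^ k - Q ^ k * z) *
          (\<Prod>j\<in>{..<Suc n} - {k}. 1 + Q ^ j * Q ^ j - Q ^ j * (Q ^ k + 1 / Q ^ k)))
      = (- 1) ^ k * Q ^ (Suc k choose 2) * fold_weight Q k * poly N (Q ^ k + 1 / Q ^ k)
            / ((1 + Q ^ k * Q ^ k - Q ^ k * z) * (qpoch Q Q (n - k) * qpoch Q Q (n + k)))"
    if "k \<le> n" for k
  proof -
    have "1 / (\<Prod>j\<in>{..<Suc n} - {k}. 1 + Q ^ j * Q ^ j - Q ^ j * (Q ^ k + 1 / Q ^ k))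
        = (- 1) ^ k * (Q ^ (Suc k choose 2) * fold_weight Q k) / (qpoch Q Q (n - k) * qpoch Q Q (n + k))"
      unfolding factor skipped_product_one[OF Q that] minus_one_power_div by simp
    note inv = this
    have e: "x / (y * (\<Prod>j\<in>{..<Suc n} - {k}. 1 + Q ^ j * Q ^ j - Q ^ j * (Q ^ k + 1 / Q ^ k)))
        = x / y * ((- 1) ^ k * (Q ^ (Suc k choose 2) * fold_weight Q k) / (qpoch Q Q (n - k) * qpoch Q Q (n + k)))"
      for x y
      unfolding inv[symmetric] by simp
    show ?thesis unfolding e by (simp add: mult_ac)
  qed
  ultimately show ?thesis
    by (simp add: lessThan_Suc_atMost del: sum.lessThan_Suc)
qed

text \<open>
  The unit Bailey pair: the expansion of a numerator that vanishes at the point of evaluation.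
  The numerator \<open>w + 2\<close> has degree at most \<open>n\<close> only for \<open>n > 0\<close>.
\<close>

lemma bailey_pair_unit:
  assumes Q: "norm Q < 1" "Q \<noteq> 0"
  shows "(\<Sum>k\<le>n. (- 1) ^ k * Q ^ (k choose 2) * fold_weight Q k / (qpoch Q Q (n - k) * qpoch Q Q (n + k)))
         = (if n = 0 then 1 else 0)"
proof (cases "n = 0")
  case False
  have *: "1 + Q ^ i * Q ^ i - Q ^ i * (- 2) \<noteq> 0" for i
  proof -
    have "1 + Q ^ i \<noteq> 0"
      using one_minus_power_nonzero(2)[OF Q(1), of i] by (cases "i = 0") auto
    moreover have "1 + Q ^ i * Q ^ i - Q ^ i * (- 2) = (1 + Q ^ i) * (1 + Q ^ i)"
      by (simp add: algebra_simps)
    ultimately show ?thesis by simp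
  qed
  have "(\<Sum>k\<le>n. (- 1) ^ k * Q ^ (Suc k choose 2) * fold_weight Q k * poly [:2, 1:] (Q ^ k + 1 / Q ^ k)
            / ((1 + Q ^ k * Q ^ k - Q ^ k * (- 2)) * (qpoch Q Q (n - k) * qpoch Q Q (n + k)))) = 0"
    using False by (subst partial_fractions_one[OF Q _ *]) auto
  moreover have "(- 1) ^ k * Q ^ (Suc k choose 2) * fold_weight Q k * poly [:2, 1:] (Q ^ k + 1 / Q ^ k)
            / ((1 + Q ^ k * Q ^ k - Q ^ k * (- 2)) * (qpoch Q Q (n - k) * qpoch Q Q (n + k)))
      = (- 1) ^ k * Q ^ (k choose 2) * fold_weight Q k / (qpoch Q Q (n - k) * qpoch Q Q (n + k))" for k
  proof -
    have "poly [:2, 1:] (Q ^ k + 1 / Q ^ k) = (1 + Q ^ k * Q ^ k - Q ^ k * (- 2)) / Q ^ k"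
      using Q(2) by (simp add: field_simps)
    thus ?thesis using *[of k] Q(2) by (simp add: Suc_choose_two power_add)
  qed
  ultimately show ?thesis using False by simp
qed (simp add: fold_weight_def)

text \<open>
  Partial fractions of the constant \<open>1\<close> at \<open>x = - 1\<close>.  The factors of index \<open>0\<close> are \<open>1 - x\<close> and
  \<open>1 - 1 / x\<close>, which accounts for the constant \<open>4\<close>.
\<close>

lemma bailey_pair_mu:
  assumes Q: "norm Q < 1" "Q \<noteq> 0"
  shows "(\<Sum>k\<le>n. (if k = 0 then 1 else 4 * (- 1) ^ k * Q ^ (Suc k choose 2) / (1 + Q ^ k))
             / (qpoch Q Q (n - k) * qpoch Q Q (n + k)))
         = 1 / qpoch (- Q) Q n ^ 2"
proof -
  have sq: "1 + Q ^ i * Q ^ i - Q ^ i * (- 2) = (1 + Q ^ i) * (1 + Q ^ i)" for i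
    by (simp add: algebra_simps)
  have nz: "1 + Q ^ i \<noteq> 0" for i
    using one_minus_power_nonzero(2)[OF Q(1), of i] by (cases "i = 0") auto
  have *: "1 + Q ^ i * Q ^ i - Q ^ i * (- 2) \<noteq> 0" for i
    unfolding sq using nz[of i] by simp
  have "(\<Prod>i\<le>n. 1 + Q ^ i * Q ^ i - Q ^ i * (- 2)) = qpoch (- 1) Q (Suc n) ^ 2"
    unfolding sq by (simp add: qpoch_def prod.distrib power2_eq_square lessThan_Suc_atMost del: prod.lessThan_Suc)
  also have "\<dots> = 4 * qpoch (- Q) Q n ^ 2"
    by (simp add: qpoch_Suc_left power_mult_distrib)
  finally have "(\<Sum>k\<le>n. (- 1) ^ k * Q ^ (Suc k choose 2) * fold_weight Q k
            / ((1 + Q ^ k * Q ^ k - Q ^ k * (- 2)) * (qpoch Q Q (n - k) * qpoch Q Q (n + k))))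
      = 1 / (4 * qpoch (- Q) Q n ^ 2)"
    using partial_fractions_one[OF Q _ *, of 1 n] by simp
  hence "(\<Sum>k\<le>n. 4 * ((- 1) ^ k * Q ^ (Suc k choose 2) * fold_weight Q k
            / ((1 + Q ^ k * Q ^ k - Q ^ k * (- 2)) * (qpoch Q Q (n - k) * qpoch Q Q (n + k)))))
      = 1 / qpoch (- Q) Q n ^ 2"
    by (simp only: sum_distrib_left[symmetric]) simp
  moreover have "4 * ((- 1) ^ k * Q ^ (Suc k choose 2) * fold_weight Q k
            / ((1 + Q ^ k * Q ^ k - Q ^ k * (- 2)) * (qpoch Q Q (n - k) * qpoch Q Q (n + k))))
      = (if k = 0 then 1 else 4 * (- 1) ^ k * Q ^ (Suc k choose 2) / (1 + Q ^ k))
             / (qpoch Q Q (n - k) * qpoch Q Q (n + k))" for k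
    unfolding sq using nz[of k] by (simp add: fold_weight_def Suc_choose_two)
  ultimately show ?thesis by simp
qed

text \<open>
  The Bailey pair relative to \<open>q\<^sup>2\<close> (up to normalisation) for base \<open>q\<^sup>2\<close>: partial fractions in
  \<open>x + q\<^sup>2 / x\<close> of \<open>1 / ((x; q\<^sup>2)\<^sub>n\<^sub>+\<^sub>1 (q\<^sup>2 / x; q\<^sup>2)\<^sub>n\<^sub>+\<^sub>1)\<close>, evaluated at the fixed point \<open>x = q\<close> of \<open>x \<rightarrow> q\<^sup>2 / x\<close>.
\<close>

lemma bailey_pair_odd:
  assumes q: "norm q < 1" "q \<noteq> 0"
  shows "(\<Sum>k\<le>n. (- 1) ^ k * q ^ (k * Suc k) * (1 + q ^ (2 * k + 1)) / (1 - q ^ (2 * k + 1))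
             / (qpoch (q\<^sup>2) (q\<^sup>2) (n - k) * qpoch (q\<^sup>2) (q\<^sup>2) (n + k + 1)))
         = 1 / qpoch q (q\<^sup>2) (Suc n) ^ 2"
proof -
  define Q where "Q = q\<^sup>2"
  have Q: "norm Q < 1" "Q \<noteq> 0"
    using q by (auto simp: Q_def norm_power power_less_one_iff abs_square_less_1)
  have qQ: "q ^ (2 * k + 1) = q * Q ^ k" for k
    by (simp add: Q_def power_mult)
  have odd: "1 - q * Q ^ k \<noteq> 0" "1 + q * Q ^ k \<noteq> 0" for k
    using one_minus_power_nonzero[OF q(1), of "2 * k + 1"] unfolding qQ by auto
  have factor: "(1 + Q * Q ^ j * Q ^ j) - Q ^ j * (1 / Q ^ i + Q * Q ^ i)
      = (1 - Q ^ j / Q ^ i) * (1 - Q ^ j * (Q * Q ^ i))"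
    for i j using Q(2) by (simp add: field_simps)
  have at_z: "(1 + Q * Q ^ j * Q ^ j) - Q ^ j * (2 * q) = (1 - q * Q ^ j)\<^sup>2" for j
    by (simp add: Q_def power2_eq_square algebra_simps)
  have nonroot: "(1 - Q ^ j / Q ^ i) * (1 - Q ^ j * (Q * Q ^ i)) \<noteq> 0" if "i \<noteq> j" for i j
  proof -
    have "Q ^ j \<noteq> Q ^ i" using power_inject_disc[OF Q] that by blast
    moreover have "Q ^ (j + Suc i) \<noteq> 1" by (rule power_neq_1_disc[OF Q(1)]) auto
    ultimately show ?thesis using Q(2) by (auto simp: power_add mult_ac)
  qed
  have "(\<Sum>k\<in>{..<Suc n}. poly 1 (1 / Q ^ k + Q * Q ^ k) / (((1 + Q * Q ^ k * Q ^ k) - Q ^ k * (2 * q)) *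
          (\<Prod>j\<in>{..<Suc n} - {k}. (1 + Q * Q ^ j * Q ^ j) - Q ^ j * (1 / Q ^ k + Q * Q ^ k))))
        = poly 1 (2 * q) / (\<Prod>j\<in>{..<Suc n}. (1 + Q * Q ^ j * Q ^ j) - Q ^ j * (2 * q))"
  proof (rule partial_fractions)
    show "1 + Q * Q ^ j * Q ^ j - Q ^ j * (1 / Q ^ j + Q * Q ^ j) = 0" for j
      unfolding factor using Q(2) by simp
    show "1 + Q * Q ^ j * Q ^ j - Q ^ j * (1 / Q ^ i + Q * Q ^ i) \<noteq> 0" if "i \<noteq> j" for i j
      unfolding factor by (rule nonroot[OF that])
    show "1 + Q * Q ^ j * Q ^ j - Q ^ j * (2 * q) \<noteq> 0" for j
      unfolding at_z using odd by simp
  qed auto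
  moreover have "(\<Prod>j\<in>{..<Suc n}. (1 + Q * Q ^ j * Q ^ j) - Q ^ j * (2 * q)) = qpoch q Q (Suc n) ^ 2"
    unfolding at_z by (simp add: qpoch_def prod_power_distrib mult_ac del: prod.lessThan_Suc)
  moreover have "poly 1 (1 / Q ^ k + Q * Q ^ k) / (((1 + Q * Q ^ k * Q ^ k) - Q ^ k * (2 * q)) *
          (\<Prod>j\<in>{..<Suc n} - {k}. (1 + Q * Q ^ j * Q ^ j) - Q ^ j * (1 / Q ^ k + Q * Q ^ k)))
      = (- 1) ^ k * q ^ (k * Suc k) * (1 + q * Q ^ k) / (1 - q * Q ^ k)
             / (qpoch Q Q (n - k) * qpoch Q Q (n + k + 1))" if "k \<le> n" for k
  proof -
    have ne: "1 - Q ^ k * (Q * Q ^ k) \<noteq> 0"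
      using one_minus_power_nonzero(1)[OF Q(1), of "k + Suc k"] by (simp add: power_add mult_ac)
    have "(\<Prod>j\<in>{..<Suc n} - {k}. 1 - Q ^ j * (Q * Q ^ k)) = qpoch (Q * Q ^ k) Q (Suc n) / (1 - Q ^ k * (Q * Q ^ k))"
      using that ne by (intro prod_skip_right) auto
    moreover have "(\<Prod>j\<in>{..<Suc n} - {k}. 1 - Q ^ j / Q ^ k)
        = (- 1) ^ k / Q ^ (Suc k choose 2) * qpoch Q Q k * qpoch Q Q (n - k)"
      using prod_skip_left[OF Q(2), of k "Suc n"] that by simp
    moreover have "qpoch Q Q k * qpoch (Q * Q ^ k) Q (Suc n) = qpoch Q Q (n + k + 1)"
      using qpoch_add[of Q Q k "Suc n"] by (simp add: add_ac)
    ultimately have "(\<Prod>j\<in>{..<Suc n} - {k}. (1 + Q * Q ^ j * Q ^ j) - Q ^ j * (1 / Q ^ k + Q * Q ^ k))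
        = (- 1) ^ k * (qpoch Q Q (n - k) * qpoch Q Q (n + k + 1) / (Q ^ (Suc k choose 2) * (1 - Q ^ k * (Q * Q ^ k))))"
      unfolding factor prod.distrib by (simp add: mult_ac)
    hence e: "1 / (\<Prod>j\<in>{..<Suc n} - {k}. (1 + Q * Q ^ j * Q ^ j) - Q ^ j * (1 / Q ^ k + Q * Q ^ k))
        = (- 1) ^ k * (Q ^ (Suc k choose 2) * (1 - Q ^ k * (Q * Q ^ k)) / (qpoch Q Q (n - k) * qpoch Q Q (n + k + 1)))"
      by (simp only: minus_one_power_div) simp
    have f: "1 - Q ^ k * (Q * Q ^ k) = (1 - q * Q ^ k) * (1 + q * Q ^ k)"
      by (simp add: Q_def power2_eq_square algebra_simps)
    have g: "Q ^ (Suc k choose 2) = q ^ (k * Suc k)"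
      unfolding Q_def power2_choose_two by (simp add: mult.commute)
    have "poly 1 (1 / Q ^ k + Q * Q ^ k) / (((1 + Q * Q ^ k * Q ^ k) - Q ^ k * (2 * q)) *
          (\<Prod>j\<in>{..<Suc n} - {k}. (1 + Q * Q ^ j * Q ^ j) - Q ^ j * (1 / Q ^ k + Q * Q ^ k)))
        = 1 / (1 - q * Q ^ k)\<^sup>2 * (1 / (\<Prod>j\<in>{..<Suc n} - {k}. (1 + Q * Q ^ j * Q ^ j) - Q ^ j * (1 / Q ^ k + Q * Q ^ k)))"
      unfolding at_z by simp
    also have "\<dots> = (- 1) ^ k * q ^ (k * Suc k) * (1 + q * Q ^ k) / (1 - q * Q ^ k)
             / (qpoch Q Q (n - k) * qpoch Q Q (n + k + 1))"
      unfolding e f g using odd[of k] by (simp add: power2_eq_square)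
    finally show ?thesis .
  qed
  ultimately show ?thesis
    unfolding Q_def[symmetric] qQ by (simp add: lessThan_Suc_atMost del: sum.lessThan_Suc)
qed

section \<open>Partial fractions with two families of poles\<close>

lemma qpoch_symmetric_product:
  assumes "Q \<noteq> 0" "c * d = Q" "k \<le> n"
  shows "qpoch (c / Q ^ k) Q n * qpoch (d * Q ^ k) Q l
         = (- c) ^ k / Q ^ (Suc k choose 2) * (qpoch c Q (n - k) * qpoch d Q (k + l))"
proof -
  have c: "c \<noteq> 0" "Q / c = d" using assms by auto
  have "qpoch d Q k * qpoch (d * Q ^ k) Q l = qpoch d Q (k + l)"
    by (rule qpoch_add[symmetric])
  thus ?thesis
    using qpoch_shifted_split[OF assms(1) c(1) assms(3)] by (simp add: c(2) mult_ac)
qed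

text \<open>
  Partial fractions in \<open>w = x + 1 / x\<close>, at \<open>w = 2\<close>, of
  \<open>(-p x, -p / x; Q)\<^sub>n / ((-x; Q)\<^sub>n\<^sub>+\<^sub>1 (-1 / x; Q)\<^sub>n\<^sub>+\<^sub>1 (p x, p / x; Q)\<^sub>n)\<close> with \<open>Q = p\<^sup>2\<close>.
  The poles at \<open>x = - Q ^ m\<close> and those at \<open>x = p Q ^ k\<close> contribute one sum each.  Both families are
  indexed by a sum type.
\<close>

lemma mixed_partial_fractions:
  assumes p: "norm p < 1" "p \<noteq> 0" and Q_def: "Q = p\<^sup>2"
  shows "(\<Sum>m\<le>n. (if m = 0 then 1/4 else Q ^ (Suc m choose 2) / (1 + Q ^ m)) *
            (qpoch p Q (n - m) / (qpoch (- p) Q (n - m) * qpoch Q Q (n - m)) *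
             (qpoch p Q (n + m) / (qpoch (- p) Q (n + m) * qpoch Q Q (n + m)))))
       + (\<Sum>k<n. 2 * (- 1) ^ k * p ^ (Suc k ^ 2) / (1 - p * Q ^ k) *
            (qpoch (- Q) Q (n - Suc k) / (qpoch (- p) Q (Suc (n - Suc k)) * qpoch Q Q (n - Suc k)) *
             (qpoch (- Q) Q (n + k) / (qpoch (- p) Q (Suc (n + k)) * qpoch Q Q (n + k)))))
       = qpoch (- p) Q n ^ 2 / (4 * qpoch (- Q) Q n ^ 2 * qpoch p Q n ^ 2)"
proof -
  have Q: "norm Q < 1" "Q \<noteq> 0"
    using p by (auto simp: Q_def norm_power power_less_one_iff abs_square_less_1)
  have pp: "p * p = Q" by (simp add: Q_def power2_eq_square)
  have Qpow: "Q ^ k = p ^ (2 * k)" for k by (simp add: Q_def power_mult)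
  have plus_one: "1 + Q ^ m \<noteq> 0" for m
    using one_minus_power_nonzero(2)[OF Q(1), of m] by (cases "m = 0") auto
  have odd: "1 - p * Q ^ k \<noteq> 0" "1 + p * Q ^ k \<noteq> 0" for k
    using one_minus_power_nonzero[OF p(1), of "Suc (2 * k)"] by (auto simp: Qpow)
  have parity: "p * Q ^ k + Q ^ j \<noteq> 0" for j k
  proof
    assume "p * Q ^ k + Q ^ j = 0"
    hence "p ^ Suc (2 * k) = - (p ^ (2 * j))" by (simp add: Qpow eq_neg_iff_add_eq_0)
    hence "(p ^ Suc (2 * k)) ^ 2 = (p ^ (2 * j)) ^ 2" by simp
    hence "p ^ (Suc (2 * k) * 2) = p ^ (2 * j * 2)" by (simp only: power_mult)
    hence "Suc (2 * k) * 2 = 2 * j * 2" by (rule power_inject_disc[OF p])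
    thus False by presburger
  qed
  define \<alpha> :: "nat + nat \<Rightarrow> complex" where
    "\<alpha> = case_sum (\<lambda>j. 1 + Q ^ j * Q ^ j) (\<lambda>j. 1 + Q * Q ^ j * Q ^ j)"
  define \<beta> :: "nat + nat \<Rightarrow> complex" where
    "\<beta> = case_sum (\<lambda>j. - (Q ^ j)) (\<lambda>j. p * Q ^ j)"
  define y :: "nat + nat \<Rightarrow> complex" where
    "y = case_sum (\<lambda>m. - (Q ^ m + 1 / Q ^ m)) (\<lambda>k. p * Q ^ k + 1 / (p * Q ^ k))"
  define F where "F j w = \<alpha> j - \<beta> j * w" for j w
  define N where "N = (\<Prod>i<n. [:1 + Q * Q ^ i * Q ^ i, p * Q ^ i:])"
  define I :: "(nat + nat) set" where "I = {..<Suc n} <+> {..<n}"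
  note defs = F_def \<alpha>_def \<beta>_def y_def
  have F_ll: "F (Inl j) (y (Inl m)) = (1 - Q ^ j / Q ^ m) * (1 - Q ^ j * Q ^ m)" for j m
    using Q(2) by (simp add: defs field_simps)
  have F_rl: "F (Inr j) (y (Inl m)) = (1 - Q ^ j * (- p / Q ^ m)) * (1 - Q ^ j * (- p * Q ^ m))" for j m
    using Q(2) by (simp add: defs field_simps pp[symmetric])
  have F_lr: "F (Inl j) (y (Inr k)) = (1 - Q ^ j * (- p / Q ^ Suc k)) * (1 - Q ^ j * (- p * Q ^ k))" for j k
    using Q(2) p(2) by (simp add: defs field_simps pp[symmetric])
  have F_rr: "F (Inr j) (y (Inr k)) = (1 - Q ^ j / Q ^ k) * (1 - Q ^ j * (Q * Q ^ k))" for j k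
    using Q(2) p(2) by (simp add: defs field_simps pp[symmetric])
  have F_l2: "F (Inl j) 2 = (1 + Q ^ j)\<^sup>2" for j
    by (simp add: defs power2_eq_square algebra_simps)
  have F_r2: "F (Inr j) 2 = (1 - p * Q ^ j)\<^sup>2" for j
    by (simp add: defs power2_eq_square algebra_simps pp[symmetric])
  have N_l: "poly N (y (Inl m)) = qpoch (p / Q ^ m) Q n * qpoch (p * Q ^ m) Q n" for m
  proof -
    have "1 + Q * Q ^ i * Q ^ i + y (Inl m) * (p * Q ^ i) = (1 - Q ^ i * (p / Q ^ m)) * (1 - Q ^ i * (p * Q ^ m))" for i
      using Q(2) by (simp add: defs field_simps pp[symmetric])
    thus ?thesis by (simp add: N_def poly_prod qpoch_def prod.distrib)
  qed
  have N_r: "poly N (y (Inr k)) = qpoch (- 1 / Q ^ k) Q n * qpoch (- Q * Q ^ k) Q n" for k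
  proof -
    have "1 + Q * Q ^ i * Q ^ i + y (Inr k) * (p * Q ^ i) = (1 - Q ^ i * (- 1 / Q ^ k)) * (1 - Q ^ i * (- Q * Q ^ k))" for i
      using Q(2) p(2) by (simp add: defs field_simps pp[symmetric])
    thus ?thesis by (simp add: N_def poly_prod qpoch_def prod.distrib)
  qed
  have N_2: "poly N 2 = qpoch (- p) Q n ^ 2"
  proof -
    have "1 + Q * Q ^ i * Q ^ i + 2 * (p * Q ^ i) = (1 - Q ^ i * - p) ^ 2" for i
      by (simp add: power2_eq_square algebra_simps pp[symmetric])
    thus ?thesis by (simp add: N_def poly_prod qpoch_def prod_power_distrib)
  qed
  have prod_2: "(\<Prod>j\<in>I. F j 2) = 4 * qpoch (- Q) Q n ^ 2 * qpoch p Q n ^ 2"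
  proof -
    have "(\<Prod>j\<in>I. F j 2) = (\<Prod>j<Suc n. (1 + Q ^ j)\<^sup>2) * (\<Prod>j<n. (1 - p * Q ^ j)\<^sup>2)"
      unfolding I_def by (subst prod.Plus) (simp_all only: F_l2 F_r2 finite_lessThan o_def)
    also have "(\<Prod>j<Suc n. (1 + Q ^ j)\<^sup>2) = qpoch (- 1) Q (Suc n) ^ 2"
      by (simp add: qpoch_def prod_power_distrib del: prod.lessThan_Suc)
    also have "\<dots> = 4 * qpoch (- Q) Q n ^ 2"
      by (simp add: qpoch_Suc_left power_mult_distrib)
    also have "(\<Prod>j<n. (1 - p * Q ^ j)\<^sup>2) = qpoch p Q n ^ 2"
      by (simp add: qpoch_def prod_power_distrib mult.commute)
    finally show ?thesis .
  qed
  have main: "(\<Sum>i\<in>I. poly N (y i) / (F i 2 * (\<Prod>j\<in>I - {i}. F j (y i)))) = poly N 2 / (\<Prod>j\<in>I. F j 2)"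
    unfolding F_def
  proof (rule partial_fractions)
    show "finite I" by (simp add: I_def)
    have "degree N \<le> (\<Sum>i<n. degree [:1 + Q * Q ^ i * Q ^ i, p * Q ^ i:])"
      unfolding N_def by (rule order.trans[OF degree_prod_sum_le]) (auto simp: o_def)
    also have "\<dots> \<le> (\<Sum>i<n. 1)" by (intro sum_mono) auto
    finally show "degree N < card I" by (simp add: I_def card_Plus)
    show "\<alpha> j - \<beta> j * y j = 0" for j
      using F_ll F_rr Q(2) by (cases j) (auto simp: F_def[symmetric])
    show "\<alpha> j - \<beta> j * 2 \<noteq> 0" for j
      using F_l2 F_r2 plus_one odd by (cases j) (auto simp: F_def[symmetric])
    show "\<alpha> j - \<beta> j * y i \<noteq> 0" if "i \<noteq> j" for i j
    proof -
      have 1: "1 - Q ^ j / Q ^ i \<noteq> 0" if "j \<noteq> i" for i j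
        using power_inject_disc[OF Q, of j i] that Q(2) by auto
      have 2: "1 - Q ^ j * Q ^ i \<noteq> 0" if "j \<noteq> i" for i j
        using power_neq_1_disc[OF Q(1), of "j + i"] that unfolding power_add by auto
      have 3: "1 - Q ^ j * (Q * Q ^ i) \<noteq> 0" for i j
        using power_neq_1_disc[OF Q(1), of "j + Suc i"] unfolding power_add by auto
      have 4: "1 - Q ^ j * (- p * Q ^ i) \<noteq> 0" for i j
        using odd(2)[of "j + i"] unfolding power_add by (simp add: mult_ac)
      have 5: "1 - Q ^ j * (- p / Q ^ i) \<noteq> 0" for i j
      proof -
        have "1 - Q ^ j * (- p / Q ^ i) = (p * Q ^ j + Q ^ i) / Q ^ i"
          using Q(2) by (simp add: field_simps)
        thus ?thesis using parity[of j i] Q(2) by simp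
      qed
      show ?thesis
        unfolding F_def[symmetric] using that 1 2 3 4 5
        by (cases i; cases j) (simp_all only: F_ll F_rl F_lr F_rr mult_eq_0_iff sum.inject simp_thms)
    qed
  qed
  have term_l: "poly N (y (Inl m)) / (F (Inl m) 2 * (\<Prod>j\<in>I - {Inl m}. F j (y (Inl m))))
      = (if m = 0 then 1/4 else Q ^ (Suc m choose 2) / (1 + Q ^ m)) *
            (qpoch p Q (n - m) / (qpoch (- p) Q (n - m) * qpoch Q Q (n - m)) *
             (qpoch p Q (n + m) / (qpoch (- p) Q (n + m) * qpoch Q Q (n + m))))"
    if m: "m \<le> n" for m
  proof -
    have "I - {Inl m} = ({..<Suc n} - {m}) <+> {..<n}"
      unfolding I_def by auto
    hence "(\<Prod>j\<in>I - {Inl m}. F j (y (Inl m)))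
        = (\<Prod>j\<in>{..<Suc n} - {m}. F (Inl j) (y (Inl m))) * (\<Prod>j<n. F (Inr j) (y (Inl m)))"
      by (simp add: prod.Plus o_def)
    also have "(\<Prod>j\<in>{..<Suc n} - {m}. F (Inl j) (y (Inl m)))
        = (- 1) ^ m * (qpoch Q Q (n - m) * qpoch Q Q (n + m) / (Q ^ (Suc m choose 2) * fold_weight Q m))"
      unfolding F_ll by (rule skipped_product_one[OF Q m])
    also have "(\<Prod>j<n. F (Inr j) (y (Inl m))) = qpoch (- p / Q ^ m) Q n * qpoch (- p * Q ^ m) Q n"
      unfolding F_rl by (simp add: prod.distrib qpoch_def)
    also have "\<dots> = p ^ m / Q ^ (Suc m choose 2) * (qpoch (- p) Q (n - m) * qpoch (- p) Q (n + m))"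
      using qpoch_symmetric_product[OF Q(2), of "- p" "- p" m n n] m pp by (simp add: add.commute)
    finally have D: "(\<Prod>j\<in>I - {Inl m}. F j (y (Inl m)))
        = (- 1) ^ m * (qpoch Q Q (n - m) * qpoch Q Q (n + m) / (Q ^ (Suc m choose 2) * fold_weight Q m)) *
          (p ^ m / Q ^ (Suc m choose 2) * (qpoch (- p) Q (n - m) * qpoch (- p) Q (n + m)))" .
    have E: "poly N (y (Inl m)) = (- 1) ^ m * (p ^ m / Q ^ (Suc m choose 2)) * (qpoch p Q (n - m) * qpoch p Q (n + m))"
      unfolding N_l using qpoch_symmetric_product[OF Q(2), of p p m n n] m pp
      by (simp add: add.commute power_minus[of p])
    have w: "Q ^ (Suc m choose 2) * fold_weight Q m / (1 + Q ^ m)\<^sup>2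
        = (if m = 0 then 1/4 else Q ^ (Suc m choose 2) / (1 + Q ^ m))"
      using plus_one[of m] by (simp add: fold_weight_def Suc_choose_two power2_eq_square)
    have "poly N (y (Inl m)) / (F (Inl m) 2 * (\<Prod>j\<in>I - {Inl m}. F j (y (Inl m))))
        = Q ^ (Suc m choose 2) * fold_weight Q m / (1 + Q ^ m)\<^sup>2 *
          ((qpoch p Q (n - m) * qpoch p Q (n + m)) /
           ((qpoch Q Q (n - m) * qpoch Q Q (n + m)) * (qpoch (- p) Q (n - m) * qpoch (- p) Q (n + m))))"
      unfolding D E F_l2 using p(2) Q(2) by (simp add: mult_ac)
    thus ?thesis unfolding w by (simp add: mult_ac)
  qed
  have term_r: "poly N (y (Inr k)) / (F (Inr k) 2 * (\<Prod>j\<in>I - {Inr k}. F j (y (Inr k))))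
      = 2 * (- 1) ^ k * p ^ (Suc k ^ 2) / (1 - p * Q ^ k) *
            (qpoch (- Q) Q (n - Suc k) / (qpoch (- p) Q (Suc (n - Suc k)) * qpoch Q Q (n - Suc k)) *
             (qpoch (- Q) Q (n + k) / (qpoch (- p) Q (Suc (n + k)) * qpoch Q Q (n + k))))"
    if k: "k < n" for k
  proof -
    have "I - {Inr k} = {..<Suc n} <+> ({..<n} - {k})"
      unfolding I_def by auto
    hence "(\<Prod>j\<in>I - {Inr k}. F j (y (Inr k)))
        = (\<Prod>j<Suc n. F (Inl j) (y (Inr k))) * (\<Prod>j\<in>{..<n} - {k}. F (Inr j) (y (Inr k)))"
      by (simp add: prod.Plus o_def del: prod.lessThan_Suc)
    also have "(\<Prod>j<Suc n. F (Inl j) (y (Inr k)))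
        = qpoch (- p / Q ^ Suc k) Q (Suc n) * qpoch (- p * Q ^ k) Q (Suc n)"
      unfolding F_lr by (simp only: prod.distrib qpoch_def)
    also have "\<dots> = 1 / p ^ (Suc k ^ 2) * (1 + p * Q ^ k)
        * (qpoch (- p) Q (n - k) * qpoch (- p) Q (Suc (n + k)))"
    proof -
      have "qpoch (- p / Q ^ Suc k) Q (Suc n)
          = p ^ Suc k / Q ^ (Suc (Suc k) choose 2) * qpoch (- p) Q (Suc k) * qpoch (- p) Q (n - k)"
      proof -
        have "Q / - p = - p" using p(2) by (simp add: pp[symmetric])
        moreover have "Suc n - Suc k = n - k" "Suc k \<le> Suc n" "- p \<noteq> 0" "- (- p) = p"
          using k p(2) by simp_all
        ultimately show ?thesis
          using qpoch_shifted_split[OF Q(2), of "- p" "Suc k" "Suc n"] by (simp only: simp_thms)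
      qed
      moreover have "qpoch (- p) Q (Suc k) * qpoch (- p * Q ^ k) Q (Suc n)
          = (1 + p * Q ^ k) * qpoch (- p) Q (Suc (n + k))"
        using qpoch_add[of "- p" Q k "Suc n"] by (simp add: qpoch_Suc[of _ _ k] add_ac mult_ac)
      moreover have "p ^ Suc k / Q ^ (Suc (Suc k) choose 2) = 1 / p ^ (Suc k ^ 2)"
      proof -
        have "Q ^ (Suc (Suc k) choose 2) = p ^ (Suc (Suc k) * Suc k)"
          unfolding Q_def power2_choose_two by simp
        also have "Suc (Suc k) * Suc k = Suc k + Suc k ^ 2"
          by (simp add: power2_eq_square)
        finally show ?thesis using p(2) by (simp add: power_add)
      qed
      moreover have "A * D = c' * E * (C * G)" if "A = c * B * C" "B * D = E * G" "c = c'"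
        for A B C D E G c c' :: complex
      proof -
        have "A * D = c * C * (B * D)" using that(1) by (simp add: mult_ac)
        thus ?thesis unfolding that(2,3) by (simp add: mult_ac)
      qed
      ultimately show ?thesis by blast
    qed
    also have "(\<Prod>j\<in>{..<n} - {k}. F (Inr j) (y (Inr k)))
        = (- 1) ^ k / Q ^ (Suc k choose 2) * (qpoch Q Q (n - Suc k) * qpoch Q Q (n + k))
            / ((1 - p * Q ^ k) * (1 + p * Q ^ k))"
    proof -
      have f: "1 - Q ^ k * (Q * Q ^ k) = (1 - p * Q ^ k) * (1 + p * Q ^ k)"
        by (simp add: algebra_simps pp[symmetric])
      hence "Q ^ k * (Q * Q ^ k) \<noteq> 1" using odd[of k] by auto
      hence "(\<Prod>j\<in>{..<n} - {k}. 1 - Q ^ j * (Q * Q ^ k)) = qpoch (Q * Q ^ k) Q n / ((1 - p * Q ^ k) * (1 + p * Q ^ k))"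
        unfolding f[symmetric] by (rule prod_skip_right[OF k])
      moreover have "qpoch Q Q k * qpoch (Q * Q ^ k) Q n = qpoch Q Q (n + k)"
        using qpoch_add[of Q Q k n] by (simp add: add.commute)
      ultimately show ?thesis
        unfolding F_rr prod.distrib prod_skip_left[OF Q(2) k] by (simp add: mult_ac)
    qed
    finally have D: "(\<Prod>j\<in>I - {Inr k}. F j (y (Inr k)))
        = 1 / p ^ (Suc k ^ 2) * (1 + p * Q ^ k) * (qpoch (- p) Q (n - k) * qpoch (- p) Q (Suc (n + k))) *
          ((- 1) ^ k / Q ^ (Suc k choose 2) * (qpoch Q Q (n - Suc k) * qpoch Q Q (n + k))
            / ((1 - p * Q ^ k) * (1 + p * Q ^ k)))" .
    have nk: "n - k = Suc (n - Suc k)" using k by simp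
    have "qpoch (- 1) Q (n - k) = 2 * qpoch (- Q) Q (n - Suc k)"
      unfolding nk by (simp add: qpoch_Suc_left)
    hence E: "poly N (y (Inr k)) = 1 / Q ^ (Suc k choose 2) * (2 * qpoch (- Q) Q (n - Suc k) * qpoch (- Q) Q (n + k))"
      unfolding N_r using qpoch_symmetric_product[OF Q(2), of "- 1" "- Q" k n n] k
      by (simp add: add.commute)
    have sgn: "1 / (- 1 :: complex) ^ k = (- 1) ^ k" by (cases "even k") simp_all
    have "poly N (y (Inr k)) / (F (Inr k) 2 * (\<Prod>j\<in>I - {Inr k}. F j (y (Inr k))))
        = 1 / (- 1) ^ k * (2 * p ^ (Suc k ^ 2) / (1 - p * Q ^ k)) *
          ((qpoch (- Q) Q (n - Suc k) * qpoch (- Q) Q (n + k)) /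
           ((qpoch (- p) Q (n - k) * qpoch (- p) Q (Suc (n + k))) * (qpoch Q Q (n - Suc k) * qpoch Q Q (n + k))))"
      unfolding D E F_r2 using p(2) Q(2) odd[of k] by (simp add: power2_eq_square mult_ac)
    thus ?thesis unfolding sgn nk by (simp add: mult_ac)
  qed
  have "(\<Sum>i\<in>I. poly N (y i) / (F i 2 * (\<Prod>j\<in>I - {i}. F j (y i))))
      = (\<Sum>m<Suc n. poly N (y (Inl m)) / (F (Inl m) 2 * (\<Prod>j\<in>I - {Inl m}. F j (y (Inl m)))))
      + (\<Sum>k<n. poly N (y (Inr k)) / (F (Inr k) 2 * (\<Prod>j\<in>I - {Inr k}. F j (y (Inr k)))))"
    by (subst (1) I_def, subst sum.Plus) (simp_all add: o_def del: sum.lessThan_Suc)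
  with main show ?thesis
    unfolding N_2 prod_2 by (simp add: term_l term_r lessThan_Suc_atMost del: sum.lessThan_Suc)
qed

section \<open>Limits of the partial fraction expansions\<close>

lemma summable_bounded_gaussian:
  fixes f :: "nat \<Rightarrow> complex"
  assumes "norm Q < 1" "\<And>k. norm (f k) \<le> C"
  shows "summable (\<lambda>k. norm (f k * (r ^ k * Q ^ (k choose 2))))"
proof (rule summable_comparison_test')
  show "summable (\<lambda>k. C * norm (r ^ k * Q ^ (k choose 2)))"
    by (intro summable_mult gaussian_summable assms)
  show "norm (norm (f k * (r ^ k * Q ^ (k choose 2)))) \<le> C * norm (r ^ k * Q ^ (k choose 2))" for k
    using assms(2)[of k] mult_right_mono[OF assms(2)[of k], of "norm (r ^ k * Q ^ (k choose 2))"]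
    by (simp add: norm_mult)
qed

text \<open>
  The limit of the \<open>\<beta>\<close> side of a Bailey pair, by Tannery's theorem.
\<close>

lemma bailey_sum_tendsto:
  fixes a X Y :: "nat \<Rightarrow> complex"
  assumes a: "summable (\<lambda>k. norm (a k))" and X: "X \<longlonglongrightarrow> x" and Y: "Y \<longlonglongrightarrow> y"
  shows "(\<lambda>n. \<Sum>k\<le>n. a k * (X (n - k) * Y (n + k))) \<longlonglongrightarrow> (\<Sum>k. a k) * (x * y)"
proof -
  obtain C where C: "C > 0" "\<And>n. norm (X n) \<le> C"
    using convergent_imp_norm_bounded[OF X] by blast
  obtain D where D: "D > 0" "\<And>n. norm (Y n) \<le> D"
    using convergent_imp_norm_bounded[OF Y] by blast
  define f where "f k n = (if k \<le> n then a k * (X (n - k) * Y (n + k)) else 0)" for k n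
  have "(\<lambda>n. \<Sum>k. f k n) \<longlonglongrightarrow> (\<Sum>k. a k * (x * y))"
  proof (rule tannery_sequences(1))
    fix k
    have "(\<lambda>n. X (n - k)) \<longlonglongrightarrow> x"
      by (rule filterlim_compose[OF X filterlim_minus_const_nat_at_top])
    moreover have "(\<lambda>n. Y (n + k)) \<longlonglongrightarrow> y"
      by (rule LIMSEQ_ignore_initial_segment[OF Y])
    ultimately have "(\<lambda>n. a k * (X (n - k) * Y (n + k))) \<longlonglongrightarrow> a k * (x * y)"
      by (intro tendsto_intros)
    moreover have "eventually (\<lambda>n. a k * (X (n - k) * Y (n + k)) = f k n) sequentially"
      using eventually_ge_at_top[of k] by eventually_elim (simp add: f_def)
    ultimately show "f k \<longlonglongrightarrow> a k * (x * y)"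
      by (rule Lim_transform_eventually)
  next
    fix k n
    have "norm (a k) * (norm (X (n - k)) * norm (Y (n + k))) \<le> norm (a k) * (C * D)"
      using C(1) C(2)[of "n - k"] D(1) D(2)[of "n + k"]
      by (intro mult_left_mono mult_mono) (auto intro: less_imp_le)
    thus "norm (f k n) \<le> norm (a k) * (C * D)"
      using C(1) D(1) by (simp add: f_def norm_mult)
  qed (intro summable_mult2 a)
  moreover have "(\<Sum>k. f k n) = (\<Sum>k\<le>n. a k * (X (n - k) * Y (n + k)))" for n
  proof -
    have "(\<Sum>k. f k n) = (\<Sum>k\<le>n. f k n)"
      by (intro suminf_finite) (auto simp: f_def)
    also have "\<dots> = (\<Sum>k\<le>n. a k * (X (n - k) * Y (n + k)))"
      by (intro sum.cong) (auto simp: f_def)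
    finally show ?thesis .
  qed
  moreover have "(\<Sum>k. a k * (x * y)) = (\<Sum>k. a k) * (x * y)"
    using summable_norm_cancel[OF a] by (simp add: suminf_mult2)
  ultimately show ?thesis by simp
qed

text \<open>
  The term of index \<open>k\<close> of the series \<open>\<Sum> Q ^ (k (k + 1) / 2) / (1 + Q ^ k)\<close> over all integers.
  It is invariant under \<open>k \<rightarrow> - k\<close>; here the term at \<open>0\<close> is halved, so that the sum over
  \<open>k \<ge> 0\<close> is half of the bilateral one.
\<close>

definition appell_term :: "complex \<Rightarrow> nat \<Rightarrow> complex" where
  "appell_term Q k = (if k = 0 then 1 / 4 else Q ^ (Suc k choose 2) / (1 + Q ^ k))"

lemma appell_term_bounded_form:
  assumes Q: "norm Q < 1"
  obtains f C where "\<And>k. norm (f k) \<le> C" "\<And>k. appell_term Q k = f k * (Q ^ k * Q ^ (k choose 2))"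
proof -
  define f where "f k = (if k = 0 then 1 / 4 else 1 / (1 + Q ^ k))" for k
  have "(\<lambda>k. 1 / (1 + Q ^ k)) \<longlonglongrightarrow> 1 / (1 + 0)"
    by (intro tendsto_intros LIMSEQ_power_zero Q) simp
  moreover have "eventually (\<lambda>k. 1 / (1 + Q ^ k) = f k) sequentially"
    using eventually_gt_at_top[of 0] by eventually_elim (simp add: f_def)
  ultimately have "f \<longlonglongrightarrow> 1 / (1 + 0)"
    by (rule Lim_transform_eventually)
  then obtain C where "\<And>k. norm (f k) \<le> C"
    using convergent_imp_norm_bounded by blast
  moreover have "appell_term Q k = f k * (Q ^ k * Q ^ (k choose 2))" for k
    by (simp add: appell_term_def f_def Suc_choose_two power_add mult.commute)
  ultimately show ?thesis using that by blast
qed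

lemma summable_appell_term:
  assumes "norm Q < 1"
  shows "summable (\<lambda>k. norm (appell_term Q k))"
proof -
  obtain f C where "\<And>k. norm (f k) \<le> C" "\<And>k. appell_term Q k = f k * (Q ^ k * Q ^ (k choose 2))"
    using appell_term_bounded_form[OF assms] by blast
  thus ?thesis
    using summable_bounded_gaussian[OF assms, of f C Q] by simp
qed

lemma alternating_appell_sum:
  assumes Q: "norm Q < 1" "Q \<noteq> 0"
  shows "(\<Sum>k. (- 1) ^ k * appell_term Q k) = (qinf Q Q / qinf (- Q) Q)\<^sup>2 / 4"
proof -
  have QQ: "Q ^ i * Q \<noteq> 1" "Q ^ i * (- Q) \<noteq> 1" for i
    using power_mult_neq_1[OF Q(1)] Q(1) by (metis norm_minus_cancel)+
  have s: "summable (\<lambda>k. norm (4 * ((- 1) ^ k * appell_term Q k)))"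
    using summable_mult[OF summable_appell_term[OF Q(1)], of 4]
    by (simp add: norm_mult norm_power)
  have "(\<lambda>n. \<Sum>k\<le>n. 4 * ((- 1) ^ k * appell_term Q k) * (1 / qpoch Q Q (n - k) * (1 / qpoch Q Q (n + k))))
        \<longlonglongrightarrow> (\<Sum>k. 4 * ((- 1) ^ k * appell_term Q k)) * (1 / qinf Q Q * (1 / qinf Q Q))"
    by (rule bailey_sum_tendsto[OF s]) (intro inverse_qpoch_tendsto Q QQ)+
  moreover have "(\<Sum>k\<le>n. 4 * ((- 1) ^ k * appell_term Q k) * (1 / qpoch Q Q (n - k) * (1 / qpoch Q Q (n + k))))
      = 1 / qpoch (- Q) Q n ^ 2" for n
    unfolding bailey_pair_mu[OF Q, symmetric]
    by (intro sum.cong) (auto simp: appell_term_def)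
  moreover have "(\<lambda>n. 1 / qpoch (- Q) Q n ^ 2) \<longlonglongrightarrow> 1 / qinf (- Q) Q ^ 2"
    by (intro tendsto_intros qpoch_tendsto Q) (use qinf_nonzero[OF Q(1) QQ(2)] in simp)
  ultimately have "(\<Sum>k. 4 * ((- 1) ^ k * appell_term Q k)) * (1 / qinf Q Q * (1 / qinf Q Q)) = 1 / qinf (- Q) Q ^ 2"
    using LIMSEQ_unique by auto
  moreover have "(\<Sum>k. 4 * ((- 1) ^ k * appell_term Q k)) = 4 * (\<Sum>k. (- 1) ^ k * appell_term Q k)"
    by (rule suminf_mult, rule summable_norm_cancel)
       (use summable_appell_term[OF Q(1)] in \<open>simp add: norm_mult norm_power\<close>)
  ultimately show ?thesis
    using qinf_nonzero'[OF Q(1) Q(1)] by (simp add: power2_eq_square field_simps)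
qed

text \<open>
  The sum of the terms of indices \<open>k\<close> and \<open>- k - 1\<close> of
  \<open>\<Sum> (- 1) ^ k q ^ (k (k + 1)) / (1 - q ^ (2 k + 1))\<close>.
\<close>

definition lambert_term :: "complex \<Rightarrow> nat \<Rightarrow> complex" where
  "lambert_term q k = (- 1) ^ k * q ^ (k * Suc k) * (1 + q ^ (2 * k + 1)) / (1 - q ^ (2 * k + 1))"

lemma odd_power_tendsto_0:
  fixes q :: complex
  assumes "norm q < 1"
  shows "(\<lambda>k. q ^ (2 * k + 1)) \<longlonglongrightarrow> 0"
proof -
  have "filterlim (\<lambda>k::nat. 2 * k + 1) sequentially sequentially"
    by (rule filterlim_subseq) (auto simp: strict_mono_def)
  thus ?thesis
    using filterlim_compose[OF LIMSEQ_power_zero[OF assms]] by blast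
qed

lemma power_square_form:
  fixes q :: complex
  shows "q ^ (k * Suc k) = (q\<^sup>2) ^ k * (q\<^sup>2) ^ (k choose 2)"
proof -
  have "k * Suc k = 2 * k + k * (k - 1)" by (cases k) simp_all
  thus ?thesis unfolding power2_choose_two by (simp only: power_add power_mult)
qed

lemma lambert_term_bounded_form:
  assumes q: "norm q < 1"
  obtains f C where "\<And>k. norm (f k) \<le> C" "\<And>k. lambert_term q k = f k * ((q\<^sup>2) ^ k * (q\<^sup>2) ^ (k choose 2))"
proof -
  have "(\<lambda>k. (1 + q ^ (2 * k + 1)) / (1 - q ^ (2 * k + 1))) \<longlonglongrightarrow> (1 + 0) / (1 - 0)"
    by (intro tendsto_intros odd_power_tendsto_0 q) simp
  then obtain C where C: "\<And>k. norm ((1 + q ^ (2 * k + 1)) / (1 - q ^ (2 * k + 1))) \<le> C"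
    using convergent_imp_norm_bounded by blast
  hence "norm ((- 1) ^ k * ((1 + q ^ (2 * k + 1)) / (1 - q ^ (2 * k + 1)))) \<le> C" for k
    by (simp only: norm_mult norm_power norm_minus_cancel norm_one power_one mult_1)
  moreover have "lambert_term q k = (- 1) ^ k * ((1 + q ^ (2 * k + 1)) / (1 - q ^ (2 * k + 1)))
      * ((q\<^sup>2) ^ k * (q\<^sup>2) ^ (k choose 2))" for k
    unfolding power_square_form[symmetric] lambert_term_def by simp
  ultimately show ?thesis by (rule that)
qed

lemma norm_power2_less_1:
  fixes q :: complex
  assumes "norm q < 1"
  shows "norm (q\<^sup>2) < 1"
  using assms by (simp add: norm_power power_less_one_iff abs_square_less_1)

lemma summable_lambert_term:
  assumes "norm q < 1"
  shows "summable (\<lambda>k. norm (lambert_term q k))"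
proof -
  obtain f C where fC: "\<And>k. norm (f k) \<le> C"
      "\<And>k. lambert_term q k = f k * ((q\<^sup>2) ^ k * (q\<^sup>2) ^ (k choose 2))"
    using lambert_term_bounded_form[OF assms] by blast
  show ?thesis
    unfolding fC(2) by (rule summable_bounded_gaussian[OF norm_power2_less_1[OF assms] fC(1)])
qed

lemma lambert_sum:
  assumes q: "norm q < 1" "q \<noteq> 0"
  shows "(\<Sum>k. lambert_term q k) = (qinf (q\<^sup>2) (q\<^sup>2) / qinf q (q\<^sup>2))\<^sup>2"
proof -
  have Q: "norm (q\<^sup>2) < 1" by (rule norm_power2_less_1[OF q(1)])
  have QQ: "(q\<^sup>2) ^ i * q\<^sup>2 \<noteq> 1" "(q\<^sup>2) ^ i * q \<noteq> 1" for i
    by (rule power_mult_neq_1[OF Q Q], rule power_mult_neq_1[OF Q q(1)])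
  have Y: "(\<lambda>n. 1 / qpoch (q\<^sup>2) (q\<^sup>2) (n + 1)) \<longlonglongrightarrow> 1 / qinf (q\<^sup>2) (q\<^sup>2)"
    by (rule LIMSEQ_ignore_initial_segment[OF inverse_qpoch_tendsto[OF Q QQ(1)]])
  have "(\<lambda>n. \<Sum>k\<le>n. lambert_term q k * (1 / qpoch (q\<^sup>2) (q\<^sup>2) (n - k) * (1 / qpoch (q\<^sup>2) (q\<^sup>2) (n + k + 1))))
        \<longlonglongrightarrow> (\<Sum>k. lambert_term q k) * (1 / qinf (q\<^sup>2) (q\<^sup>2) * (1 / qinf (q\<^sup>2) (q\<^sup>2)))"
    by (rule bailey_sum_tendsto[OF summable_lambert_term[OF q(1)] inverse_qpoch_tendsto[OF Q QQ(1)] Y])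
  moreover have "(\<Sum>k\<le>n. lambert_term q k * (1 / qpoch (q\<^sup>2) (q\<^sup>2) (n - k) * (1 / qpoch (q\<^sup>2) (q\<^sup>2) (n + k + 1))))
      = 1 / qpoch q (q\<^sup>2) (Suc n) ^ 2" for n
    unfolding bailey_pair_odd[OF q, symmetric]
    by (intro sum.cong) (auto simp: lambert_term_def)
  moreover have "(\<lambda>n. 1 / qpoch q (q\<^sup>2) (Suc n) ^ 2) \<longlonglongrightarrow> 1 / qinf q (q\<^sup>2) ^ 2"
    by (intro tendsto_intros LIMSEQ_Suc qpoch_tendsto Q) (use qinf_nonzero[OF Q QQ(2)] in simp)
  ultimately have "(\<Sum>k. lambert_term q k) * (1 / qinf (q\<^sup>2) (q\<^sup>2) * (1 / qinf (q\<^sup>2) (q\<^sup>2))) = 1 / qinf q (q\<^sup>2) ^ 2"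
    using LIMSEQ_unique by auto
  thus ?thesis
    using qinf_nonzero'[OF Q Q] by (simp add: power2_eq_square field_simps)
qed

text \<open>
  The sum of the terms of indices \<open>k\<close> and \<open>- k - 1\<close>, which are equal, of
  \<open>\<Sum> (- 1) ^ k p ^ ((k + 1)\<^sup>2) / (1 - p ^ (2 k + 1))\<close>.
\<close>

definition square_lambert_term :: "complex \<Rightarrow> nat \<Rightarrow> complex" where
  "square_lambert_term p k = 2 * (- 1) ^ k * p ^ (Suc k ^ 2) / (1 - p ^ (2 * k + 1))"

lemma square_lambert_eq_lambert:
  assumes p: "norm p < 1"
  shows "square_lambert_term p k = 2 * p ^ (k + 1) / (1 + p ^ (2 * k + 1)) * lambert_term p k"
proof -
  have "1 + p ^ (2 * k + 1) \<noteq> 0"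
    by (rule one_minus_power_nonzero[OF p]) simp
  moreover have "p ^ (Suc k ^ 2) = p ^ (k + 1) * p ^ (k * Suc k)"
    by (simp add: power_add[symmetric] power2_eq_square)
  ultimately show ?thesis
    by (simp add: square_lambert_term_def lambert_term_def)
qed

lemma summable_square_lambert_term:
  assumes p: "norm p < 1"
  shows "summable (\<lambda>k. norm (square_lambert_term p k))"
proof -
  have "(\<lambda>k. 2 * p ^ (k + 1) / (1 + p ^ (2 * k + 1))) \<longlonglongrightarrow> 2 * 0 / (1 + 0)"
    by (intro tendsto_intros odd_power_tendsto_0 LIMSEQ_ignore_initial_segment LIMSEQ_power_zero p) simp
  then obtain C where C: "\<And>k. norm (2 * p ^ (k + 1) / (1 + p ^ (2 * k + 1))) \<le> C"
    using convergent_imp_norm_bounded by blast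
  show ?thesis
  proof (rule summable_comparison_test')
    show "summable (\<lambda>k. C * norm (lambert_term p k))"
      by (intro summable_mult summable_lambert_term p)
    show "norm (norm (square_lambert_term p k)) \<le> C * norm (lambert_term p k)" for k
      unfolding square_lambert_eq_lambert[OF p] norm_mult[of _ "lambert_term p k"]
      using mult_right_mono[OF C[of k], of "norm (lambert_term p k)"] by simp
  qed
qed

text \<open>
  The limit \<open>n \<rightarrow> \<infinity>\<close> of \<open>mixed_partial_fractions\<close>: the value of this linear combination of
  the two sums is a product.
\<close>

lemma appell_square_lambert_relation:
  assumes p: "norm p < 1" "p \<noteq> 0" and Q_def: "Q = p\<^sup>2"
  shows "(\<Sum>k. appell_term Q k) * (qinf p Q / (qinf (- p) Q * qinf Q Q))\<^sup>2
         + (\<Sum>k. square_lambert_term p k) * (qinf (- Q) Q / (qinf (- p) Q * qinf Q Q))\<^sup>2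
         = (qinf (- p) Q / (2 * qinf (- Q) Q * qinf p Q))\<^sup>2"
proof -
  have Q: "norm Q < 1" unfolding Q_def by (rule norm_power2_less_1[OF p(1)])
  have nz: "qinf p Q \<noteq> 0" "qinf (- p) Q \<noteq> 0" "qinf Q Q \<noteq> 0" "qinf (- Q) Q \<noteq> 0"
    by (rule qinf_nonzero'[OF Q]; use p(1) Q in simp)+
  define R where "R n = qpoch p Q n / (qpoch (- p) Q n * qpoch Q Q n)" for n
  define X where "X n = qpoch (- Q) Q n / (qpoch (- p) Q (Suc n) * qpoch Q Q n)" for n
  have R: "R \<longlonglongrightarrow> qinf p Q / (qinf (- p) Q * qinf Q Q)"
    unfolding R_def by (intro tendsto_intros qpoch_tendsto Q) (use nz in simp)
  have X: "X \<longlonglongrightarrow> qinf (- Q) Q / (qinf (- p) Q * qinf Q Q)"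
    unfolding X_def by (intro tendsto_intros LIMSEQ_Suc qpoch_tendsto Q) (use nz in simp)
  have fin: "(\<Sum>m\<le>Suc n. appell_term Q m * (R (Suc n - m) * R (Suc n + m)))
       + (\<Sum>k\<le>n. square_lambert_term p k * (X (n - k) * X (Suc (n + k))))
       = qpoch (- p) Q (Suc n) ^ 2 / (4 * qpoch (- Q) Q (Suc n) ^ 2 * qpoch p Q (Suc n) ^ 2)" for n
  proof -
    have "p ^ (2 * k + 1) = p * Q ^ k" for k by (simp add: Q_def power_mult)
    thus ?thesis
      using mixed_partial_fractions[OF p Q_def, of "Suc n"]
      unfolding appell_term_def square_lambert_term_def R_def X_def
      by (simp only: lessThan_Suc_atMost diff_Suc_Suc add_Suc)
  qed
  have "(\<lambda>n. (\<Sum>m\<le>Suc n. appell_term Q m * (R (Suc n - m) * R (Suc n + m)))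
       + (\<Sum>k\<le>n. square_lambert_term p k * (X (n - k) * X (Suc (n + k)))))
     \<longlonglongrightarrow> (\<Sum>k. appell_term Q k) * (qinf p Q / (qinf (- p) Q * qinf Q Q) * (qinf p Q / (qinf (- p) Q * qinf Q Q)))
         + (\<Sum>k. square_lambert_term p k) * (qinf (- Q) Q / (qinf (- p) Q * qinf Q Q) * (qinf (- Q) Q / (qinf (- p) Q * qinf Q Q)))"
    by (intro tendsto_add LIMSEQ_Suc[OF bailey_sum_tendsto[OF summable_appell_term[OF Q] R R]]
          bailey_sum_tendsto[OF summable_square_lambert_term[OF p(1)] X LIMSEQ_Suc[OF X]])
  moreover have "(\<lambda>n. qpoch (- p) Q (Suc n) ^ 2 / (4 * qpoch (- Q) Q (Suc n) ^ 2 * qpoch p Q (Suc n) ^ 2))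
      \<longlonglongrightarrow> qinf (- p) Q ^ 2 / (4 * qinf (- Q) Q ^ 2 * qinf p Q ^ 2)"
    by (intro tendsto_intros LIMSEQ_Suc qpoch_tendsto Q) (use nz in simp)
  ultimately show ?thesis
    unfolding fin using LIMSEQ_unique
    by (fastforce simp: power2_eq_square mult_ac)
qed

section \<open>The mock theta functions as Appell--Lerch sums\<close>

lemma suminf_even_odd:
  fixes f :: "nat \<Rightarrow> complex"
  assumes "summable (\<lambda>k. norm (f k))"
  shows "summable (\<lambda>k. f (2 * k))" "summable (\<lambda>k. f (2 * k + 1))"
    and "(\<Sum>k. f k) = (\<Sum>k. f (2 * k)) + (\<Sum>k. f (2 * k + 1))"
proof -
  have pair: "(\<lambda>k. g (2 * k) + g (2 * k + 1)) sums suminf g" if "summable g"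
    for g :: "nat \<Rightarrow> 'b :: real_normed_vector"
  proof -
    have "{k * 2..<k * 2 + 2} = {2 * k, 2 * k + 1}" for k :: nat by auto
    thus ?thesis using sums_group[OF summable_sums[OF that], of 2] by simp
  qed
  have s: "summable (\<lambda>k. norm (f (2 * k)) + norm (f (2 * k + 1)))"
    using pair[OF assms] by (rule sums_summable)
  show 1: "summable (\<lambda>k. f (2 * k))"
    by (rule summable_comparison_test'[OF s]) simp
  show 2: "summable (\<lambda>k. f (2 * k + 1))"
    by (rule summable_comparison_test'[OF s]) simp
  show "(\<Sum>k. f k) = (\<Sum>k. f (2 * k)) + (\<Sum>k. f (2 * k + 1))"
    using sums_unique[OF pair[OF summable_norm_cancel[OF assms]]] suminf_add[OF 1 2] by simp
qed

lemma choose_two_odd: "(2 * k + 1) choose 2 = k * (2 * k + 1)"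
  by (induction k) (simp_all add: numeral_2_eq_2)

lemma choose_two_even: "(2 * k + 2) choose 2 = (k + 1) * (2 * k + 1)"
proof -
  have "(2 * k + 2) choose 2 = Suc (2 * k + 1) choose 2" by simp
  also have "\<dots> = k * (2 * k + 1) + (2 * k + 1)" by (simp only: Suc_choose_two choose_two_odd)
  finally show ?thesis by simp
qed

theorem mu2_eq_appell_sum:
  assumes q: "norm q < 1" "q \<noteq> 0"
  shows "mu2 q = 4 * qinf q (q\<^sup>2) / qinf (q\<^sup>2) (q\<^sup>2) * (\<Sum>k. appell_term q (2 * k))"
proof -
  define Q where "Q = q\<^sup>2"
  have Q: "norm Q < 1" "Q \<noteq> 0"
    using norm_power2_less_1[OF q(1)] q(2) by (simp_all add: Q_def)
  define a where "a k = (if k = 0 then 1 else 4 * (- 1) ^ k * Q ^ (Suc k choose 2) / (1 + Q ^ k))" for k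
  have a: "a k = 4 * ((- 1) ^ k * appell_term Q k)" for k
    by (simp add: a_def appell_term_def)
  have "summable (\<lambda>k. norm (a k))"
    unfolding a using summable_mult[OF summable_appell_term[OF Q(1)], of 4]
    by (simp add: norm_mult norm_power)
  hence "a \<longlonglongrightarrow> 0"
    by (rule summable_LIMSEQ_zero[OF summable_norm_cancel])
  then obtain K where K: "\<And>k. norm (a k) \<le> K"
    using convergent_imp_norm_bounded by blast
  have qQ: "Q ^ i * q \<noteq> 1" "Q ^ i * (1 * Q) \<noteq> 1" for i
    using power_mult_neq_1[OF Q(1) q(1)] power_mult_neq_1[OF Q(1) Q(1)] by simp_all
  have "(\<lambda>n. qpoch q Q n * (- q) ^ n * Q ^ (n choose 2) * (1 / qpoch (- Q) Q n ^ 2)) sums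
     (qinf q Q / qinf (1 * Q) Q *
       (\<Sum>k. qpoch q Q k / qpoch q Q k * (- q) ^ k * Q ^ (k choose 2) * a k))"
  proof (rule bailey_lemma[OF Q(1) q(2) qQ(2) qQ(1) _ K])
    show "1 / qpoch (- Q) Q n ^ 2 = (\<Sum>k\<le>n. a k / (qpoch Q Q (n - k) * qpoch (1 * Q) Q (n + k)))" for n
      using bailey_pair_mu[OF Q, of n] by (simp add: a_def)
  qed (simp add: Q_def power2_eq_square)
  moreover have "qpoch q Q n * (- q) ^ n * Q ^ (n choose 2) * (1 / qpoch (- Q) Q n ^ 2)
      = (- 1) ^ n * q ^ (n ^ 2) * qpoch q (q\<^sup>2) n / qpoch (- (q\<^sup>2)) (q\<^sup>2) n ^ 2" for n
  proof -
    have "n ^ 2 = n + n * (n - 1)" by (cases n) (simp_all add: power2_eq_square)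
    hence "(- q) ^ n * Q ^ (n choose 2) = (- 1) ^ n * q ^ (n ^ 2)"
      by (simp add: Q_def power2_choose_two power_add power_minus[of q] del: power2_eq_square)
    thus ?thesis by (simp add: Q_def mult_ac)
  qed
  moreover have "qpoch q Q k / qpoch q Q k * (- q) ^ k * Q ^ (k choose 2) * a k = 4 * appell_term q (2 * k)" for k
  proof (cases "k = 0")
    case False
    have e: "k + k * (k - 1) + k * Suc k = k * (2 * k + 1)"
      using False by (cases k) (simp_all add: algebra_simps)
    have "(- q) ^ k * Q ^ (k choose 2) * ((- 1) ^ k * Q ^ (Suc k choose 2)) = q ^ k * q ^ (k * (k - 1)) * q ^ (k * Suc k)"
      unfolding Q_def power2_choose_two by (simp add: power_minus[of q] mult_ac)
    also have "\<dots> = q ^ (Suc (2 * k) choose 2)"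
    proof -
      have "Suc (2 * k) choose 2 = k * (2 * k + 1)"
        using choose_two_odd[of k] by (simp only: Suc_eq_plus1)
      thus ?thesis by (simp only: power_add[symmetric] e)
    qed
    finally have "(- q) ^ k * Q ^ (k choose 2) * ((- 1) ^ k * Q ^ (Suc k choose 2)) = q ^ (Suc (2 * k) choose 2)" .
    moreover have "qpoch q Q k / qpoch q Q k * (- q) ^ k * Q ^ (k choose 2) * a k
        = 4 * ((- q) ^ k * Q ^ (k choose 2) * ((- 1) ^ k * Q ^ (Suc k choose 2))) / (1 + Q ^ k)"
      using False qpoch_nonzero[OF qQ(1), of k] by (simp add: a_def)
    ultimately show ?thesis
      using False by (simp only: appell_term_def) (simp add: Q_def power_mult)
  qed (simp add: a_def appell_term_def)
  ultimately have "(\<lambda>n. (- 1) ^ n * q ^ (n ^ 2) * qpoch q (q\<^sup>2) n / qpoch (- (q\<^sup>2)) (q\<^sup>2) n ^ 2) sums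
     (qinf q Q / qinf Q Q * (\<Sum>k. 4 * appell_term q (2 * k)))"
    by simp
  moreover have "(\<Sum>k. 4 * appell_term q (2 * k)) = 4 * (\<Sum>k. appell_term q (2 * k))"
    by (rule suminf_mult) (rule suminf_even_odd[OF summable_appell_term[OF q(1)]])
  ultimately show ?thesis
    by (simp add: mu2_def Q_def sums_iff)
qed

text \<open>
  Bailey's lemma for the pair \<open>bailey_pair_odd\<close>.  The factor \<open>1 - q\<^sup>2\<close> by which
  \<open>(q\<^sup>2; q\<^sup>2)\<^sub>n\<^sub>+\<^sub>k\<^sub>+\<^sub>1\<close> exceeds \<open>(q\<^sup>4; q\<^sup>2)\<^sub>n\<^sub>+\<^sub>k\<close> cancels.
\<close>

lemma bailey_lemma_odd:
  assumes q: "norm q < 1" "q \<noteq> 0" and \<alpha>: "\<alpha> \<noteq> 0"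
    and \<gamma>: "\<And>i. (q\<^sup>2) ^ i * \<gamma> \<noteq> 1" "\<alpha> * \<gamma> = q ^ 4"
  shows "(\<Sum>n. qpoch \<alpha> (q\<^sup>2) n * (- \<gamma>) ^ n * (q\<^sup>2) ^ (n choose 2) / qpoch q (q\<^sup>2) (Suc n) ^ 2)
         = qinf \<gamma> (q\<^sup>2) / qinf (q\<^sup>2) (q\<^sup>2) *
           (\<Sum>k. qpoch \<alpha> (q\<^sup>2) k / qpoch \<gamma> (q\<^sup>2) k * (- \<gamma>) ^ k * (q\<^sup>2) ^ (k choose 2) * lambert_term q k)"
proof -
  define Q where "Q = q\<^sup>2"
  have Q: "norm Q < 1" "Q \<noteq> 0"
    using norm_power2_less_1[OF q(1)] q(2) by (simp_all add: Q_def)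
  have Q1: "1 - Q \<noteq> 0" using one_minus_power_nonzero[OF Q(1), of 1] by simp
  have QQ: "Q ^ i * (Q * Q) \<noteq> 1" for i
    using power_mult_neq_1[OF Q(1) Q(1), of "Suc i"] by (simp add: mult_ac)
  obtain K where K: "\<And>k. norm (lambert_term q k) \<le> K"
    using convergent_imp_norm_bounded[OF summable_LIMSEQ_zero[OF
        summable_norm_cancel[OF summable_lambert_term[OF q(1)]]]] by blast
  have "(\<lambda>n. qpoch \<alpha> Q n * (- \<gamma>) ^ n * Q ^ (n choose 2) * ((1 - Q) / qpoch q Q (Suc n) ^ 2)) sums
     (qinf \<gamma> Q / qinf (Q * Q) Q *
       (\<Sum>k. qpoch \<alpha> Q k / qpoch \<gamma> Q k * (- \<gamma>) ^ k * Q ^ (k choose 2) * lambert_term q k))"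
  proof (rule bailey_lemma[OF Q(1) \<alpha> QQ _ _ K])
    fix n
    have "(1 - Q) / qpoch q Q (Suc n) ^ 2 = (1 - Q) *
        (\<Sum>k\<le>n. lambert_term q k / (qpoch Q Q (n - k) * qpoch Q Q (n + k + 1)))"
      using bailey_pair_odd[OF q, of n] by (simp add: lambert_term_def Q_def)
    also have "\<dots> = (\<Sum>k\<le>n. lambert_term q k / (qpoch Q Q (n - k) * qpoch (Q * Q) Q (n + k)))"
      unfolding sum_distrib_left using Q1 by (intro sum.cong) (simp_all add: qpoch_Suc_left)
    finally show "(1 - Q) / qpoch q Q (Suc n) ^ 2 =
        (\<Sum>k\<le>n. lambert_term q k / (qpoch Q Q (n - k) * qpoch (Q * Q) Q (n + k)))" .
  qed (use \<gamma> in \<open>simp_all add: Q_def power2_eq_square power4_eq_xxxx\<close>)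
  moreover have "qinf Q Q = (1 - Q) * qinf (Q * Q) Q"
    using qinf_split_prefix[OF Q(1), of Q 1] by simp
  hence "qinf (Q * Q) Q = qinf Q Q / (1 - Q)"
    using Q1 by simp
  ultimately have "(\<lambda>n. (1 - Q) * (qpoch \<alpha> Q n * (- \<gamma>) ^ n * Q ^ (n choose 2) / qpoch q Q (Suc n) ^ 2)) sums
     ((1 - Q) * (qinf \<gamma> Q / qinf Q Q *
       (\<Sum>k. qpoch \<alpha> Q k / qpoch \<gamma> Q k * (- \<gamma>) ^ k * Q ^ (k choose 2) * lambert_term q k)))"
    by (simp add: mult_ac)
  from sums_mult_D[OF this Q1] show ?thesis
    using Q1 by (simp add: Q_def sums_iff)
qed

text \<open>
  Fine's transformation in base \<open>q\<^sup>2\<close> at \<open>t = q\<close>, \<open>B = q\<^sup>3\<close>: the passage from the first to the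
  second Eulerian form of \<open>A2\<close> (for \<open>A = - q\<^sup>2\<close>) and of \<open>B2\<close> (for \<open>A = - q\<close>).
\<close>

lemma fine_transformation_odd:
  assumes q: "norm q < 1" "q \<noteq> 0" and A: "A \<noteq> 0"
  shows "(\<Sum>n. q ^ n * qpoch A (q\<^sup>2) n / qpoch q (q\<^sup>2) (n + 1))
       = (\<Sum>n. qpoch (q ^ 3 / A) (q\<^sup>2) n * (- (A * q)) ^ n * (q\<^sup>2) ^ (n choose 2) / qpoch q (q\<^sup>2) (Suc n) ^ 2)"
proof -
  define Q where "Q = q\<^sup>2"
  have Q: "norm Q < 1"
    using norm_power2_less_1[OF q(1)] by (simp add: Q_def)
  have q1: "1 - q \<noteq> 0" using q(1) by auto
  have q3: "q ^ 3 = q * Q" by (simp add: Q_def power2_eq_square power3_eq_cube)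
  have B: "Q ^ i * q ^ 3 \<noteq> 1" for i
    using power_mult_neq_1[OF Q q(1), of "Suc i"] by (simp add: q3 mult_ac)
  have split: "qpoch q Q (Suc n) = (1 - q) * qpoch (q ^ 3) Q n" for n
    by (simp add: q3 qpoch_Suc_left)
  have "summable (\<lambda>n. qpoch A Q n / qpoch (q ^ 3) Q n * q ^ n)"
    by (rule fine_series_summable[OF Q q(1) B])
  hence "(\<Sum>n. qpoch A Q n / qpoch (q ^ 3) Q n * q ^ n / (1 - q))
      = (\<Sum>n. qpoch A Q n / qpoch (q ^ 3) Q n * q ^ n) / (1 - q)"
    by (rule suminf_divide)
  also have "(\<Sum>n. qpoch A Q n / qpoch (q ^ 3) Q n * q ^ n)
      = (\<Sum>n. qpoch (q ^ 3 / A) Q n * (- A * q) ^ n * Q ^ (n choose 2) / (qpoch (q ^ 3) Q n * qpoch q Q (Suc n)))"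
    by (rule fine_transformation[OF Q q(1) A B])
  also have "\<dots> = (\<Sum>n. (1 - q) * (qpoch (q ^ 3 / A) Q n * (- (A * q)) ^ n * Q ^ (n choose 2) / qpoch q Q (Suc n) ^ 2))"
    using q1 by (intro suminf_cong) (simp add: split power2_eq_square)
  finally have *: "(\<Sum>n. qpoch A Q n / qpoch (q ^ 3) Q n * q ^ n / (1 - q))
      = (\<Sum>n. (1 - q) * (qpoch (q ^ 3 / A) Q n * (- (A * q)) ^ n * Q ^ (n choose 2) / qpoch q Q (Suc n) ^ 2)) / (1 - q)" .
  have s: "summable (\<lambda>n. qpoch (q ^ 3 / A) Q n * (- (A * q)) ^ n * Q ^ (n choose 2) / qpoch q Q (Suc n) ^ 2)"
  proof -
    have "(\<lambda>n. qpoch (q ^ 3 / A) Q n / qpoch q Q (Suc n) ^ 2) \<longlonglongrightarrow> qinf (q ^ 3 / A) Q / qinf q Q ^ 2"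
      by (intro tendsto_intros LIMSEQ_Suc qpoch_tendsto Q) (use qinf_nonzero'[OF Q q(1)] in simp)
    then obtain C where "\<And>n. norm (qpoch (q ^ 3 / A) Q n / qpoch q Q (Suc n) ^ 2) \<le> C"
      using convergent_imp_norm_bounded by blast
    from summable_norm_cancel[OF summable_bounded_gaussian[OF Q this, where r = "- (A * q)"]]
    show ?thesis by (simp add: mult_ac)
  qed
  have "q ^ n * qpoch A Q n / qpoch q Q (n + 1) = qpoch A Q n / qpoch (q ^ 3) Q n * q ^ n / (1 - q)" for n
    by (simp add: split mult_ac)
  thus ?thesis
    using * q1 suminf_mult[OF s, of "1 - q"] unfolding Q_def[symmetric] by simp
qed

text \<open>
  Bailey's lemma yields the terms \<open>q ^ (k (k + 1))\<close> times \<open>lambert_term q k\<close>; with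
  \<open>u = q ^ (2 k + 1)\<close>, the identity \<open>(1 + u) / (1 - u) = (1 + u\<^sup>2) / (1 - u\<^sup>2) + 2 u / (1 - u\<^sup>2)\<close>
  writes \<open>q\<close> times these terms as a sum of two terms of base \<open>q\<^sup>2\<close>.
\<close>

theorem B2_eq_lambert_sum:
  assumes q: "norm q < 1" "q \<noteq> 0"
  shows "q * B2 q = qinf (- (q\<^sup>2)) (q\<^sup>2) / qinf (q\<^sup>2) (q\<^sup>2) *
           (q * (\<Sum>k. lambert_term (q\<^sup>2) k) + (\<Sum>k. square_lambert_term (q\<^sup>2) k))"
proof -
  have Q: "norm (q\<^sup>2) < 1" by (rule norm_power2_less_1[OF q(1)])
  have mQ: "(q\<^sup>2) ^ i * - (q\<^sup>2) \<noteq> 1" for i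
    by (rule power_mult_neq_1[OF Q]) (use Q in simp)
  have e: "q ^ 3 / - q = - (q\<^sup>2)" "- (- q * q) = q\<^sup>2" "- (- (q\<^sup>2)) = q\<^sup>2"
    using q(2) by (simp_all add: power2_eq_square power3_eq_cube)
  have "B2 q = (\<Sum>n. qpoch (- (q\<^sup>2)) (q\<^sup>2) n * (q\<^sup>2) ^ n * (q\<^sup>2) ^ (n choose 2) / qpoch q (q\<^sup>2) (Suc n) ^ 2)"
    using fine_transformation_odd[OF q, of "- q"] q(2) unfolding B2_def e by simp
  also have "\<dots> = qinf (- (q\<^sup>2)) (q\<^sup>2) / qinf (q\<^sup>2) (q\<^sup>2) *
      (\<Sum>k. qpoch (- (q\<^sup>2)) (q\<^sup>2) k / qpoch (- (q\<^sup>2)) (q\<^sup>2) k * (q\<^sup>2) ^ k * (q\<^sup>2) ^ (k choose 2) * lambert_term q k)"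
    using bailey_lemma_odd[OF q _ mQ, of "- (q\<^sup>2)"] q(2) unfolding e(3) by (simp flip: power_add)
  also have "(\<Sum>k. qpoch (- (q\<^sup>2)) (q\<^sup>2) k / qpoch (- (q\<^sup>2)) (q\<^sup>2) k * (q\<^sup>2) ^ k * (q\<^sup>2) ^ (k choose 2) * lambert_term q k)
      = (\<Sum>k. q ^ (k * Suc k) * lambert_term q k)"
    unfolding power_square_form using qpoch_nonzero[OF mQ] by simp
  finally have B: "B2 q = qinf (- (q\<^sup>2)) (q\<^sup>2) / qinf (q\<^sup>2) (q\<^sup>2) * (\<Sum>k. q ^ (k * Suc k) * lambert_term q k)" .
  have termwise: "q * (q ^ (k * Suc k) * lambert_term q k) = q * lambert_term (q\<^sup>2) k + square_lambert_term (q\<^sup>2) k" for k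
  proof -
    define u where "u = q ^ (2 * k + 1)"
    define v where "v = q ^ (k * Suc k)"
    have u': "1 - u \<noteq> 0" "1 + u \<noteq> 0"
      unfolding u_def by (rule one_minus_power_nonzero[OF q(1)]; simp)+
    moreover have "1 - u\<^sup>2 = (1 - u) * (1 + u)"
      by (simp add: power2_eq_square algebra_simps)
    ultimately have u: "1 - u \<noteq> 0" "1 + u \<noteq> 0" "1 - u\<^sup>2 \<noteq> 0" by simp_all
    have u2: "(q\<^sup>2) ^ (2 * k + 1) = u\<^sup>2" "(q\<^sup>2) ^ (k * Suc k) = v\<^sup>2"
      by (simp_all only: u_def v_def power_mult[symmetric] mult.commute)
    have sq: "(q\<^sup>2) ^ (Suc k ^ 2) = q * u * v\<^sup>2"
    proof -
      have "2 * Suc k ^ 2 = 1 + (2 * k + 1) + k * Suc k * 2"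
        by (simp add: power2_eq_square algebra_simps)
      thus ?thesis by (simp only: u_def v_def power_mult[symmetric] power_add power_one_right)
    qed
    have "(1 + u) / (1 - u) = (1 + u\<^sup>2) / (1 - u\<^sup>2) + 2 * u / (1 - u\<^sup>2)"
    proof -
      have "(1 - u\<^sup>2) = (1 - u) * (1 + u)" by (simp add: power2_eq_square algebra_simps)
      moreover have "1 + u\<^sup>2 + 2 * u = (1 + u) * (1 + u)" by (simp add: power2_eq_square algebra_simps)
      ultimately show ?thesis using u by (simp add: add_divide_distrib[symmetric])
    qed
    hence "q * (v * ((- 1) ^ k * v * ((1 + u) / (1 - u))))
        = q * ((- 1) ^ k * v\<^sup>2 * ((1 + u\<^sup>2) / (1 - u\<^sup>2))) + 2 * (- 1) ^ k * (q * u * v\<^sup>2) / (1 - u\<^sup>2)"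
      by (simp add: power2_eq_square algebra_simps)
    thus ?thesis
      unfolding lambert_term_def square_lambert_term_def u2 sq u_def[symmetric] v_def[symmetric]
      by (simp add: mult.assoc)
  qed
  have s: "summable (lambert_term (q\<^sup>2))" "summable (square_lambert_term (q\<^sup>2))"
    using summable_norm_cancel[OF summable_lambert_term[OF Q]]
          summable_norm_cancel[OF summable_square_lambert_term[OF Q]] by simp_all
  have "summable (\<lambda>k. q * (q ^ (k * Suc k) * lambert_term q k))"
    unfolding termwise by (intro summable_add summable_mult s)
  hence s': "summable (\<lambda>k. q ^ (k * Suc k) * lambert_term q k)"
    using q(2) by (simp add: summable_mult_D)
  have "q * (\<Sum>k. q ^ (k * Suc k) * lambert_term q k) = (\<Sum>k. q * lambert_term (q\<^sup>2) k + square_lambert_term (q\<^sup>2) k)"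
    unfolding termwise[symmetric] by (rule suminf_mult[OF s', symmetric])
  also have "\<dots> = q * (\<Sum>k. lambert_term (q\<^sup>2) k) + (\<Sum>k. square_lambert_term (q\<^sup>2) k)"
    using suminf_add[OF summable_mult[OF s(1), of q] s(2)] suminf_mult[OF s(1), of q] by simp
  finally show ?thesis unfolding B by (simp add: mult_ac)
qed

text \<open>
  The value at \<open>- q\<close> is expanded: there the signs of the Appell--Lerch sum of \<open>A2\<close> disappear and
  its terms become those of \<open>mu2\<close> with odd instead of even index.
\<close>

theorem A2_eq_appell_sum:
  assumes q: "norm q < 1" "q \<noteq> 0"
  shows "A2 (- q) = - (qinf q (q\<^sup>2) / qinf (q\<^sup>2) (q\<^sup>2) * (\<Sum>k. appell_term q (2 * k + 1)))"
proof -
  define x where "x = - q"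
  have x: "norm x < 1" "x \<noteq> 0" using q by (simp_all add: x_def)
  have Q: "norm (x\<^sup>2) < 1" by (rule norm_power2_less_1[OF x(1)])
  have odd: "1 + x ^ (2 * k + 1) \<noteq> 0" "1 - x ^ (2 * k + 1) \<noteq> 0" for k
    using one_minus_power_nonzero[OF x(1), of "2 * k + 1"] by simp_all
  have mx: "(x\<^sup>2) ^ i * - (x ^ 3) \<noteq> 1" for i
  proof -
    have "2 * i + 3 = 2 * Suc i + 1" by simp
    hence "(x\<^sup>2) ^ i * - (x ^ 3) = - (x ^ (2 * Suc i + 1))"
      by (simp only: power_mult[symmetric] power_add[symmetric] mult_minus_right)
    thus ?thesis using odd(1)[of "Suc i"] by (metis add.inverse_inverse eq_neg_iff_add_eq_0 add.commute)
  qed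
  have e: "x ^ 3 / - (x\<^sup>2) = - x" "- (- (x\<^sup>2) * x) = x ^ 3" "- (- (x ^ 3)) = x ^ 3"
    using x(2) by (simp_all add: power2_eq_square power3_eq_cube)
  have fs: "summable (\<lambda>n. x ^ n * qpoch (- (x\<^sup>2)) (x\<^sup>2) n / qpoch x (x\<^sup>2) (n + 1))"
  proof -
    have "(\<lambda>n. qpoch (- (x\<^sup>2)) (x\<^sup>2) n / qpoch x (x\<^sup>2) (n + 1)) \<longlonglongrightarrow> qinf (- (x\<^sup>2)) (x\<^sup>2) / qinf x (x\<^sup>2)"
      by (intro tendsto_intros LIMSEQ_ignore_initial_segment qpoch_tendsto Q qinf_nonzero'[OF Q x(1)])
    then obtain C where C: "\<And>n. norm (qpoch (- (x\<^sup>2)) (x\<^sup>2) n / qpoch x (x\<^sup>2) (n + 1)) \<le> C"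
      using convergent_imp_norm_bounded by blast
    show ?thesis
    proof (rule summable_comparison_test')
      show "summable (\<lambda>n. norm x ^ n * C)"
        by (intro summable_mult2 summable_geometric) (use x in simp)
      show "norm (x ^ n * qpoch (- (x\<^sup>2)) (x\<^sup>2) n / qpoch x (x\<^sup>2) (n + 1)) \<le> norm x ^ n * C" for n
        using mult_left_mono[OF C[of n], of "norm x ^ n"] by (simp add: norm_mult norm_power norm_divide)
    qed
  qed
  have "A2 x = x * (\<Sum>n. x ^ n * qpoch (- (x\<^sup>2)) (x\<^sup>2) n / qpoch x (x\<^sup>2) (n + 1))"
    unfolding A2_def suminf_mult[OF fs, symmetric] by (simp add: mult_ac)
  also have "(\<Sum>n. x ^ n * qpoch (- (x\<^sup>2)) (x\<^sup>2) n / qpoch x (x\<^sup>2) (n + 1))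
      = (\<Sum>n. qpoch (- x) (x\<^sup>2) n * (x ^ 3) ^ n * (x\<^sup>2) ^ (n choose 2) / qpoch x (x\<^sup>2) (Suc n) ^ 2)"
    using fine_transformation_odd[OF x, of "- (x\<^sup>2)"] x(2) unfolding e by simp
  also have "\<dots> = qinf (- (x ^ 3)) (x\<^sup>2) / qinf (x\<^sup>2) (x\<^sup>2) *
      (\<Sum>k. qpoch (- x) (x\<^sup>2) k / qpoch (- (x ^ 3)) (x\<^sup>2) k * (x ^ 3) ^ k * (x\<^sup>2) ^ (k choose 2) * lambert_term x k)"
    using bailey_lemma_odd[OF x _ mx, of "- x"] x(2) unfolding e(3) by (simp add: power3_eq_cube power4_eq_xxxx)
  finally have A: "A2 x = x * (qinf (- (x ^ 3)) (x\<^sup>2) / qinf (x\<^sup>2) (x\<^sup>2) *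
      (\<Sum>k. qpoch (- x) (x\<^sup>2) k / qpoch (- (x ^ 3)) (x\<^sup>2) k * (x ^ 3) ^ k * (x\<^sup>2) ^ (k choose 2) * lambert_term x k))" .
  have termwise: "qpoch (- x) (x\<^sup>2) k / qpoch (- (x ^ 3)) (x\<^sup>2) k * (x ^ 3) ^ k * (x\<^sup>2) ^ (k choose 2) * lambert_term x k
      = - (1 + x) / x * appell_term q (2 * k + 1)" for k
  proof -
    have x3: "- x * x\<^sup>2 = - (x ^ 3)" by (simp add: power2_eq_square power3_eq_cube)
    have "qpoch (- x) (x\<^sup>2) k * (1 + x ^ (2 * k + 1)) = (1 + x) * qpoch (- (x ^ 3)) (x\<^sup>2) k"
      using qpoch_Suc[of "- x" "x\<^sup>2" k] qpoch_Suc_left[of "- x" "x\<^sup>2" k]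
      unfolding x3 by (simp add: power_mult[symmetric] mult.commute)
    hence r: "qpoch (- x) (x\<^sup>2) k / qpoch (- (x ^ 3)) (x\<^sup>2) k = (1 + x) / (1 + x ^ (2 * k + 1))"
      using qpoch_nonzero[OF mx, of k] odd(1)[of k] by (simp add: frac_eq_eq)
    have ex: "3 * k + k * (k - 1) + k * Suc k + 1 = (k + 1) * (2 * k + 1)"
      by (cases k) (simp_all add: algebra_simps)
    have "x * ((x ^ 3) ^ k * (x\<^sup>2) ^ (k choose 2) * x ^ (k * Suc k)) = x ^ (3 * k + k * (k - 1) + k * Suc k + 1)"
      by (simp only: power_add power_mult power_one_right power2_choose_two) (simp only: mult_ac)
    also have "\<dots> = x ^ ((k + 1) * (2 * k + 1))" unfolding ex ..
    also have "\<dots> = (- 1) ^ (k + 1) * q ^ ((k + 1) * (2 * k + 1))"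
    proof -
      have "(- 1 :: complex) ^ ((k + 1) * (2 * k + 1)) = ((- 1) ^ (2 * k + 1)) ^ (k + 1)"
        by (metis power_mult mult.commute)
      hence "(- 1 :: complex) ^ ((k + 1) * (2 * k + 1)) = (- 1) ^ (k + 1)"
        by simp
      thus ?thesis unfolding x_def by (simp only: power_minus[of q])
    qed
    finally have p: "(x ^ 3) ^ k * (x\<^sup>2) ^ (k choose 2) * x ^ (k * Suc k) = (- 1) ^ (k + 1) * q ^ ((k + 1) * (2 * k + 1)) / x"
      using nonzero_mult_div_cancel_left[OF x(2)] by metis
    have xq: "1 - x ^ (2 * k + 1) = 1 + q ^ (2 * k + 1)" by (simp add: x_def)
    have "qpoch (- x) (x\<^sup>2) k / qpoch (- (x ^ 3)) (x\<^sup>2) k * (x ^ 3) ^ k * (x\<^sup>2) ^ (k choose 2) * lambert_term x k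
       = (1 + x) * (- 1) ^ k * ((x ^ 3) ^ k * (x\<^sup>2) ^ (k choose 2) * x ^ (k * Suc k)) / (1 - x ^ (2 * k + 1))"
      unfolding r lambert_term_def using odd(1)[of k] by simp
    also have "\<dots> = - (1 + x) / x * (q ^ ((k + 1) * (2 * k + 1)) / (1 + q ^ (2 * k + 1)))"
      unfolding p xq by (cases "even k") (simp_all del: minus_add_distrib)
    also have "q ^ ((k + 1) * (2 * k + 1)) / (1 + q ^ (2 * k + 1)) = appell_term q (2 * k + 1)"
      using choose_two_even[of k] by (simp add: appell_term_def)
    finally show ?thesis .
  qed
  have x1: "1 + x \<noteq> 0" using odd(1)[of 0] by simp
  have "qinf (- x) (x\<^sup>2) = (1 + x) * qinf (- (x ^ 3)) (x\<^sup>2)"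
    using qinf_split_prefix[OF Q, of "- x" 1] by (simp add: power2_eq_square power3_eq_cube mult.assoc)
  hence pre: "qinf (- (x ^ 3)) (x\<^sup>2) = qinf (- x) (x\<^sup>2) / (1 + x)"
    using x1 by simp
  have "(\<Sum>k. - (1 + x) / x * appell_term q (2 * k + 1)) = - (1 + x) / x * (\<Sum>k. appell_term q (2 * k + 1))"
    by (rule suminf_mult) (rule suminf_even_odd[OF summable_appell_term[OF q(1)]])
  hence "A2 x = x * (qinf (- x) (x\<^sup>2) / (1 + x) / qinf (x\<^sup>2) (x\<^sup>2) * (- (1 + x) / x * (\<Sum>k. appell_term q (2 * k + 1))))"
    unfolding A pre termwise by simp
  also have "\<dots> = - (qinf (- x) (x\<^sup>2) / qinf (x\<^sup>2) (x\<^sup>2) * (\<Sum>k. appell_term q (2 * k + 1)))"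
    using x1 x(2) by (simp del: minus_add_distrib)
  finally show ?thesis by (simp add: x_def)
qed

section \<open>Theta functions of Gauss and the final identities\<close>

lemma square_eq_choose_two: "k + (k choose 2) + (k choose 2) = k ^ 2"
proof -
  have "k ^ 2 = k + k * (k - 1)" by (cases k) (simp_all add: power2_eq_square)
  thus ?thesis using two_times_choose_two[of k] by linarith
qed

text \<open>Bailey's lemma for the pair with \<open>\<beta> n = 0\<close> for \<open>n > 0\<close>, relative to \<open>1\<close>.\<close>

lemma bailey_unit_identity:
  assumes Q: "norm Q < 1" "Q \<noteq> 0" and \<alpha>: "\<alpha> \<noteq> 0"
    and \<gamma>: "\<And>i. Q ^ i * \<gamma> \<noteq> 1" "\<alpha> * \<gamma> = 1 * Q"
  shows "1 = qinf \<gamma> Q / qinf (1 * Q) Q *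
      (\<Sum>k. qpoch \<alpha> Q k / qpoch \<gamma> Q k * (- \<gamma>) ^ k * Q ^ (k choose 2)
            * ((- 1) ^ k * Q ^ (k choose 2) * fold_weight Q k))"
proof -
  have 1: "Q ^ i * (1 * Q) \<noteq> 1" for i
    using power_mult_neq_1[OF Q(1) Q(1)] by simp
  have K: "norm ((- 1) ^ k * Q ^ (k choose 2) * fold_weight Q k) \<le> 1 * (1 + 1)" for k
  proof -
    have "norm (fold_weight Q k) \<le> 1 + 1"
      using Q(1) norm_triangle_le[of 1 "Q ^ k" "1 + 1"]
      by (auto simp: fold_weight_def norm_power power_le_one)
    moreover have "norm ((- 1) ^ k * Q ^ (k choose 2)) \<le> 1"
      using Q(1) by (simp add: norm_mult norm_power power_le_one)
    ultimately show ?thesis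
      unfolding norm_mult[of _ "fold_weight Q k"] by (intro mult_mono) auto
  qed
  have "(\<lambda>n. qpoch \<alpha> Q n * (- \<gamma>) ^ n * Q ^ (n choose 2) * (if n = 0 then 1 else 0)) sums
     (qinf \<gamma> Q / qinf (1 * Q) Q *
       (\<Sum>k. qpoch \<alpha> Q k / qpoch \<gamma> Q k * (- \<gamma>) ^ k * Q ^ (k choose 2)
            * ((- 1) ^ k * Q ^ (k choose 2) * fold_weight Q k)))"
    by (rule bailey_lemma[OF Q(1) \<alpha> 1 \<gamma> K])
       (simp only: bailey_pair_unit[OF Q, symmetric] mult_1)
  moreover have "(\<lambda>n. qpoch \<alpha> Q n * (- \<gamma>) ^ n * Q ^ (n choose 2) * (if n = 0 then 1 else 0))
      = (\<lambda>n. if n = 0 then 1 else 0)"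
    by (rule ext) simp
  ultimately have "(\<lambda>n::nat. if n = 0 then 1 else 0 :: complex) sums
     (qinf \<gamma> Q / qinf (1 * Q) Q *
       (\<Sum>k. qpoch \<alpha> Q k / qpoch \<gamma> Q k * (- \<gamma>) ^ k * Q ^ (k choose 2)
            * ((- 1) ^ k * Q ^ (k choose 2) * fold_weight Q k)))"
    by (simp only:)
  thus ?thesis
    by (rule sums_unique2[OF sums_single[of 0 "\<lambda>_. 1 :: complex"]])
qed

text \<open>Gauss: \<open>\<phi>(-Q) = \<Sum> (- 1) ^ k Q ^ (k\<^sup>2)\<close> (over all integers) equals \<open>(Q; Q)\<^sub>\<infinity> / (- Q; Q)\<^sub>\<infinity>\<close>.\<close>

lemma gauss_square_series:
  assumes Q: "norm Q < 1" "Q \<noteq> 0"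
  shows "(\<lambda>k. if k = 0 then 1 else 2 * (- 1) ^ k * Q ^ (k ^ 2)) sums (qinf Q Q / qinf (- Q) Q)"
proof -
  have mQ: "norm (- Q) < 1" using Q by simp
  have nz: "Q ^ i * (1 * Q) \<noteq> 1" "Q ^ i * (- Q) \<noteq> 1" for i
    using power_mult_neq_1[OF Q(1) Q(1)] power_mult_neq_1[OF Q(1) mQ] by simp_all
  have "1 = qinf (- Q) Q / qinf (1 * Q) Q *
      (\<Sum>k. qpoch (- 1) Q k / qpoch (- Q) Q k * (- (- Q)) ^ k * Q ^ (k choose 2)
            * ((- 1) ^ k * Q ^ (k choose 2) * fold_weight Q k))"
    by (rule bailey_unit_identity[OF Q _ nz(2)]) auto
  moreover have coeff: "qpoch (- 1) Q k / qpoch (- Q) Q k * (- (- Q)) ^ k * Q ^ (k choose 2)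
        * ((- 1) ^ k * Q ^ (k choose 2) * fold_weight Q k)
      = (if k = 0 then 1 else 2 * (- 1) ^ k * Q ^ (k ^ 2))" for k
  proof (cases k)
    case 0
    thus ?thesis by (simp add: fold_weight_def)
  next
    case (Suc l)
    have "qpoch (- Q) Q l \<noteq> 0" "1 + Q ^ k \<noteq> 0"
      using qpoch_nonzero[OF nz(2)] one_minus_power_nonzero[OF Q(1), of k] Suc by auto
    moreover have "qpoch (- 1) Q k = 2 * qpoch (- Q) Q l"
      by (simp add: Suc qpoch_Suc_left)
    moreover have "qpoch (- Q) Q k = qpoch (- Q) Q l * (1 + Q ^ k)"
      by (simp add: Suc qpoch_Suc mult.commute)
    moreover have "fold_weight Q k = 1 + Q ^ k"
      by (simp add: Suc fold_weight_def)
    moreover have "2 * a / (a * b) * b = 2" if "a \<noteq> 0" "b \<noteq> 0" for a b :: complex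
      using that by simp
    ultimately have r: "qpoch (- 1) Q k / qpoch (- Q) Q k * fold_weight Q k = 2"
      by (simp only:)
    from square_eq_choose_two[of k] have "Q ^ k * Q ^ (k choose 2) * Q ^ (k choose 2) = Q ^ (k ^ 2)"
      by (simp only: power_add[symmetric])
    moreover have "qpoch (- 1) Q k / qpoch (- Q) Q k * (- (- Q)) ^ k * Q ^ (k choose 2)
        * ((- 1) ^ k * Q ^ (k choose 2) * fold_weight Q k)
      = qpoch (- 1) Q k / qpoch (- Q) Q k * fold_weight Q k * (- 1) ^ k
        * (Q ^ k * Q ^ (k choose 2) * Q ^ (k choose 2))"
      by (simp add: mult_ac)
    ultimately show ?thesis unfolding r using Suc by simp
  qed
  moreover have "summable (\<lambda>k. if k = 0 then 1 else 2 * (- 1) ^ k * Q ^ (k ^ 2))"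
  proof -
    have "norm (if k = 0 then 1 else 2 * (- 1) ^ k * Q ^ (k ^ 2) :: complex) \<le> 2 * norm (Q ^ k * Q ^ (k choose 2))" for k
    proof (cases "k = 0")
      case False
      from square_eq_choose_two[of k] have "Q ^ (k ^ 2) = Q ^ k * Q ^ (k choose 2) * Q ^ (k choose 2)"
        by (simp only: power_add[symmetric])
      hence "norm (Q ^ (k ^ 2)) = norm (Q ^ k * Q ^ (k choose 2)) * norm (Q ^ (k choose 2))"
        by (simp only: norm_mult)
      also have "\<dots> \<le> norm (Q ^ k * Q ^ (k choose 2)) * 1"
        using Q(1) by (intro mult_left_mono) (simp_all add: norm_power power_le_one)
      finally show ?thesis using False by (simp add: norm_mult norm_power)
    qed simp
    thus ?thesis
      by (intro summable_comparison_test'[OF summable_mult[OF gaussian_summable[OF Q(1), of Q], of 2]])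
  qed
  ultimately show ?thesis
    using qinf_nonzero'[OF Q(1) Q(1)] qinf_nonzero[OF Q(1) nz(2)]
    by (simp add: sums_iff field_simps)
qed

text \<open>Gauss: \<open>\<psi>(s) = \<Sum>\<^sub>k\<^sub>\<ge>\<^sub>0 s ^ (k (k + 1) / 2)\<close> equals \<open>(s\<^sup>2; s\<^sup>2)\<^sub>\<infinity> / (s; s\<^sup>2)\<^sub>\<infinity>\<close>.\<close>

lemma gauss_triangular_series:
  assumes s: "norm s < 1" "s \<noteq> 0"
  shows "(\<lambda>k. s ^ (Suc k choose 2)) sums (qinf (s\<^sup>2) (s\<^sup>2) / qinf s (s\<^sup>2))"
proof -
  define Q where "Q = s\<^sup>2"
  have Q: "norm Q < 1" "Q \<noteq> 0"
    using norm_power2_less_1[OF s(1)] s(2) by (simp_all add: Q_def)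
  have sQ: "Q ^ i * s \<noteq> 1" for i by (rule power_mult_neq_1[OF Q(1) s(1)])
  define t where "t k = s ^ (Suc k choose 2)" for k
  have abs: "summable (\<lambda>k. norm (t k))"
    using gaussian_summable[OF s(1), of s] by (simp add: t_def Suc_choose_two power_add mult.commute)
  define E where "E k = t (2 * k)" for k
  define O' where "O' k = t (2 * k + 1)" for k
  have sE: "summable E" and sO: "summable O'" and sum_t: "(\<Sum>k. t k) = (\<Sum>k. E k) + (\<Sum>k. O' k)"
    unfolding E_def O'_def using suminf_even_odd[OF abs] by simp_all
  have "1 = qinf s Q / qinf (1 * Q) Q *
      (\<Sum>k. qpoch s Q k / qpoch s Q k * (- s) ^ k * Q ^ (k choose 2)
            * ((- 1) ^ k * Q ^ (k choose 2) * fold_weight Q k))"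
    by (rule bailey_unit_identity[OF Q s(2) sQ]) (simp add: Q_def power2_eq_square)
  \<comment> \<open>The index \<open>k\<close> collects the triangular numbers of index \<open>2 k\<close> and \<open>2 k - 1\<close>.\<close>
  moreover have coeff: "qpoch s Q k / qpoch s Q k * (- s) ^ k * Q ^ (k choose 2)
            * ((- 1) ^ k * Q ^ (k choose 2) * fold_weight Q k)
      = E k + (if k = 0 then 0 else O' (k - 1))" for k
  proof (cases k)
    case 0
    thus ?thesis by (simp add: fold_weight_def E_def t_def Suc_choose_two)
  next
    case (Suc l)
    have ss: "(- s) ^ k * (- 1) ^ k = s ^ k"
      by (simp add: power_mult_distrib[symmetric])
    have o: "k + k * (k - 1) + k * (k - 1) = Suc (2 * l + 1) choose 2"
      using choose_two_even[of l] by (simp add: Suc algebra_simps)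
    have e: "k + k * (k - 1) + k * (k - 1) + 2 * k = Suc (2 * k) choose 2"
      using choose_two_odd[of k] by (simp add: Suc algebra_simps)
    have "qpoch s Q k / qpoch s Q k * (- s) ^ k * Q ^ (k choose 2)
            * ((- 1) ^ k * Q ^ (k choose 2) * fold_weight Q k)
        = (- s) ^ k * (- 1) ^ k * s ^ (k * (k - 1)) * s ^ (k * (k - 1)) * (1 + s ^ (2 * k))"
    proof -
      have w: "fold_weight Q k = 1 + s ^ (2 * k)"
        by (simp only: fold_weight_def Q_def power_mult) (simp add: Suc)
      have c: "Q ^ (k choose 2) = s ^ (k * (k - 1))"
        by (simp only: Q_def power2_choose_two)
      have r: "qpoch s Q k / qpoch s Q k = 1"
        using qpoch_nonzero[OF sQ, of k] by simp
      have "1 * x * y * (z * y * v) = x * z * y * y * v" for x y z v :: complex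
        by simp
      thus ?thesis unfolding w c r .
    qed
    also have "\<dots> = s ^ (k + k * (k - 1) + k * (k - 1)) + s ^ (k + k * (k - 1) + k * (k - 1) + 2 * k)"
      unfolding ss power_add by (simp only: distrib_left mult_1_right)
    also have "\<dots> = O' l + E k"
      unfolding e unfolding o by (simp only: E_def O'_def t_def)
    finally show ?thesis using Suc by simp
  qed
  moreover have "(\<lambda>k. E k + (if k = 0 then 0 else O' (k - 1))) sums ((\<Sum>k. E k) + (\<Sum>k. O' k))"
  proof (intro sums_add summable_sums[OF sE])
    show "(\<lambda>k. if k = 0 then 0 else O' (k - 1)) sums (\<Sum>k. O' k)"
      using sums_Suc[of "\<lambda>k. if k = 0 then 0 else O' (k - 1)" "\<Sum>k. O' k"] summable_sums[OF sO]
      by simp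
  qed
  ultimately have "1 = qinf s Q / qinf Q Q * (\<Sum>k. t k)"
    unfolding coeff sum_t by (simp add: sums_iff)
  hence "(\<Sum>k. t k) = qinf Q Q / qinf s Q"
    using qinf_nonzero'[OF Q(1) Q(1)] qinf_nonzero[OF Q(1) sQ] by (simp add: field_simps)
  thus ?thesis
    using summable_sums[OF summable_norm_cancel[OF abs]] by (simp add: t_def[abs_def] Q_def)
qed

lemma norm_power_less_1:
  fixes q :: complex
  assumes "norm q < 1" "m > 0"
  shows "norm (q ^ m) < 1"
  using assms by (simp add: norm_power power_less_one_iff)

lemma Theta_nonzero:
  assumes "norm q < 1" "m > 0"
  shows "Theta m q \<noteq> 0"
  unfolding Theta_eq_qinf using assms by (intro qinf_nonzero' norm_power_less_1)

lemma qinf_odd_eq_Theta: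
  assumes q: "norm q < 1" and m: "m > 0" "n = 2 * m"
  shows "qinf (q ^ m) (q ^ n) = Theta m q / Theta n q"
proof -
  have "qinf (q ^ m) ((q ^ m)\<^sup>2) * qinf (q ^ m * q ^ m) ((q ^ m)\<^sup>2) = qinf (q ^ m) (q ^ m)"
    by (rule qinf_even_odd[OF norm_power_less_1[OF q m(1)]])
  moreover have "q ^ m * q ^ m = q ^ n" "(q ^ m)\<^sup>2 = q ^ n"
    by (simp_all only: m(2) mult_2 power_add power2_eq_square)
  ultimately show ?thesis
    using Theta_nonzero[OF q, of n] m by (simp add: Theta_eq_qinf nonzero_eq_divide_eq)
qed

lemma qinf_minus_eq_Theta:
  assumes q: "norm q < 1" and m: "m > 0" "n = 2 * m"
  shows "qinf (- (q ^ m)) (q ^ m) = Theta n q / Theta m q"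
proof -
  have "qinf (q ^ m) (q ^ m) * qinf (- (q ^ m)) (q ^ m) = qinf ((q ^ m)\<^sup>2) ((q ^ m)\<^sup>2)"
    by (rule qinf_pm[OF norm_power_less_1[OF q m(1)]])
  moreover have "(q ^ m)\<^sup>2 = q ^ n"
    by (simp add: m(2) power_mult[symmetric] mult.commute)
  ultimately show ?thesis
    using Theta_nonzero[OF q, of m] m by (simp add: Theta_eq_qinf nonzero_eq_divide_eq mult.commute)
qed

lemma qinf_minus_odd_eq_Theta:
  assumes q: "norm q < 1" and m: "m > 0" "n = 2 * m" "l = 4 * m"
  shows "qinf (- (q ^ m)) (q ^ n) = Theta n q ^ 2 / (Theta m q * Theta l q)"
proof -
  have n: "n > 0" "l = 2 * n" using m by auto
  have "qinf (q ^ m) (q ^ n) * qinf (- (q ^ m)) (q ^ n) = qinf ((q ^ m)\<^sup>2) ((q ^ n)\<^sup>2)"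
    by (rule qinf_pm[OF norm_power_less_1[OF q n(1)]])
  moreover have "(q ^ m)\<^sup>2 = q ^ n" "(q ^ n)\<^sup>2 = q ^ l"
    by (simp_all add: m(2) n(2) power_mult[symmetric] mult.commute)
  ultimately have "Theta m q / Theta n q * qinf (- (q ^ m)) (q ^ n) = Theta n q / Theta l q"
    using qinf_odd_eq_Theta[OF q m(1,2)] qinf_odd_eq_Theta[OF q n] by simp
  thus ?thesis
    using Theta_nonzero[OF q, of m] Theta_nonzero[OF q, of n] Theta_nonzero[OF q, of l] m n
    by (simp add: field_simps power2_eq_square)
qed

lemma Theta_1_minus:
  assumes q: "norm q < 1"
  shows "qinf (- q) (- q) = Theta 2 q ^ 3 / (Theta 1 q * Theta 4 q)"
proof -
  have "qinf (- q) ((- q)\<^sup>2) * qinf (- q * - q) ((- q)\<^sup>2) = qinf (- q) (- q)"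
    by (rule qinf_even_odd) (use q in simp)
  hence "qinf (- q) (- q) = qinf (- (q ^ 1)) (q ^ 2) * qinf (q ^ 2) (q ^ 2)"
    by (simp add: power2_eq_square)
  also have "qinf (- (q ^ 1)) (q ^ 2) = Theta 2 q ^ 2 / (Theta 1 q * Theta 4 q)"
    by (rule qinf_minus_odd_eq_Theta[OF q]) auto
  finally show ?thesis
    by (simp add: Theta_eq_qinf power2_eq_square power3_eq_cube)
qed

text \<open>
  The dissection \<open>\<phi>(\<plusminus> q) = \<phi>(q ^ 4) \<plusminus> 2 q \<psi>(q ^ 8)\<close>, with the theta functions of Gauss
  written as products.
\<close>

lemma phi_dissection:
  assumes q: "norm q < 1" "q \<noteq> 0"
  shows "Theta 1 q ^ 2 / Theta 2 q
         = Theta 8 q ^ 5 / (Theta 4 q ^ 2 * Theta 16 q ^ 2) - 2 * q * (Theta 16 q ^ 2 / Theta 8 q)"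
    and "Theta 2 q ^ 5 / (Theta 1 q ^ 2 * Theta 4 q ^ 2)
         = Theta 8 q ^ 5 / (Theta 4 q ^ 2 * Theta 16 q ^ 2) + 2 * q * (Theta 16 q ^ 2 / Theta 8 q)"
proof -
  define \<phi> where "\<phi> x = (\<lambda>k. if k = 0 then 1 else 2 * (- 1) ^ k * x ^ (k ^ 2))" for x :: complex
  have \<phi>: "\<phi> x sums (qinf x x / qinf (- x) x)" if "norm x < 1" "x \<noteq> 0" for x
    unfolding \<phi>_def by (rule gauss_square_series[OF that])
  have dissect: "(\<Sum>k. \<phi> x k) = (\<Sum>k. \<phi> (- (x ^ 4)) k) - 2 * x * (\<Sum>k. (x ^ 8) ^ (Suc k choose 2))"
    if x: "norm x < 1" "x \<noteq> 0" for x
  proof -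
    have n8: "norm (x ^ 8) < 1" "x ^ 8 \<noteq> 0" and n4: "norm (- (x ^ 4)) < 1" "- (x ^ 4) \<noteq> 0"
      using x norm_power_less_1[OF x(1)] by simp_all
    have even: "\<phi> x (2 * k) = \<phi> (- (x ^ 4)) k" for k
    proof (cases "k = 0")
      case False
      have "(- 1) ^ k * (- (x ^ 4)) ^ (k ^ 2) = (x ^ 4) ^ (k ^ 2)"
        by (cases "even k") simp_all
      moreover have "x ^ ((2 * k) ^ 2) = (x ^ 4) ^ (k ^ 2)"
        by (simp only: power_mult[symmetric] power_mult_distrib) simp
      ultimately show ?thesis using False by (simp add: \<phi>_def mult.assoc)
    qed (simp add: \<phi>_def)
    have odd: "\<phi> x (2 * k + 1) = - (2 * x * (x ^ 8) ^ (Suc k choose 2))" for k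
    proof -
      have "8 * (Suc k choose 2) = 4 * (Suc k * k)"
        using two_times_choose_two[of "Suc k"] by simp
      hence "(2 * k + 1) ^ 2 = Suc (8 * (Suc k choose 2))"
        by (simp add: power2_eq_square algebra_simps)
      hence "x ^ ((2 * k + 1) ^ 2) = x * (x ^ 8) ^ (Suc k choose 2)"
        by (simp only: power_Suc power_mult)
      thus ?thesis by (simp add: \<phi>_def mult.assoc)
    qed
    have E: "summable (\<lambda>k. \<phi> x (2 * k))"
      unfolding even using sums_summable[OF \<phi>[OF n4]] .
    have O': "summable (\<lambda>k. (x ^ 8) ^ (Suc k choose 2))"
      by (rule sums_summable[OF gauss_triangular_series[OF n8]])
    hence O: "summable (\<lambda>k. \<phi> x (2 * k + 1))"
      unfolding odd by (intro summable_minus summable_mult)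
    have "{k * 2..<k * 2 + 2} = {2 * k, 2 * k + 1}" for k :: nat by auto
    hence "(\<lambda>k. \<phi> x (2 * k) + \<phi> x (2 * k + 1)) sums (\<Sum>k. \<phi> x k)"
      using sums_group[OF summable_sums[OF sums_summable[OF \<phi>[OF x]]], of 2] by simp
    hence "(\<Sum>k. \<phi> x k) = (\<Sum>k. \<phi> x (2 * k)) + (\<Sum>k. \<phi> x (2 * k + 1))"
      using suminf_add[OF E O] by (simp add: sums_iff)
    thus ?thesis
      unfolding even odd using suminf_minus[OF summable_mult[OF O', of "2 * x"]] suminf_mult[OF O', of "2 * x"]
      by simp
  qed
  have T8: "(\<Sum>k. (x ^ 8) ^ (Suc k choose 2)) = Theta 16 q ^ 2 / Theta 8 q"
    if "x ^ 8 = q ^ 8" for x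
  proof -
    have "norm (q ^ 8) < 1" "q ^ 8 \<noteq> 0" using q norm_power_less_1[OF q(1)] by simp_all
    from sums_unique[OF gauss_triangular_series[OF this]]
    have "(\<Sum>k. (q ^ 8) ^ (Suc k choose 2)) = qinf (q ^ 16) (q ^ 16) / qinf (q ^ 8) (q ^ 16)"
      by (simp add: power_mult[symmetric])
    thus ?thesis
      unfolding that using qinf_odd_eq_Theta[OF q(1), of 8 16]
      by (simp add: Theta_eq_qinf power2_eq_square)
  qed
  have phi_minus: "(\<Sum>k. \<phi> (- x) k) = Theta 2 x ^ 5 / (Theta 1 x ^ 2 * Theta 4 x ^ 2)"
    if x: "norm x < 1" "x \<noteq> 0" for x
  proof -
    have "(\<Sum>k. \<phi> (- x) k) = qinf (- x) (- x) / qinf x (- x)"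
      using sums_unique[OF \<phi>[of "- x"]] x by simp
    also have "qinf (- x) (- x) * qinf x (- x) = Theta 2 x"
      using qinf_pm[of "- x" "- x"] x by (simp add: Theta_eq_qinf)
    hence "qinf x (- x) = Theta 2 x / qinf (- x) (- x)"
      using qinf_nonzero'[of "- x" "- x"] x by (simp add: nonzero_eq_divide_eq mult.commute)
    finally show ?thesis
      unfolding Theta_1_minus[OF x(1)]
      using Theta_nonzero[OF x(1), of 1] Theta_nonzero[OF x(1), of 2] Theta_nonzero[OF x(1), of 4]
      by (simp add: field_simps eval_nat_numeral)
  qed
  have T: "Theta m (q ^ 4) = Theta (4 * m) q" for m
    by (simp add: Theta_eq_qinf power_mult)
  have n4: "norm (q ^ 4) < 1" "q ^ 4 \<noteq> 0" using q norm_power_less_1[OF q(1)] by simp_all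
  have P4: "(\<Sum>k. \<phi> (- (q ^ 4)) k) = Theta 8 q ^ 5 / (Theta 4 q ^ 2 * Theta 16 q ^ 2)"
    using phi_minus[OF n4] by (simp add: T)
  have "(\<Sum>k. \<phi> q k) = Theta 1 q ^ 2 / Theta 2 q"
    using sums_unique[OF \<phi>[OF q]] qinf_minus_eq_Theta[OF q(1), of 1 2]
    by (simp add: Theta_eq_qinf power2_eq_square)
  thus "Theta 1 q ^ 2 / Theta 2 q
      = Theta 8 q ^ 5 / (Theta 4 q ^ 2 * Theta 16 q ^ 2) - 2 * q * (Theta 16 q ^ 2 / Theta 8 q)"
    using dissect[OF q] P4 T8[OF refl] by simp
  have "norm (- q) < 1" "- q \<noteq> 0" using q by simp_all
  from dissect[OF this] show "Theta 2 q ^ 5 / (Theta 1 q ^ 2 * Theta 4 q ^ 2)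
      = Theta 8 q ^ 5 / (Theta 4 q ^ 2 * Theta 16 q ^ 2) + 2 * q * (Theta 16 q ^ 2 / Theta 8 q)"
    using P4 T8[of "- q"] phi_minus[OF q] by simp
qed

text \<open>\<open>\<phi>(q)\<^sup>2 = \<phi>(q\<^sup>2)\<^sup>2 + 4 q \<psi>(q ^ 4)\<^sup>2\<close>, with the theta functions written as products.\<close>

lemma phi_square_dissection:
  assumes q: "norm q < 1" "q \<noteq> 0"
  shows "(Theta 2 q ^ 5 / (Theta 1 q ^ 2 * Theta 4 q ^ 2))\<^sup>2
         = (Theta 4 q ^ 5 / (Theta 2 q ^ 2 * Theta 8 q ^ 2))\<^sup>2 + 4 * q * (Theta 8 q ^ 2 / Theta 4 q)\<^sup>2"
proof -
  have nz: "Theta m q \<noteq> 0" if "m > 0" for m by (rule Theta_nonzero[OF q(1) that])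
  define s where "s = csqrt q"
  have s: "s\<^sup>2 = q" by (simp add: s_def)
  have "norm s ^ 2 < 1"
    using q(1) by (metis norm_power s)
  hence s1: "norm s < 1" "s \<noteq> 0"
    using q(2) s by (auto simp: abs_square_less_1)
  have T: "Theta m q = Theta (2 * m) s" for m
    by (simp only: Theta_eq_qinf power_mult s)
  have n: "Theta 1 s \<noteq> 0" "Theta 2 s \<noteq> 0" "Theta 4 s \<noteq> 0"
    by (rule Theta_nonzero[OF s1(1)]; simp)+
  \<comment> \<open>The two dissections at the square root \<open>s\<close> of \<open>q\<close>, multiplied.\<close>
  have "Theta 1 s ^ 2 / Theta 2 s * (Theta 2 s ^ 5 / (Theta 1 s ^ 2 * Theta 4 s ^ 2))
      = (Theta 8 s ^ 5 / (Theta 4 s ^ 2 * Theta 16 s ^ 2))\<^sup>2 - 4 * s\<^sup>2 * (Theta 16 s ^ 2 / Theta 8 s)\<^sup>2"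
    unfolding phi_dissection[OF s1] by (simp add: algebra_simps power2_eq_square)
  moreover have "Theta 1 s ^ 2 / Theta 2 s * (Theta 2 s ^ 5 / (Theta 1 s ^ 2 * Theta 4 s ^ 2))
      = (Theta 2 s ^ 2 / Theta 4 s)\<^sup>2"
    using n by (simp add: field_simps eval_nat_numeral)
  ultimately have minus: "(Theta 1 q ^ 2 / Theta 2 q)\<^sup>2
      = (Theta 4 q ^ 5 / (Theta 2 q ^ 2 * Theta 8 q ^ 2))\<^sup>2 - 4 * q * (Theta 8 q ^ 2 / Theta 4 q)\<^sup>2"
    by (simp add: T s)
  have "(Theta 2 q ^ 5 / (Theta 1 q ^ 2 * Theta 4 q ^ 2))\<^sup>2 - (Theta 1 q ^ 2 / Theta 2 q)\<^sup>2
      = 8 * q * (Theta 8 q ^ 5 / (Theta 4 q ^ 2 * Theta 16 q ^ 2) * (Theta 16 q ^ 2 / Theta 8 q))"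
    unfolding phi_dissection[OF q] by (simp add: algebra_simps power2_eq_square)
  also have "Theta 8 q ^ 5 / (Theta 4 q ^ 2 * Theta 16 q ^ 2) * (Theta 16 q ^ 2 / Theta 8 q) = (Theta 8 q ^ 2 / Theta 4 q)\<^sup>2"
    using nz[of 4] nz[of 8] nz[of 16] by (simp add: field_simps eval_nat_numeral)
  finally show ?thesis using minus by (simp add: algebra_simps)
qed

theorem theorem2p1:
  fixes \<tau> q :: complex
  assumes "Im \<tau> > 0"
    and "q = exp (2 * of_real pi * \<i> * \<tau>)"
  shows "q * B2 q - 2 * A2 (- (q ^ 4)) =
           q * (Theta 2 q / Theta 1 q ^ 2) * (Theta 4 q ^ 5 * Theta 16 q ^ 2 / Theta 8 q ^ 5)
       \<and> q * B2 q + 1 / 2 * mu2 (q ^ 4) =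
           1 / 2 * (Theta 2 q / Theta 1 q ^ 2) * (Theta 4 q ^ 3 * Theta 8 q / Theta 16 q ^ 2)
       \<and> q * B2 q + 1 / 4 * mu2 (q ^ 4) - A2 (- (q ^ 4)) =
           1 / 4 * (Theta 2 q ^ 6 / Theta 1 q ^ 4) * (Theta 4 q ^ 3 / Theta 8 q ^ 4)"
proof -
  have "norm q = exp (- (2 * pi * Im \<tau>))"
    unfolding assms(2) norm_exp_eq_Re by simp
  hence q: "norm q < 1" "q \<noteq> 0"
    using assms by simp_all
  define t1 where "t1 = Theta 1 q"
  define t2 where "t2 = Theta 2 q"
  define t4 where "t4 = Theta 4 q"
  define t8 where "t8 = Theta 8 q"
  define t16 where "t16 = Theta 16 q"
  note t = t1_def t2_def t4_def t8_def t16_def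
  have nz: "t1 \<noteq> 0" "t2 \<noteq> 0" "t4 \<noteq> 0" "t8 \<noteq> 0" "t16 \<noteq> 0"
    unfolding t by (rule Theta_nonzero[OF q(1)]; simp)+
  define c where "c = t4 / t8 / t8"
  define p where "p = q\<^sup>2"
  define Q where "Q = q ^ 4"
  have p: "norm p < 1" "p \<noteq> 0" and Q: "norm Q < 1" "Q \<noteq> 0"
    using norm_power_less_1[OF q(1)] q(2) by (simp_all add: p_def Q_def)
  have powers: "p\<^sup>2 = Q" "Q\<^sup>2 = q ^ 8"
    by (simp_all add: p_def Q_def power_mult[symmetric])
  define S0 where "S0 = (\<Sum>k. appell_term Q (2 * k))"
  define S1 where "S1 = (\<Sum>k. appell_term Q (2 * k + 1))"
  define L where "L = (\<Sum>k. square_lambert_term p k)"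
  have sum: "(\<Sum>k. appell_term Q k) = S0 + S1"
    unfolding S0_def S1_def by (rule suminf_even_odd(3)[OF summable_appell_term[OF Q(1)]])
  have "summable (\<lambda>k. norm ((- 1) ^ k * appell_term Q k))"
    using summable_appell_term[OF Q(1)] by (simp add: norm_mult norm_power)
  from suminf_even_odd(3)[OF this]
  have "(\<Sum>k. (- 1) ^ k * appell_term Q k) = S0 + (\<Sum>k. - appell_term Q (2 * k + 1))"
    by (simp add: S0_def)
  also have "(\<Sum>k. - appell_term Q (2 * k + 1)) = - S1"
    unfolding S1_def by (rule suminf_minus) (rule suminf_even_odd(2)[OF summable_appell_term[OF Q(1)]])
  finally have alt: "(\<Sum>k. (- 1) ^ k * appell_term Q k) = S0 - S1" by simp
  have products:
    "qinf Q (Q\<^sup>2) = t4 / t8" "qinf (Q\<^sup>2) (Q\<^sup>2) = t8" "qinf Q Q = t4" "qinf (- Q) Q = t8 / t4"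
    "qinf p Q = t2 / t4" "qinf (- p) Q = t4\<^sup>2 / (t2 * t8)" "qinf (- p) p = t4 / t2" "qinf p p = t2"
    unfolding powers unfolding p_def Q_def t
    by (rule qinf_odd_eq_Theta[OF q(1)] qinf_minus_eq_Theta[OF q(1)] qinf_minus_odd_eq_Theta[OF q(1)]
          Theta_eq_qinf[symmetric]; simp)+
  have mu: "mu2 (q ^ 4) = 4 * c * S0"
    using mu2_eq_appell_sum[OF Q] by (simp add: c_def products S0_def flip: Q_def)
  have A: "A2 (- (q ^ 4)) = - (c * S1)"
    using A2_eq_appell_sum[OF Q] by (simp add: c_def products S1_def flip: Q_def)
  have "(\<Sum>k. lambert_term p k) = (t4 / (t2 / t4))\<^sup>2"
    using lambert_sum[OF p] by (simp only: powers products)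
  hence B: "q * B2 q = t4 / t2 / t2 * (q * (t4 / (t2 / t4))\<^sup>2 + L)"
    using B2_eq_lambert_sum[OF q] by (simp only: p_def[symmetric] products L_def)
  have diff: "S0 - S1 = (t4 / (t8 / t4))\<^sup>2 / 4"
    using alternating_appell_sum[OF Q] by (simp only: alt products)
  have "(S0 + S1) * (t2 / t4 / (t4\<^sup>2 / (t2 * t8) * t4))\<^sup>2 + L * (t8 / t4 / (t4\<^sup>2 / (t2 * t8) * t4))\<^sup>2
      = (t4\<^sup>2 / (t2 * t8) / (2 * (t8 / t4) * (t2 / t4)))\<^sup>2"
    using appell_square_lambert_relation[OF p powers(1)[symmetric]] by (simp only: sum products L_def)
  moreover have "c * (S0 + S1) + t4 / t2 / t2 * L
      = t4 ^ 9 / (t2 ^ 4 * t8 ^ 4) *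
        ((S0 + S1) * (t2 / t4 / (t4\<^sup>2 / (t2 * t8) * t4))\<^sup>2 + L * (t8 / t4 / (t4\<^sup>2 / (t2 * t8) * t4))\<^sup>2)"
    unfolding c_def using nz by (simp add: field_simps eval_nat_numeral)
  moreover have "t4 ^ 9 / (t2 ^ 4 * t8 ^ 4) * (t4\<^sup>2 / (t2 * t8) / (2 * (t8 / t4) * (t2 / t4)))\<^sup>2
      = t4 ^ 17 / (4 * t2 ^ 8 * t8 ^ 8)"
    using nz by (simp add: field_simps eval_nat_numeral)
  ultimately have mixed: "c * (S0 + S1) + t4 / t2 / t2 * L = t4 ^ 17 / (4 * t2 ^ 8 * t8 ^ 8)"
    by simp
  \<comment> \<open>\<open>G\<close> is \<open>q \<psi>(q ^ 8)\<close>, and \<open>d1\<close> and \<open>d2\<close> are \<open>\<phi>(- q)\<close> and \<open>\<phi>(q)\<close>.\<close>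
  define G where "G = q * (t16\<^sup>2 / t8)"
  have d1: "t1\<^sup>2 / t2 = t8 ^ 5 / (t4\<^sup>2 * t16\<^sup>2) - 2 * G"
   and d2: "t2 ^ 5 / (t1\<^sup>2 * t4\<^sup>2) = t8 ^ 5 / (t4\<^sup>2 * t16\<^sup>2) + 2 * G"
    using phi_dissection[OF q] by (simp_all add: t G_def mult.assoc)
  have d3: "(t2 ^ 5 / (t1\<^sup>2 * t4\<^sup>2))\<^sup>2 = (t4 ^ 5 / (t2\<^sup>2 * t8\<^sup>2))\<^sup>2 + 4 * q * (t8\<^sup>2 / t4)\<^sup>2"
    using phi_square_dissection[OF q] by (simp only: t)
  have X: "q * B2 q + c * (S0 + S1) = 1 / 4 * (t2 ^ 6 / t1 ^ 4) * (t4 ^ 3 / t8 ^ 4)"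
  proof -
    have "q * B2 q + c * (S0 + S1) = q * (t4 / t2 / t2 * (t4 / (t2 / t4))\<^sup>2) + t4 ^ 17 / (4 * t2 ^ 8 * t8 ^ 8)"
      unfolding mixed[symmetric] B by (simp add: algebra_simps)
    also have "\<dots> = t4 ^ 7 / (4 * t2 ^ 4 * t8 ^ 4) * ((t4 ^ 5 / (t2\<^sup>2 * t8\<^sup>2))\<^sup>2 + 4 * q * (t8\<^sup>2 / t4)\<^sup>2)"
      using nz by (simp add: field_simps eval_nat_numeral)
    also have "\<dots> = 1 / 4 * (t2 ^ 6 / t1 ^ 4) * (t4 ^ 3 / t8 ^ 4)"
      unfolding d3[symmetric] using nz by (simp add: field_simps eval_nat_numeral)
    finally show ?thesis .
  qed
  have Y: "c * (S0 - S1) = t2 * t4 ^ 5 / (4 * t1\<^sup>2 * t8 ^ 4) * (t1\<^sup>2 / t2)"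
    unfolding diff c_def using nz by (simp add: field_simps eval_nat_numeral)
  have X': "q * B2 q + c * (S0 + S1)
      = t2 * t4 ^ 5 / (4 * t1\<^sup>2 * t8 ^ 4) * (t2 ^ 5 / (t1\<^sup>2 * t4\<^sup>2))"
    unfolding X using nz by (simp add: field_simps eval_nat_numeral)
  have "q * B2 q - 2 * A2 (- (q ^ 4))
      = (q * B2 q + c * (S0 + S1)) - c * (S0 - S1)"
    unfolding A by (simp add: algebra_simps)
  also have "\<dots> = t2 * t4 ^ 5 / (4 * t1\<^sup>2 * t8 ^ 4) * (4 * G)"
    unfolding X' Y d1 d2 right_diff_distrib[symmetric] by simp
  also have "\<dots> = q * (t2 / t1\<^sup>2) * (t4 ^ 5 * t16\<^sup>2 / t8 ^ 5)"
    unfolding G_def using nz by (simp add: field_simps eval_nat_numeral)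
  finally have first: "q * B2 q - 2 * A2 (- (q ^ 4)) = q * (t2 / t1\<^sup>2) * (t4 ^ 5 * t16\<^sup>2 / t8 ^ 5)" .
  have "q * B2 q + 1 / 2 * mu2 (q ^ 4)
      = (q * B2 q + c * (S0 + S1)) + c * (S0 - S1)"
    unfolding mu by (simp add: algebra_simps)
  also have "\<dots> = t2 * t4 ^ 5 / (4 * t1\<^sup>2 * t8 ^ 4) * (2 * (t8 ^ 5 / (t4\<^sup>2 * t16\<^sup>2)))"
    unfolding X' Y d1 d2 distrib_left[symmetric] by simp
  also have "\<dots> = 1 / 2 * (t2 / t1\<^sup>2) * (t4 ^ 3 * t8 / t16\<^sup>2)"
    using nz by (simp add: field_simps eval_nat_numeral)
  finally have second: "q * B2 q + 1 / 2 * mu2 (q ^ 4) = 1 / 2 * (t2 / t1\<^sup>2) * (t4 ^ 3 * t8 / t16\<^sup>2)" .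
  have "q * B2 q + 1 / 4 * mu2 (q ^ 4) - A2 (- (q ^ 4)) = q * B2 q + c * (S0 + S1)"
    unfolding mu A by (simp add: algebra_simps)
  with first second X show ?thesis
    unfolding t by simp
qed

end
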